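(* Let $d\in\mathbb{N}$ and let $\mathcal{V}\in C^1(\mathbb{R}^d;\mathbb{R})$ be bounded from below with $\nabla\mathcal{V}$ antisymmetric (i.e. $\nabla\mathcal{V}(-x)=-\nabla\mathcal{V}(x)$ for all $x$), uniformly continuous, locally Lipschitz continuous and bounded. Moreover, assume that $\nabla\mathcal{V}(x)\cdot x<0$ for all $x\in\mathbb{R}^d\setminus\{0\}$. Let $\psi\in C(\mathbb{R}_{\ge 0};\mathbb{R}_{\ge 0})$ be bounded and locally Lipschitz continuous and assume that there exists $\underline{\psi}>0$ with $\psi(x)\ge\underline{\psi}$ for all $x\in\mathbb{R}_{\ge 0}$. Then there exists $f_0\in\mathcal{P}_c(\mathbb{R}^d\times\mathbb{R}^d)$ such that the corresponding solution $(f_t)_{t\ge 0}$ of the mean-field equation (in the weak sense stated in the context) with initial condition $f_0$ has no limit point in $\mathcal{P}_2(\mathbb{R}^d\times\mathbb{R}^d)$ as $t\to\infty$; that is, for any sequence $(t_n)_{n\in\mathbb{N}}\subseteq\mathbb{R}_{\ge 0}$ with $t_n\to\infty$, the sequence $(f_{t_n})_{n\in\mathbb{N}}$ does not converge in $\mathcal{P}_2(\mathbb{R}^d\times\mathbb{R}^d)$.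
   Context: $\mathcal{P}_2(\mathbb{R}^d\times\mathbb{R}^d)$ is the set of Borel probability measures on $\mathbb{R}^d\times\mathbb{R}^d$ with finite second moment, equipped with the $2$-Wasserstein distance. $\mathcal{P}_c(\mathbb{R}^d\times\mathbb{R}^d)$ is the set of compactly supported Borel probability measures, equipped with the $\infty$-Wasserstein distance $\mathcal{W}_\infty(\mu,\nu)=\inf_{\pi\in\Pi(\mu,\nu)}\sup\{|(x-x',y-y')| : (x,y,x',y')\in\mathrm{supp}(\pi)\}$, where $\Pi(\mu,\nu)$ is the set of couplings of $\mu$ and $\nu$. Given $f_0\in\mathcal{P}_c(\mathbb{R}^d\times\mathbb{R}^d)$ and $\bar v:=\int v\,\mathrm{d}f_0(r,v)$, the solution of the mean-field equation with initial condition $f_0$ is the (unique) $f\in C([0,\infty);\mathcal{P}_c(\mathbb{R}^d\times\mathbb{R}^d))$, $t\mapsto f_t$, such that for all test functions $h\in C_c^\infty([0,\infty)\times\mathbb{R}^d\times\mathbb{R}^d)$ $$\int_0^\infty\!\!\int\big(\partial_t h_t(r,v)+(v-\bar v)\cdot\nabla_r h_t(r,v)\big)\,\mathrm{d}f_t(r,v)\,\mathrm{d}t+\int h_0(r,v)\,\mathrm{d}f_0(r,v)$$ $$=\int_0^\infty\!\!\int\Big(\int\big[\psi(|r-r'|)(v-v')-\nabla\mathcal{V}(r'-r)\big]\,\mathrm{d}f_t(r',v')\Big)\cdot\nabla_v h_t(r,v)\,\mathrm{d}f_t(r,v)\,\mathrm{d}t.$$ *)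

theory Defs
  imports "HOL-Probability.Probability"
begin

section \<open>Regularity of functions\<close>

definition grad :: "('a::real_inner \<Rightarrow> real) \<Rightarrow> 'a \<Rightarrow> 'a" where
  "grad f x = (THE D. GDERIV f x :> D)"

definition locally_lipschitz_on :: "'a::metric_space set \<Rightarrow> ('a \<Rightarrow> 'b::metric_space) \<Rightarrow> bool" where
  "locally_lipschitz_on S f \<longleftrightarrow>
     (\<forall>x\<in>S. \<exists>u>0. \<exists>L. L-lipschitz_on (cball x u \<inter> S) f)"

text \<open>Derivatives are taken within \<open>S\<close>, hence one-sided on the boundary. This is used for
  \<open>S = UNIV\<close> and for the half-space \<open>{0..} \<times> UNIV\<close>, on both of which the derivative
  within \<open>S\<close> is unique, so that the choice in \<^const>\<open>frechet_derivative\<close> is harmless.\<close>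

primrec C_k_on :: "nat \<Rightarrow> 'a::euclidean_space set \<Rightarrow> ('a \<Rightarrow> real) \<Rightarrow> bool" where
  "C_k_on 0 S f \<longleftrightarrow> continuous_on S f"
| "C_k_on (Suc k) S f \<longleftrightarrow> f differentiable_on S \<and>
     (\<forall>b\<in>Basis. C_k_on k S (\<lambda>x. frechet_derivative f (at x within S) b))"

definition smooth_on :: "'a::euclidean_space set \<Rightarrow> ('a \<Rightarrow> real) \<Rightarrow> bool" where
  "smooth_on S f \<longleftrightarrow> (\<forall>k. C_k_on k S f)"

text \<open>The test functions \<open>C\<^sub>c\<^sup>\<infinity>([0,\<infinity>) \<times> E)\<close>: the support is compact in
  \<open>[0,\<infinity>) \<times> E\<close>, so \<open>h\<close> need not vanish at time \<open>0\<close>. The values of \<open>h\<close> at negative times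
  are irrelevant.\<close>

definition test_functions :: "(real \<times> 'a::euclidean_space \<Rightarrow> real) set" where
  "test_functions = {h. smooth_on ({0..} \<times> UNIV) h \<and>
     compact (closure {z \<in> {0..} \<times> UNIV. h z \<noteq> 0})}"

section \<open>Wasserstein spaces\<close>

definition measure_support :: "'a::topological_space measure \<Rightarrow> 'a set" where
  "measure_support M = {x. \<forall>U. open U \<and> x \<in> U \<longrightarrow> emeasure M U > 0}"

definition borel_prob :: "'a::topological_space measure set" where
  "borel_prob = {M. sets M = sets borel \<and> prob_space M}"

definition Pc :: "'a::topological_space measure set" where
  "Pc = {M \<in> borel_prob. compact (measure_support M)}"

definition P2 :: "'a::real_normed_vector measure set" where
  "P2 = {M \<in> borel_prob. (\<integral>\<^sup>+ z. ennreal ((norm z)\<^sup>2) \<partial>M) < \<infinity>}"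

definition couplings ::
  "'a::topological_space measure \<Rightarrow> 'a measure \<Rightarrow> ('a \<times> 'a) measure set" where
  "couplings \<mu> \<nu> = {\<pi> \<in> borel_prob. distr \<pi> borel fst = \<mu> \<and> distr \<pi> borel snd = \<nu>}"

text \<open>On a product type, \<^const>\<open>dist\<close> is the Euclidean product distance.\<close>

definition W_inf :: "'a::metric_space measure \<Rightarrow> 'a measure \<Rightarrow> ennreal" where
  "W_inf \<mu> \<nu> = (INF \<pi>\<in>couplings \<mu> \<nu>. SUP z\<in>measure_support \<pi>. ennreal (dist (fst z) (snd z)))"

text \<open>The infimum below is finite for measures in \<open>P2\<close>, where \<open>W2\<close> is used.\<close>

definition W2 :: "'a::metric_space measure \<Rightarrow> 'a measure \<Rightarrow> real" where
  "W2 \<mu> \<nu> =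
     sqrt (enn2real (INF \<pi>\<in>couplings \<mu> \<nu>. \<integral>\<^sup>+ z. ennreal ((dist (fst z) (snd z))\<^sup>2) \<partial>\<pi>))"

definition converges_in_P2 :: "(nat \<Rightarrow> 'a::real_normed_vector measure) \<Rightarrow> bool" where
  "converges_in_P2 \<mu> \<longleftrightarrow> (\<exists>\<nu>\<in>P2. (\<lambda>n. W2 (\<mu> n) \<nu>) \<longlonglongrightarrow> 0)"

text \<open>\<open>f \<in> C([0,\<infinity>); P\<^sub>c)\<close>, with respect to \<^const>\<open>W_inf\<close>; values at negative times are
  unconstrained.\<close>

definition continuous_curve_Pc :: "(real \<Rightarrow> 'a::metric_space measure) \<Rightarrow> bool" where
  "continuous_curve_Pc f \<longleftrightarrow> (\<forall>t\<ge>0. f t \<in> Pc) \<and>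
     (\<forall>t\<ge>0. ((\<lambda>s. W_inf (f s) (f t)) \<longlongrightarrow> 0) (at t within {0..}))"

section \<open>The mean-field equation\<close>

definition mean_velocity :: "('a::euclidean_space \<times> 'a) measure \<Rightarrow> 'a" where
  "mean_velocity \<mu> = (\<integral>z. snd z \<partial>\<mu>)"

definition interaction ::
  "('a::euclidean_space \<Rightarrow> real) \<Rightarrow> (real \<Rightarrow> real) \<Rightarrow> ('a \<times> 'a) measure \<Rightarrow> 'a \<Rightarrow> 'a \<Rightarrow> 'a" where
  "interaction V \<psi> \<mu> r v =
     (\<integral>(r', v'). \<psi> (norm (r - r')) *\<^sub>R (v - v') - grad V (r' - r) \<partial>\<mu>)"

definition mean_field_solution ::
  "('a::euclidean_space \<Rightarrow> real) \<Rightarrow> (real \<Rightarrow> real) \<Rightarrow> ('a \<times> 'a) measure \<Rightarrow>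
     (real \<Rightarrow> ('a \<times> 'a) measure) \<Rightarrow> bool" where
  "mean_field_solution V \<psi> f0 f \<longleftrightarrow> continuous_curve_Pc f \<and>
     (\<forall>h\<in>test_functions.
        (LINT t:{0..}|lborel. (\<integral>(r, v).
            vector_derivative (\<lambda>s. h (s, r, v)) (at t within {0..})
            + (v - mean_velocity f0) \<bullet> grad (\<lambda>x. h (t, x, v)) r \<partial>f t))
        + (\<integral>(r, v). h (0, r, v) \<partial>f0)
        = (LINT t:{0..}|lborel. (\<integral>(r, v).
            interaction V \<psi> (f t) r v \<bullet> grad (\<lambda>w. h (t, r, w)) v \<partial>f t)))"

end

theory Submission
  imports Defs
begin

text \<open>Take \<open>f\<^sub>0 = (\<delta>\<^sub>z + \<delta>\<^sub>-\<^sub>z) / 2\<close> with \<open>z = (a, 0)\<close> and \<open>a \<noteq> 0\<close>. The solution is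
  \<open>(\<delta>\<^sub>z\<^sub>(\<^sub>t\<^sub>) + \<delta>\<^sub>-\<^sub>z\<^sub>(\<^sub>t\<^sub>)) / 2\<close> with \<open>z = (r, v)\<close>, \<open>r' = v\<close> and
  \<open>v' = - \<psi>(2|r|) v - \<nabla>V(2r) / 2\<close>. The energy \<open>|v|\<^sup>2/2 + V(2r)/4\<close> decreases, so \<open>r\<close> stays away
  from \<open>0\<close>, the only critical point of \<open>V\<close>, and the damping forces \<open>v \<rightarrow> 0\<close>. A finite limit point of
  \<open>r\<close> would carry a nonzero force and contradict \<open>v \<rightarrow> 0\<close>, so \<open>|r| \<rightarrow> \<infinity>\<close>, while convergence in
  \<open>P2\<close> bounds the second moments.

  Another solution \<open>g\<close> that agrees with this one up to time \<open>T\<close> is concentrated, shortly after \<open>T\<close>,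
  near \<open>z(T)\<close> and \<open>- z(T)\<close>. With \<open>\<sigma> = 1\<close> near \<open>z(T)\<close> and \<open>\<sigma> = - 1\<close> near \<open>- z(T)\<close>, the quantity
  \<open>\<integral>|\<sigma> x - z(t)|\<^sup>2 dg\<^sub>t\<close> is, after expanding the square, a combination of integrals of fixed test
  functions with time-dependent coefficients. It therefore satisfies a Gronwall inequality and
  vanishes.\<close>

section \<open>Smooth functions\<close>

text \<open>The statement speaks of the solution belonging to \<open>f0\<close>, so a divergent
  solution alone is not enough: every other weak solution has to be excluded. As one symmetric datum
  suffices, this is done for that datum only instead of through a general stability estimate. A
  competitor is an arbitrary curve of measures without known characteristics, accessible only
  through smooth tests; hence the comparison uses finitely many smooth moments. The reflection by
  \<sigma> is smooth only as long as the two clusters are separated. Separation comes from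
  continuity in the infinity-Wasserstein distance, which moves all mass by a small amount (a weaker
  distance would let a little mass travel far), and from z never reaching the origin. The clusters
  keep equal masses because \<sigma> is locally constant on them. Symmetry of the datum also makes
  the mean velocity vanish, so that it disappears from the equation.\<close>

definition flat :: "nat \<Rightarrow> real \<Rightarrow> real" where
  "flat n x = (if x > 0 then exp (- (1 / x)) / x ^ n else 0)"

text \<open>Inversion turns the limit from the right into exponential growth beating every power at
  infinity.\<close>

lemma flat_tendsto_0: "(flat n \<longlongrightarrow> 0) (at 0)"
proof -
  have "((\<lambda>x. x ^ n / exp x) \<longlongrightarrow> 0) (at_top :: real filter)"
    by (rule tendsto_power_div_exp_0)
  then have "((\<lambda>x. (inverse x) ^ n / exp (inverse x)) \<longlongrightarrow> 0) (at_right (0::real))"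
    by (rule filterlim_compose[OF _ filterlim_inverse_at_top_right])
  then have "(flat n \<longlongrightarrow> 0) (at_right 0)"
    by (rule tendsto_cong[THEN iffD1, rotated])
      (auto simp: flat_def eventually_at_right_field exp_minus field_simps intro!: exI[of _ 1])
  moreover have "(flat n \<longlongrightarrow> 0) (at_left 0)"
    by (rule tendsto_eventually) (auto simp: flat_def eventually_at_left_field intro!: exI[of _ "-1"])
  ultimately show ?thesis by (rule filterlim_split_at_real[rotated])
qed

text \<open>The index \<open>n\<close> makes the family closed under differentiation, so all members
  are smooth at once. At 0 the difference quotient of \<open>flat n\<close> is
  \<open>flat (n + 1)\<close>, which tends to 0.\<close>

lemma DERIV_flat: "(flat n has_real_derivative flat (n + 2) x - n * flat (n + 1) x) (at x)"
proof -
  consider "x > 0" | "x < 0" | "x = 0" by linarith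
  then show ?thesis
  proof cases
    case 1
    have "((\<lambda>x. exp (- (1 / x)) / x ^ n) has_real_derivative flat (n + 2) x - n * flat (n + 1) x) (at x)"
    proof -
      have "((\<lambda>x. exp (- (1 / x)) / x ^ n) has_real_derivative
          (exp (- (1 / x)) * (1 / x^2) * x ^ n - exp (- (1 / x)) * (real n * x ^ (n - 1))) / (x ^ n * x ^ n)) (at x)"
        using 1 by (auto intro!: derivative_eq_intros simp: power2_eq_square)
      moreover have "(exp (- (1 / x)) * (1 / x^2) * x ^ n - exp (- (1 / x)) * (real n * x ^ (n - 1))) / (x ^ n * x ^ n)
          = flat (n + 2) x - n * flat (n + 1) x"
      proof (cases n)
        case 0
        then show ?thesis using 1 by (simp add: flat_def power2_eq_square)
      next
        case (Suc m)
        then show ?thesis using 1 by (simp add: flat_def field_simps power2_eq_square)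
      qed
      ultimately show ?thesis by simp
    qed
    then show ?thesis
      by (rule has_field_derivative_transform_within_open[where S="{0<..}"]) (use 1 in \<open>auto simp: flat_def\<close>)
  next
    case 2
    have "((\<lambda>x. 0) has_real_derivative flat (n + 2) x - n * flat (n + 1) x) (at x)"
      using 2 by (auto simp: flat_def)
    then show ?thesis
      by (rule has_field_derivative_transform_within_open[where S="{..<0}"]) (use 2 in \<open>auto simp: flat_def\<close>)
  next
    case 3
    have "((\<lambda>y. flat (n + 1) y) \<longlongrightarrow> 0) (at 0)" by (rule flat_tendsto_0)
    then have "((\<lambda>y. (flat n y - flat n 0) / (y - 0)) \<longlongrightarrow> 0) (at 0)"
      by (rule tendsto_cong[THEN iffD1, rotated])
        (auto simp: flat_def eventually_at_filter field_simps)
    then show ?thesis unfolding has_field_derivative_iff by (auto simp: 3 flat_def)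
  qed
qed

lemma flat_0_mono: "x \<le> y \<Longrightarrow> flat 0 x \<le> flat 0 y"
  by (auto simp: flat_def frac_le)

lemma flat_nonneg: "flat n x \<ge> 0"
  by (auto simp: flat_def)

text \<open>The rules are chosen such that the class is closed under directional derivatives;
  this replaces closure properties of \<^const>\<open>smooth_on\<close>.\<close>

inductive_set smooth :: "('a::euclidean_space \<Rightarrow> real) set" where
  const: "(\<lambda>x. c) \<in> smooth"
| inner: "(\<lambda>x. x \<bullet> b) \<in> smooth"
| add: "f \<in> smooth \<Longrightarrow> g \<in> smooth \<Longrightarrow> (\<lambda>x. f x + g x) \<in> smooth"
| mult: "f \<in> smooth \<Longrightarrow> g \<in> smooth \<Longrightarrow> (\<lambda>x. f x * g x) \<in> smooth"
| flat: "f \<in> smooth \<Longrightarrow> (\<lambda>x. flat n (f x)) \<in> smooth"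
| inverse: "f \<in> smooth \<Longrightarrow> (\<And>x. f x > 0) \<Longrightarrow> (\<lambda>x. inverse (f x)) \<in> smooth"

lemma smooth_diff: "f \<in> smooth \<Longrightarrow> g \<in> smooth \<Longrightarrow> (\<lambda>x. f x - g x) \<in> smooth"
  using smooth.add[OF _ smooth.mult[OF smooth.const[of "-1"]]] by fastforce

lemma smooth_sum: "(\<And>i. i \<in> I \<Longrightarrow> f i \<in> smooth) \<Longrightarrow> (\<lambda>x. \<Sum>i\<in>I. f i x) \<in> smooth"
  by (induction I rule: infinite_finite_induct) (simp_all add: smooth.const smooth.add)

lemma smooth_norm_sq: "(\<lambda>x. (norm (x - c))\<^sup>2) \<in> smooth"
proof -
  have "(\<lambda>x. (norm (x - c))\<^sup>2) = (\<lambda>x. \<Sum>b\<in>Basis. (x \<bullet> b - c \<bullet> b) * (x \<bullet> b - c \<bullet> b))"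
    unfolding power2_norm_eq_inner by (subst euclidean_inner) (simp add: inner_diff_left)
  also have "\<dots> \<in> smooth" by (intro smooth_sum smooth.mult smooth_diff smooth.intros)
  finally show ?thesis .
qed

lemma smooth_fst: "f \<in> smooth \<Longrightarrow> (\<lambda>x :: 'a::euclidean_space \<times> 'b::euclidean_space. f (fst x)) \<in> smooth"
proof (induction rule: smooth.induct)
  case (inner b)
  have "(\<lambda>x :: 'a \<times> 'b. fst x \<bullet> b) = (\<lambda>x. x \<bullet> (b, 0))" by (simp add: inner_prod_def)
  then show ?case by (simp only: smooth.inner)
qed (simp_all add: smooth.intros)

lemma smooth_snd: "f \<in> smooth \<Longrightarrow> (\<lambda>x :: 'a::euclidean_space \<times> 'b::euclidean_space. f (snd x)) \<in> smooth"
proof (induction rule: smooth.induct)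
  case (inner b)
  have "(\<lambda>x :: 'a \<times> 'b. snd x \<bullet> b) = (\<lambda>x. x \<bullet> (0, b))" by (simp add: inner_prod_def)
  then show ?case by (simp only: smooth.inner)
qed (simp_all add: smooth.intros)

text \<open>Each rule reproduces itself: the derivative of \<open>flat n\<close> is a combination of
  \<open>flat (n + 1)\<close> and \<open>flat (n + 2)\<close>, and that of \<open>inverse f\<close>
  uses the positivity of \<open>f\<close> alone. With the direction \<open>b\<close> fixed, the
  derivative is again a real function of the class.\<close>

lemma smooth_derivative:
  assumes "f \<in> smooth"
  shows "\<exists>f'. (\<forall>x. (f has_derivative f' x) (at x)) \<and> (\<forall>b. (\<lambda>x. f' x b) \<in> smooth)"
  using assms
proof (induction rule: smooth.induct)
  case (const c)
  show ?case by (intro exI[of _ "\<lambda>x h. 0"]) (auto intro: smooth.intros)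
next
  case (inner b)
  show ?case by (intro exI[of _ "\<lambda>x h. h \<bullet> b"]) (auto intro!: smooth.intros derivative_eq_intros)
next
  case (add f g)
  then obtain f' g' where
    "\<forall>x. (f has_derivative f' x) (at x)" "\<forall>b. (\<lambda>x. f' x b) \<in> smooth"
    "\<forall>x. (g has_derivative g' x) (at x)" "\<forall>b. (\<lambda>x. g' x b) \<in> smooth" by blast
  then show ?case
    by (intro exI[of _ "\<lambda>x h. f' x h + g' x h"]) (auto intro!: smooth.intros derivative_intros)
next
  case (mult f g)
  then obtain f' g' where
    "\<forall>x. (f has_derivative f' x) (at x)" "\<forall>b. (\<lambda>x. f' x b) \<in> smooth"
    "\<forall>x. (g has_derivative g' x) (at x)" "\<forall>b. (\<lambda>x. g' x b) \<in> smooth" by blast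
  then show ?case using mult.hyps
    by (intro exI[of _ "\<lambda>x h. f x * g' x h + f' x h * g x"]) (auto intro!: smooth.intros has_derivative_mult)
next
  case (flat f n)
  then obtain f' where f': "\<forall>x. (f has_derivative f' x) (at x)" "\<forall>b. (\<lambda>x. f' x b) \<in> smooth" by blast
  have "((\<lambda>x. flat n (f x)) has_derivative (\<lambda>h. f' x h * (flat (n + 2) (f x) - n * flat (n + 1) (f x)))) (at x)" for x
    by (rule DERIV_compose_FDERIV[OF DERIV_flat]) (use f' in auto)
  then show ?case using f' flat.hyps
    by (intro exI[of _ "\<lambda>x h. f' x h * (flat (n + 2) (f x) - n * flat (n + 1) (f x))"])
      (auto intro!: smooth.intros smooth_diff)
next
  case (inverse f)
  then obtain f' where f': "\<forall>x. (f has_derivative f' x) (at x)" "\<forall>b. (\<lambda>x. f' x b) \<in> smooth" by blast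
  have "((\<lambda>x. inverse (f x)) has_derivative (\<lambda>h. (-1) * (inverse (f x) * f' x h * inverse (f x)))) (at x)" for x
    using Deriv.has_derivative_inverse[of f x "f' x"] f' inverse.hyps(2)[of x] by auto
  then show ?case using f' inverse.hyps
    by (intro exI[of _ "\<lambda>x h. (-1) * (inverse (f x) * f' x h * inverse (f x))"])
      (intro conjI allI smooth.intros; auto)
qed

lemma smooth_continuous_on: "f \<in> smooth \<Longrightarrow> continuous_on S f"
  using smooth_derivative[of f]
  by (metis continuous_at_imp_continuous_on has_derivative_continuous)

lemma smooth_gradient:
  assumes "f \<in> smooth"
  obtains G where "\<And>x. (f has_derivative (\<lambda>h. G x \<bullet> h)) (at x)" "continuous_on UNIV G"
proof -
  obtain f' where f': "\<And>x. (f has_derivative f' x) (at x)" "\<And>b. (\<lambda>x. f' x b) \<in> smooth"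
    using smooth_derivative[OF assms] by blast
  define G where "G x = (\<Sum>b\<in>Basis. f' x b *\<^sub>R b)" for x
  have "f' x h = G x \<bullet> h" for x h
  proof -
    interpret bounded_linear "f' x" using f'(1) by (rule has_derivative_bounded_linear)
    have "f' x h = f' x (\<Sum>b\<in>Basis. (h \<bullet> b) *\<^sub>R b)" by (simp add: euclidean_representation)
    also have "\<dots> = (\<Sum>b\<in>Basis. (h \<bullet> b) * f' x b)" by (simp add: sum scaleR)
    also have "\<dots> = G x \<bullet> h" by (simp add: G_def inner_sum_left inner_commute[of h] mult.commute)
    finally show ?thesis .
  qed
  then have "f' x = (\<lambda>h. G x \<bullet> h)" for x by blast
  then show ?thesis using f'
    by (intro that[of G]) (auto simp: G_def[abs_def] intro!: continuous_intros smooth_continuous_on)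
qed

text \<open>A small positive step along any basis vector stays in the half-space, also from the
  boundary at time 0, so the derivative within it is unique.\<close>

lemma frechet_derivative_half_space:
  fixes f :: "real \<times> 'a::euclidean_space \<Rightarrow> real"
  assumes "(f has_derivative D) (at z within {0..} \<times> UNIV)" "z \<in> {0..} \<times> UNIV"
  shows "frechet_derivative f (at z within {0..} \<times> UNIV) = D"
proof -
  have "(f has_derivative frechet_derivative f (at z within {0..} \<times> UNIV)) (at z within {0..} \<times> UNIV)"
    using assms(1) frechet_derivative_works differentiableI by blast
  then show ?thesis
  proof (rule frechet_derivative_unique_within[OF _ assms(1)])
    fix i :: "real \<times> 'a" and e :: real
    assume "i \<in> Basis" "0 < e"
    then show "\<exists>d. 0 < \<bar>d\<bar> \<and> \<bar>d\<bar> < e \<and> z + d *\<^sub>R i \<in> {0..} \<times> UNIV"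
      using assms(2) by (intro exI[of _ "e/2"]) (auto simp: Basis_prod_def)
  qed
qed

text \<open>The function \<open>g\<close> agrees with \<open>f\<close> on the half-space only,
  because the induction passes to \<open>frechet_derivative g\<close>, which is the derivative of
  \<open>f\<close> there and an arbitrary choice elsewhere.\<close>

lemma smooth_imp_C_k_on:
  fixes f g :: "real \<times> 'a::euclidean_space \<Rightarrow> real"
  assumes "f \<in> smooth" and "\<And>z. z \<in> {0..} \<times> UNIV \<Longrightarrow> g z = f z"
  shows "C_k_on k ({0..} \<times> UNIV) g"
  using assms
proof (induction k arbitrary: f g)
  case 0
  have "continuous_on ({0..} \<times> UNIV) g"
    by (rule continuous_on_cong[OF refl "0.prems"(2), THEN iffD2])
      (auto intro: smooth_continuous_on[OF "0.prems"(1)])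
  then show ?case by simp
next
  case (Suc k)
  obtain f' where f': "\<And>x. (f has_derivative f' x) (at x)" "\<And>b. (\<lambda>x. f' x b) \<in> smooth"
    using smooth_derivative[OF Suc.prems(1)] by blast
  have g': "(g has_derivative f' z) (at z within {0..} \<times> UNIV)" if "z \<in> {0..} \<times> UNIV" for z
    by (rule has_derivative_transform[OF that Suc.prems(2) has_derivative_at_withinI[OF f'(1)]])
  have "C_k_on k ({0..} \<times> UNIV) (\<lambda>x. frechet_derivative g (at x within {0..} \<times> UNIV) b)" for b
    by (rule Suc.IH[OF f'(2)[of b]]) (simp only: frechet_derivative_half_space[OF g'])
  moreover have "g differentiable_on ({0..} \<times> UNIV)"
    unfolding differentiable_on_def differentiable_def using g' by blast
  ultimately show ?case by simp
qed

text \<open>The classical smooth transition from 0 to 1. Since \<open>x\<close> and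
  \<open>1 - x\<close> are never both nonpositive, the denominator is positive and the
  \<open>inverse\<close> rule of \<open>smooth\<close> applies.\<close>

definition step :: "real \<Rightarrow> real" where
  "step x = flat 0 x * inverse (flat 0 x + flat 0 (1 - x))"

lemma step_denom_pos: "flat 0 x + flat 0 (1 - x) > 0"
  by (cases "x > 0") (auto simp: flat_def intro: add_pos_nonneg)

lemma smooth_step: "f \<in> smooth \<Longrightarrow> (\<lambda>x. step (f x)) \<in> smooth"
  unfolding step_def by (intro smooth.intros smooth_diff step_denom_pos)

lemma step_eq_0: "x \<le> 0 \<Longrightarrow> step x = 0"
  by (simp add: step_def flat_def)

lemma step_eq_1: "x \<ge> 1 \<Longrightarrow> step x = 1"
  by (simp add: step_def flat_def)

text \<open>After cross-multiplication a common product cancels, and what remains is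
  \<open>flat 0 x * flat 0 (1 - y) \<le> flat 0 y * flat 0 (1 - x)\<close>.\<close>

lemma step_mono: "x \<le> y \<Longrightarrow> step x \<le> step y"
proof -
  assume "x \<le> y"
  then have "flat 0 x \<le> flat 0 y" "flat 0 (1 - y) \<le> flat 0 (1 - x)" by (auto intro: flat_0_mono)
  then have "flat 0 x * flat 0 (1 - y) \<le> flat 0 y * flat 0 (1 - x)"
    by (intro mult_mono flat_nonneg)
  then show ?thesis
    using step_denom_pos[of x] step_denom_pos[of y] by (simp add: step_def field_simps)
qed

section \<open>Compactly supported measures\<close>

lemma borel_probD:
  assumes "M \<in> borel_prob"
  shows "prob_space M" "sets M = sets borel" "space M = UNIV"
  using assms sets_eq_imp_space_eq[of M borel] by (auto simp: borel_prob_def)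

lemma open_Compl_measure_support: "open (- measure_support M)"
proof -
  have "- measure_support M = \<Union>{U. open U \<and> emeasure M U = 0}"
    by (auto simp: measure_support_def)
  then show ?thesis by (metis (mono_tags, lifting) mem_Collect_eq open_Union)
qed

text \<open>The complement of the support is a union of open null sets; by the Lindelof property
  countably many of them suffice, so it is itself null.\<close>

lemma AE_measure_support:
  fixes M :: "'a::second_countable_topology measure"
  assumes "sets M = sets borel"
  shows "AE x in M. x \<in> measure_support M"
proof -
  obtain \<U> where \<U>: "\<U> \<subseteq> {U. open U \<and> emeasure M U = 0}" "countable \<U>"
    "\<Union>\<U> = \<Union>{U. open U \<and> emeasure M U = 0}"
    by (rule Lindelof[of "{U. open U \<and> emeasure M U = 0}"]) auto
  have "(\<Union>U\<in>\<U>. U) \<in> null_sets M"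
    using \<U> assms by (intro null_sets_UN') (auto simp: null_setsI subset_iff)
  then have "AE x in M. x \<notin> \<Union>\<U>" by (intro AE_not_in) simp
  then show ?thesis
    unfolding \<U>(3) by eventually_elim (auto simp: measure_support_def zero_less_iff_neq_zero)
qed

lemma measure_support_subset:
  assumes "sets M = sets borel" "closed C" "AE x in M. x \<in> C"
  shows "measure_support M \<subseteq> C"
proof
  fix x assume x: "x \<in> measure_support M"
  show "x \<in> C"
  proof (rule ccontr)
    assume "x \<notin> C"
    then have "emeasure M (- C) > 0" using x assms(2) by (auto simp: measure_support_def)
    moreover have "emeasure M (- C) = 0"
      using assms(3) AE_iff_measurable[of "- C" M "\<lambda>x. x \<in> C"] assms(1,2) sets_eq_imp_space_eq[OF assms(1)]
      by auto
    ultimately show False by simp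
  qed
qed

lemma Pc_AE_bounded:
  fixes M :: "'a::euclidean_space measure"
  assumes "M \<in> Pc"
  obtains R where "AE x in M. norm x < R"
proof -
  have "bounded (measure_support M)" using assms by (auto simp: Pc_def compact_imp_bounded)
  then obtain R where "\<And>x. x \<in> measure_support M \<Longrightarrow> norm x < R" by (metis bounded_pos_less)
  then have "AE x in M. norm x < R"
    using AE_measure_support[of M] assms by (auto simp: Pc_def borel_prob_def)
  then show ?thesis by (rule that)
qed

text \<open>A continuous function is bounded on the compact support, which carries all the
  mass.\<close>

lemma Pc_integrable:
  fixes h :: "'a::euclidean_space \<Rightarrow> 'b::{banach,second_countable_topology}"
  assumes "M \<in> Pc" "continuous_on UNIV h"
  shows "integrable M h"
proof -
  have M: "M \<in> borel_prob" "compact (measure_support M)" using assms(1) by (auto simp: Pc_def)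
  interpret prob_space M using M by (simp add: borel_probD)
  have "bounded (h ` measure_support M)"
    using M(2) assms(2) by (meson compact_continuous_image compact_imp_bounded continuous_on_subset subset_UNIV)
  then obtain B where B: "\<And>x. x \<in> measure_support M \<Longrightarrow> norm (h x) \<le> B"
    by (auto simp: bounded_iff)
  show ?thesis
  proof (rule integrable_const_bound)
    show "AE x in M. norm (h x) \<le> B"
      using AE_measure_support[of M] borel_probD(2)[OF M(1)] B by auto
    show "h \<in> borel_measurable M"
      using borel_measurable_continuous_onI[OF assms(2)] borel_probD(2)[OF M(1)]
      by (simp cong: measurable_cong_sets)
  qed
qed

section \<open>Couplings and the infinity-Wasserstein distance\<close>

lemma W_inf_lessE:
  fixes \<mu> \<nu> :: "'a::{metric_space,second_countable_topology} measure"
  assumes "W_inf \<mu> \<nu> < ennreal \<delta>"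
  obtains \<pi> where "\<pi> \<in> couplings \<mu> \<nu>" "AE z in \<pi>. dist (fst z) (snd z) < \<delta>"
proof -
  obtain \<pi> where \<pi>: "\<pi> \<in> couplings \<mu> \<nu>"
    "(SUP z\<in>measure_support \<pi>. ennreal (dist (fst z) (snd z))) < ennreal \<delta>"
    using assms unfolding W_inf_def INF_less_iff by blast
  have "sets \<pi> = sets borel" using \<pi>(1) by (auto simp: couplings_def borel_prob_def)
  \<comment> \<open>The support has full measure, so the bound on the supremum becomes an almost
    sure bound on the displacement; this is the form in which closeness in \<open>W_inf\<close> is
    used.\<close>
  then have "AE z in \<pi>. z \<in> measure_support \<pi>" by (rule AE_measure_support)
  then have "AE z in \<pi>. dist (fst z) (snd z) < \<delta>"
  proof eventually_elim
    case (elim z)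
    then show ?case
      using SUP_lessD[OF \<pi>(2) elim] by (simp add: ennreal_less_iff)
  qed
  with \<pi>(1) show ?thesis by (rule that)
qed

lemma couplings_integral:
  fixes h :: "'a::{second_countable_topology} \<Rightarrow> 'b::{banach,second_countable_topology}"
  assumes "\<pi> \<in> couplings \<mu> \<nu>" and [measurable]: "h \<in> borel_measurable borel"
  shows "integral\<^sup>L \<mu> h = (\<integral>z. h (fst z) \<partial>\<pi>)" "integral\<^sup>L \<nu> h = (\<integral>z. h (snd z) \<partial>\<pi>)"
    "integrable \<mu> h \<longleftrightarrow> integrable \<pi> (\<lambda>z. h (fst z))" "integrable \<nu> h \<longleftrightarrow> integrable \<pi> (\<lambda>z. h (snd z))"
proof -
  have s: "sets \<pi> = sets (borel \<Otimes>\<^sub>M borel)" and \<mu>: "\<mu> = distr \<pi> borel fst" and \<nu>: "\<nu> = distr \<pi> borel snd"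
    using assms(1) unfolding couplings_def borel_prob_def borel_prod by blast+
  have [measurable]: "fst \<in> measurable \<pi> borel" "snd \<in> measurable \<pi> borel"
    unfolding measurable_cong_sets[OF s refl] by simp_all
  show "integral\<^sup>L \<mu> h = (\<integral>z. h (fst z) \<partial>\<pi>)" "integral\<^sup>L \<nu> h = (\<integral>z. h (snd z) \<partial>\<pi>)"
    "integrable \<mu> h \<longleftrightarrow> integrable \<pi> (\<lambda>z. h (fst z))" "integrable \<nu> h \<longleftrightarrow> integrable \<pi> (\<lambda>z. h (snd z))"
    unfolding \<mu> \<nu> by (rule integral_distr integrable_distr_eq; measurable)+
qed

lemma couplings_AE:
  fixes \<mu> :: "'a::second_countable_topology measure"
  assumes "\<pi> \<in> couplings \<mu> \<nu>"
  shows "(AE x in \<mu>. x \<in> A) \<Longrightarrow> A \<in> sets borel \<Longrightarrow> AE z in \<pi>. fst z \<in> A"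
    "(AE x in \<nu>. x \<in> A) \<Longrightarrow> A \<in> sets borel \<Longrightarrow> AE z in \<pi>. snd z \<in> A"
    "(AE z in \<pi>. fst z \<in> A) \<Longrightarrow> A \<in> sets borel \<Longrightarrow> AE x in \<mu>. x \<in> A"
proof -
  have s: "sets \<pi> = sets (borel \<Otimes>\<^sub>M borel)" and \<mu>: "\<mu> = distr \<pi> borel fst" and \<nu>: "\<nu> = distr \<pi> borel snd"
    using assms(1) unfolding couplings_def borel_prob_def borel_prod by blast+
  have m: "fst \<in> measurable \<pi> borel" "snd \<in> measurable \<pi> borel"
    unfolding measurable_cong_sets[OF s refl] by simp_all
  have "(AE x in \<mu>. x \<in> A) \<longleftrightarrow> (AE z in \<pi>. fst z \<in> A)" if "A \<in> sets borel"
    unfolding \<mu> by (rule AE_distr_iff[OF m(1)]) (use that in simp)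
  moreover have "(AE x in \<nu>. x \<in> A) \<longleftrightarrow> (AE z in \<pi>. snd z \<in> A)" if "A \<in> sets borel"
    unfolding \<nu> by (rule AE_distr_iff[OF m(2)]) (use that in simp)
  ultimately show "(AE x in \<mu>. x \<in> A) \<Longrightarrow> A \<in> sets borel \<Longrightarrow> AE z in \<pi>. fst z \<in> A"
    "(AE x in \<nu>. x \<in> A) \<Longrightarrow> A \<in> sets borel \<Longrightarrow> AE z in \<pi>. snd z \<in> A"
    "(AE z in \<pi>. fst z \<in> A) \<Longrightarrow> A \<in> sets borel \<Longrightarrow> AE x in \<mu>. x \<in> A"
    by blast+
qed

text \<open>A coupling close in \<open>W_inf\<close> moves almost every point by less than a fixed
  distance, so both integrals see only points near the compact support of the limit measure, where
  \<open>H\<close> is uniformly close to its values on it. The parameter \<open>x\<close> and the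
  time \<open>\<tau> x\<close> are kept apart so that time-dependent integrands and the drift as a
  function of time and state are covered.\<close>

lemma continuous_curve_integral:
  fixes H :: "'x::metric_space \<Rightarrow> 'e::euclidean_space \<Rightarrow> 'b::euclidean_space"
  assumes g: "continuous_curve_Pc g" and \<tau>: "continuous_on S \<tau>" "\<And>x. x \<in> S \<Longrightarrow> \<tau> x \<ge> 0"
    and H: "continuous_on (S \<times> UNIV) (\<lambda>(x, z). H x z)"
  shows "continuous_on S (\<lambda>x. \<integral>z. H x z \<partial>g (\<tau> x))"
  unfolding continuous_on_iff
proof (intro ballI allI impI)
  fix x0 and \<epsilon> :: real assume x0: "x0 \<in> S" and \<epsilon>: "\<epsilon> > 0"
  define K where "K = measure_support (g (\<tau> x0))"
  have gP: "g (\<tau> x) \<in> Pc" if "x \<in> S" for x using g \<tau>(2)[OF that] by (auto simp: continuous_curve_Pc_def)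
  have K: "compact K" using gP[OF x0] by (auto simp: K_def Pc_def)
  have Hc: "continuous_on UNIV (H x)" if "x \<in> S" for x
  proof -
    have "continuous_on UNIV (\<lambda>z. (\<lambda>(x, z). H x z) (x, z))"
      by (rule continuous_on_compose2[OF H]) (use that in \<open>auto intro!: continuous_intros\<close>)
    then show ?thesis by simp
  qed
  have "\<exists>d>0. \<forall>x\<in>S. \<forall>z. dist (x, z) (x0, z0) < d \<longrightarrow> dist (H x z) (H x0 z0) < \<epsilon> / 4" for z0
    using H[unfolded continuous_on_iff, rule_format, of "(x0, z0)" "\<epsilon> / 4"] x0 \<epsilon> by fastforce
  then obtain d where d: "\<And>z0. d z0 > 0"
    "\<And>z0 x z. x \<in> S \<Longrightarrow> dist (x, z) (x0, z0) < d z0 \<Longrightarrow> dist (H x z) (H x0 z0) < \<epsilon> / 4"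
    by metis
  \<comment> \<open>A Lebesgue number \<open>e\<close> for the cover by balls on which
    \<open>H\<close> stays within \<open>\<epsilon> / 4\<close> of its central value makes the
    modulus uniform over \<open>K\<close>.\<close>
  have "compact ({x0} \<times> K)" using K by (intro compact_Times) auto
  moreover have "{x0} \<times> K \<subseteq> \<Union>(range (\<lambda>z. ball (x0, z) (d z)))" using d(1) by (fastforce intro: centre_in_ball[THEN iffD2])
  ultimately obtain e where e: "e > 0"
    "\<And>p. p\<in>{x0} \<times> K \<Longrightarrow> \<exists>G\<in>range (\<lambda>z. ball (x0, z) (d z)). ball p e \<subseteq> G"
    by (rule Heine_Borel_lemma[of "{x0} \<times> K" "range (\<lambda>z. ball (x0, z) (d z))"]) blast+
  have He: "dist (H x z') (H x0 z) < \<epsilon> / 2" if h: "x \<in> S" "dist x x0 < e / 2" "z \<in> K" "dist z' z < e / 2" for x z z'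
  proof -
    obtain z0 where z0: "ball (x0, z) e \<subseteq> ball (x0, z0) (d z0)" using e(2)[of "(x0, z)"] h(3) by auto
    have "dist (x0, z) (x, z') \<le> dist x x0 + dist z' z"
      unfolding dist_Pair_Pair by (metis dist_commute real_sqrt_sum_squares_triangle_ineq sqrt_sum_squares_le_sum zero_le_dist)
    also have "\<dots> < e" using h by simp
    finally have "(x, z') \<in> ball (x0, z0) (d z0)" "(x0, z) \<in> ball (x0, z0) (d z0)"
      using subsetD[OF z0, of "(x, z')"] subsetD[OF z0, of "(x0, z)"] e(1) by simp_all
    then have "dist (H x z') (H x0 z0) < \<epsilon> / 4" "dist (H x0 z) (H x0 z0) < \<epsilon> / 4"
      using d(2)[OF h(1), of z' z0] d(2)[OF x0, of z z0] by (simp_all add: dist_commute)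
    then show ?thesis using dist_triangle2[of "H x z'" "H x0 z" "H x0 z0"] by linarith
  qed
  have "((\<lambda>s. W_inf (g s) (g (\<tau> x0))) \<longlongrightarrow> 0) (at (\<tau> x0) within {0..})"
    using g \<tau>(2)[OF x0] by (auto simp: continuous_curve_Pc_def)
  then have "\<forall>\<^sub>F s in at (\<tau> x0) within {0..}. W_inf (g s) (g (\<tau> x0)) < ennreal (e / 2)"
    using e(1) by (intro order_tendstoD(2)) auto
  then obtain \<eta> where \<eta>: "\<eta> > 0"
    "\<And>s. s \<ge> 0 \<Longrightarrow> s \<noteq> \<tau> x0 \<Longrightarrow> dist s (\<tau> x0) < \<eta> \<Longrightarrow> W_inf (g s) (g (\<tau> x0)) < ennreal (e / 2)"
    unfolding eventually_at by auto
  obtain \<rho> where \<rho>: "\<rho> > 0" "\<And>x. x \<in> S \<Longrightarrow> dist x x0 < \<rho> \<Longrightarrow> dist (\<tau> x) (\<tau> x0) < \<eta>"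
    using \<tau>(1) x0 \<eta>(1) unfolding continuous_on_iff by metis
  have key: "dist (\<integral>z. H x z \<partial>g (\<tau> x)) (\<integral>z. H x0 z \<partial>g (\<tau> x0)) \<le> \<epsilon> / 2"
    if x: "x \<in> S" "dist x x0 < min \<rho> (e / 2)" for x
  proof (cases "\<tau> x = \<tau> x0")
    case True
    interpret prob_space "g (\<tau> x0)" using gP[OF x0] by (auto simp: Pc_def borel_probD)
    have I: "integrable (g (\<tau> x0)) (H x)" "integrable (g (\<tau> x0)) (H x0)"
      using Pc_integrable[OF gP[OF x0]] Hc x(1) x0 by auto
    have "AE z in g (\<tau> x0). z \<in> K"
      unfolding K_def using gP[OF x0] by (intro AE_measure_support) (auto simp: Pc_def borel_prob_def)
    then have "AE z in g (\<tau> x0). norm (H x z - H x0 z) \<le> \<epsilon> / 2"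
    proof eventually_elim
      case (elim z)
      then show ?case using He[OF x(1) _ elim, of z] x(2) e(1) by (simp add: dist_norm)
    qed
    then have "norm (\<integral>z. H x z - H x0 z \<partial>g (\<tau> x0)) \<le> \<epsilon> / 2"
      using integral_norm_bound[of "g (\<tau> x0)" "\<lambda>z. H x z - H x0 z"]
        integral_mono_AE[of "g (\<tau> x0)" "\<lambda>z. norm (H x z - H x0 z)" "\<lambda>_. \<epsilon> / 2"] I
      by (fastforce simp: prob_space)
    then show ?thesis using I True by (simp add: dist_norm)
  next
    case False
    then have "W_inf (g (\<tau> x)) (g (\<tau> x0)) < ennreal (e / 2)"
      using \<eta>(2) \<rho>(2) x \<tau>(2) by simp
    then obtain \<pi> where \<pi>: "\<pi> \<in> couplings (g (\<tau> x)) (g (\<tau> x0))" "AE z in \<pi>. dist (fst z) (snd z) < e / 2"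
      by (rule W_inf_lessE)
    interpret prob_space \<pi> using \<pi>(1) by (auto simp: couplings_def borel_prob_def)
    have [measurable]: "H x \<in> borel_measurable borel" "H x0 \<in> borel_measurable borel"
      using Hc x(1) x0 by (auto intro: borel_measurable_continuous_onI)
    have I: "integrable \<pi> (\<lambda>z. H x (fst z))" "integrable \<pi> (\<lambda>z. H x0 (snd z))"
      using couplings_integral[OF \<pi>(1), of "H x"] couplings_integral[OF \<pi>(1), of "H x0"]
        Pc_integrable[OF gP[OF x0] Hc[OF x0]] Pc_integrable[OF gP[OF x(1)] Hc[OF x(1)]] by auto
    have "AE z in g (\<tau> x0). z \<in> K"
      unfolding K_def using gP[OF x0] by (intro AE_measure_support) (auto simp: Pc_def borel_prob_def)
    then have "AE z in \<pi>. snd z \<in> K" using K by (intro couplings_AE(2)[OF \<pi>(1)]) (auto simp: compact_imp_closed)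
    with \<pi>(2) have "AE z in \<pi>. norm (H x (fst z) - H x0 (snd z)) \<le> \<epsilon> / 2"
    proof eventually_elim
      case (elim z)
      then show ?case using He[OF x(1) _ elim(2) elim(1)] x(2) by (simp add: dist_norm)
    qed
    then have "norm (\<integral>z. H x (fst z) - H x0 (snd z) \<partial>\<pi>) \<le> \<epsilon> / 2"
      using integral_norm_bound[of \<pi> "\<lambda>z. H x (fst z) - H x0 (snd z)"]
        integral_mono_AE[of \<pi> "\<lambda>z. norm (H x (fst z) - H x0 (snd z))" "\<lambda>_. \<epsilon> / 2"] I
      by (fastforce simp: prob_space)
    then show ?thesis using I couplings_integral(1)[OF \<pi>(1), of "H x"] couplings_integral(2)[OF \<pi>(1), of "H x0"]
      by (simp add: dist_norm)
  qed
  show "\<exists>d>0. \<forall>x\<in>S. dist x x0 < d \<longrightarrow> dist (\<integral>z. H x z \<partial>g (\<tau> x)) (\<integral>z. H x0 z \<partial>g (\<tau> x0)) < \<epsilon>"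
    using key \<rho>(1) e(1) \<epsilon> by (intro exI[of _ "min \<rho> (e / 2)"]) fastforce
qed

section \<open>Symmetric measures with two atoms\<close>

definition two_atoms :: "'a::euclidean_space \<Rightarrow> 'a measure" where
  "two_atoms c = distr (measure_pmf (bernoulli_pmf (1/2))) borel (\<lambda>b. if b then c else - c)"

lemma two_atoms_borel_prob: "two_atoms c \<in> borel_prob"
  unfolding borel_prob_def two_atoms_def
  by (auto intro!: prob_space.prob_space_distr simp: prob_space_measure_pmf)

lemma integral_two_atoms:
  fixes h :: "'a::euclidean_space \<Rightarrow> 'b::{banach,second_countable_topology}"
  assumes "h \<in> borel_measurable borel"
  shows "(\<integral>z. h z \<partial>two_atoms c) = (1/2) *\<^sub>R (h c + h (- c))"
  unfolding two_atoms_def using assms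
  by (subst integral_distr) (simp_all add: integral_measure_pmf[where A = UNIV] scaleR_add_right UNIV_bool)

lemma AE_two_atoms: "AE z in two_atoms c. z \<in> {c, - c}"
  unfolding two_atoms_def by (subst AE_distr_iff) auto

lemma two_atoms_Pc: "two_atoms c \<in> Pc"
proof -
  have "measure_support (two_atoms c) \<subseteq> {c, - c}"
    using two_atoms_borel_prob[of c]
    by (intro measure_support_subset AE_two_atoms) (auto simp: borel_prob_def)
  moreover have "closed (measure_support (two_atoms c))"
    using open_Compl_measure_support closed_def by blast
  ultimately show ?thesis using two_atoms_borel_prob[of c]
    by (auto simp: Pc_def intro: finite_imp_compact finite_subset)
qed

text \<open>The same coin toss drives both measures, pairing \<open>c\<close> with \<open>c'\<close>
  and \<open>- c\<close> with \<open>- c'\<close>; both pairs have distance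
  \<open>dist c c'\<close>.\<close>

lemma W_inf_two_atoms: "W_inf (two_atoms c) (two_atoms c') \<le> ennreal (dist c c')"
proof -
  define \<pi> where "\<pi> = distr (measure_pmf (bernoulli_pmf (1/2))) borel
    (\<lambda>b. (if b then c else - c, if b then c' else - c'))"
  have [simp]: "(fst :: 'a \<times> 'a \<Rightarrow> 'a) \<in> borel_measurable borel" "(snd :: 'a \<times> 'a \<Rightarrow> 'a) \<in> borel_measurable borel"
    by (auto intro!: borel_measurable_continuous_onI continuous_intros)
  have 1: "\<pi> \<in> couplings (two_atoms c) (two_atoms c')"
    unfolding couplings_def \<pi>_def borel_prob_def two_atoms_def
    by (auto intro!: prob_space.prob_space_distr simp: prob_space_measure_pmf distr_distr o_def if_distrib[of fst] if_distrib[of snd] cong: if_cong)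
  let ?C = "{z :: 'a \<times> 'a. dist (fst z) (snd z) \<le> dist c c'}"
  have "dist (- c) (- c') = dist c c'" by (simp add: dist_norm norm_minus_commute)
  then have "AE z in \<pi>. z \<in> ?C"
    unfolding \<pi>_def by (subst AE_distr_iff) (auto simp: closed_Collect_le continuous_on_dist continuous_on_fst continuous_on_snd)
  then have "measure_support \<pi> \<subseteq> ?C"
    by (intro measure_support_subset) (auto simp: \<pi>_def intro!: closed_Collect_le continuous_intros)
  then have "(SUP z\<in>measure_support \<pi>. ennreal (dist (fst z) (snd z))) \<le> ennreal (dist c c')"
    by (intro SUP_least ennreal_leI) auto
  then show ?thesis unfolding W_inf_def by (rule INF_lower2[OF 1])
qed

text \<open>The masses of \<open>c\<close> and \<open>- c\<close> add up to 1, and the first moment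
  along \<open>c\<close> is their difference times \<open>c \<bullet> c\<close>. If it vanishes,
  both masses are one half.\<close>

lemma two_atoms_unique:
  fixes c :: "'a::euclidean_space"
  assumes M: "M \<in> borel_prob" and AE: "AE z in M. z \<in> {c, - c}" and c: "c \<noteq> 0"
    and m: "(\<integral>z. z \<bullet> c \<partial>M) = 0"
  shows "M = two_atoms c"
proof -
  interpret prob_space M using M by (rule borel_probD)
  have s[measurable_cong]: "sets M = sets borel" using M by (rule borel_probD)
  have cc: "c \<noteq> - c" using c by (simp add: eq_neg_iff_add_eq_0 flip: scaleR_2)
  have emb: "measure M A = measure M {c} * indicator A c + measure M {- c} * indicator A (- c)" if A: "A \<in> sets borel" for A
  proof -
    have "measure M A = measure M (({c} \<inter> A) \<union> ({- c} \<inter> A))"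
      by (rule finite_measure_eq_AE) (use A AE s in auto)
    also have "\<dots> = measure M ({c} \<inter> A) + measure M ({- c} \<inter> A)"
      by (rule finite_measure_Union) (use A cc s in auto)
    finally show ?thesis by (auto simp: indicator_def)
  qed
  have 1: "measure M {c} + measure M {- c} = 1"
    using emb[of UNIV] prob_space borel_probD(3)[OF M] by simp
  have "(\<integral>z. z \<bullet> c \<partial>M) = (\<integral>z. indicator {c} z * (c \<bullet> c) - indicator {- c} z * (c \<bullet> c) \<partial>M)"
    by (rule integral_cong_AE) (use AE cc s in \<open>auto simp: indicator_def cong: measurable_cong_sets\<close>)
  also have "\<dots> = measure M {c} * (c \<bullet> c) - measure M {- c} * (c \<bullet> c)"
    using s by (subst Bochner_Integration.integral_diff) (auto intro!: integrable_mult_left integrable_real_indicator simp: emeasure_eq_measure)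
  finally have "measure M {c} = measure M {- c}" using m c by simp
  then have half: "measure M {c} = 1/2" "measure M {- c} = 1/2" using 1 by simp_all
  show ?thesis
  proof (rule measure_eqI)
    show "sets M = sets (two_atoms c)" using s by (simp add: two_atoms_def)
    fix A assume "A \<in> sets M"
    then have A: "A \<in> sets borel" using s by simp
    interpret t: prob_space "two_atoms c" using two_atoms_borel_prob by (rule borel_probD)
    have "measure (two_atoms c) A = (\<integral>z. indicator A z \<partial>two_atoms c)"
      using A by (simp add: two_atoms_def)
    also have "\<dots> = (1/2) *\<^sub>R (indicator A c + indicator A (- c))"
      using A by (intro integral_two_atoms) simp
    finally show "emeasure M A = emeasure (two_atoms c) A"
      using emb[OF A] half by (simp add: emeasure_eq_measure t.emeasure_eq_measure algebra_simps)
  qed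
qed

section \<open>The evolution of integrals of test functions\<close>

lemma grad_eqI:
  assumes "(f has_derivative (\<lambda>h. D \<bullet> h)) (at x)"
  shows "grad f x = D"
  unfolding grad_def
proof (rule the_equality)
  show D: "GDERIV f x :> D" using assms by (simp add: gderiv_def inner_commute)
  show "D' = D" if "GDERIV f x :> D'" for D'
  proof -
    have "(\<lambda>h. h \<bullet> D') = (\<lambda>h. h \<bullet> D)"
      using that D unfolding gderiv_def by (rule has_derivative_unique)
    then have "(D' - D) \<bullet> D' = (D' - D) \<bullet> D" by metis
    then have "(D' - D) \<bullet> (D' - D) = 0" by (simp add: inner_diff_right)
    then show ?thesis by simp
  qed
qed

lemma has_derivative_grad:
  fixes f :: "'a::euclidean_space \<Rightarrow> real"
  assumes "f differentiable at x"
  shows "(f has_derivative (\<lambda>h. grad f x \<bullet> h)) (at x)"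
proof -
  obtain f' where f': "(f has_derivative f') (at x)" using assms by (auto simp: differentiable_def)
  interpret bounded_linear f' using f' by (rule has_derivative_bounded_linear)
  have "f' h = (\<Sum>b\<in>Basis. f' b *\<^sub>R b) \<bullet> h" for h
  proof -
    have "f' h = f' (\<Sum>b\<in>Basis. (h \<bullet> b) *\<^sub>R b)" by (simp add: euclidean_representation)
    also have "\<dots> = (\<Sum>b\<in>Basis. f' b *\<^sub>R b) \<bullet> h"
      by (simp add: sum scaleR inner_sum_left inner_commute[of h] mult.commute)
    finally show ?thesis .
  qed
  then have "f' = (\<lambda>h. (\<Sum>b\<in>Basis. f' b *\<^sub>R b) \<bullet> h)" by blast
  with f' show ?thesis using grad_eqI by metis
qed

lemma locally_lipschitz_on_compact:
  assumes "locally_lipschitz_on S f" "compact X" "X \<subseteq> S"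
  obtains L where "L-lipschitz_on X f"
proof -
  \<comment> \<open>A one-point time domain turns the map into a time-dependent one, to which the
    compactness theorem for such maps applies.\<close>
  have "local_lipschitz {0::real} X (\<lambda>_. f)"
    unfolding local_lipschitz_def
  proof (intro ballI)
    fix x t assume "x \<in> X"
    then obtain u L where "u > 0" "L-lipschitz_on (cball x u \<inter> S) f"
      using assms(1,3) unfolding locally_lipschitz_on_def by blast
    then show "\<exists>u>0. \<exists>L. \<forall>t\<in>cball t u \<inter> {0}. L-lipschitz_on (cball x u \<inter> X) f"
      using assms(3) by (meson lipschitz_on_subset Int_mono order_refl)
  qed
  then show ?thesis
    using local_lipschitz_compact_implies_lipschitz[OF _ assms(2), of "{0::real}" "\<lambda>_. f"] that by auto
qed

lemma locally_lipschitz_on_imp_continuous_on: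
  assumes "locally_lipschitz_on S f"
  shows "continuous_on S f"
  unfolding continuous_on_eq_continuous_within
proof
  fix x assume "x \<in> S"
  then obtain u L where u: "u > 0" "L-lipschitz_on (cball x u \<inter> S) f"
    using assms unfolding locally_lipschitz_on_def by blast
  then have "continuous (at x within cball x u \<inter> S) f"
    using \<open>x \<in> S\<close> by (auto dest!: lipschitz_on_continuous_on simp: continuous_on_eq_continuous_within)
  moreover have "at x within S = at x within cball x u \<inter> S"
    by (rule at_within_nhd[where S = "ball x u"]) (use u in auto)
  ultimately show "continuous (at x within S) f" by simp
qed

text \<open>Bridge from the Lebesgue integral over the half-line in the weak equation to the
  integral over a compact interval, where the fundamental theorem of calculus is applied.\<close>

lemma set_lebesgue_integral_eq_integral_bounded:
  fixes A :: "real \<Rightarrow> real"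
  assumes "continuous_on {0..} A" "\<And>t. t > b \<Longrightarrow> A t = 0" "b \<ge> 0"
  shows "(LINT t:{0..}|lborel. A t) = integral {0..b} A"
proof -
  have "continuous_on {0..b} A" using assms(1) by (rule continuous_on_subset) auto
  then have "set_integrable lborel {0..b} A" by (rule borel_integrable_atLeastAtMost')
  then have "(LINT t:{0..b}|lborel. A t) = integral {0..b} A" by (rule set_borel_integral_eq_integral)
  moreover have "(LINT t:{0..}|lborel. A t) = (LINT t:{0..b}|lborel. A t)"
    unfolding set_lebesgue_integral_def
    by (rule Bochner_Integration.integral_cong) (use assms(2) in \<open>auto simp: indicator_def\<close>)
  ultimately show ?thesis by simp
qed

section \<open>Cutoffs in time and a fundamental lemma\<close>

text \<open>This function is not compactly supported, but it vanishes for large arguments, which suffices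
  for a test function on the half-line.\<close>

definition cutoff :: "real \<Rightarrow> real \<Rightarrow> real \<Rightarrow> real" where
  "cutoff a b t = step ((b - t) / (b - a))"

lemma cutoff_eq_1: "a < b \<Longrightarrow> t \<le> a \<Longrightarrow> cutoff a b t = 1"
  unfolding cutoff_def by (rule step_eq_1) (simp add: field_simps)

lemma cutoff_eq_0: "a < b \<Longrightarrow> b \<le> t \<Longrightarrow> cutoff a b t = 0"
  unfolding cutoff_def by (rule step_eq_0) (simp add: field_simps)

lemma smooth_cutoff: "f \<in> smooth \<Longrightarrow> (\<lambda>t. cutoff a b (f t)) \<in> smooth"
  unfolding cutoff_def divide_inverse by (intro smooth_step smooth.mult smooth_diff smooth.const)

lemma smooth_ident: "(\<lambda>t::real. t) \<in> smooth"
  using smooth.inner[of "1::real"] by simp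

lemma cutoff_antimono: "a < b \<Longrightarrow> s \<le> t \<Longrightarrow> cutoff a b t \<le> cutoff a b s"
  unfolding cutoff_def by (intro step_mono divide_right_mono) auto

lemma cutoff_derivative:
  obtains D where "\<And>t. (cutoff a b has_real_derivative D t) (at t)" "continuous_on UNIV D"
proof -
  have "cutoff a b \<in> smooth" using smooth_cutoff[OF smooth_ident] by simp
  then obtain G where G: "\<And>x. (cutoff a b has_derivative (\<lambda>h. G x \<bullet> h)) (at x)" "continuous_on UNIV G"
    using smooth_gradient by blast
  have "(cutoff a b has_real_derivative G t) (at t)" for t
    using G(1)[of t] by (simp add: has_field_derivative_def)
  then show ?thesis using G(2) by (rule that)
qed

text \<open>If \<open>w t > 0\<close>, let the cutoff fall from 1 to 0 on a short interval to the
  right of \<open>t\<close> on which \<open>w\<close> is at least \<open>w t / 2\<close>. Its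
  derivative is nonpositive with total integral -1, so testing yields at most
  \<open>- w t / 2\<close> instead of 0. Derivatives of cutoffs are the weights that product test
  functions in the weak equation produce.\<close>

lemma fundamental_lemma_cutoff:
  fixes w :: "real \<Rightarrow> real"
  assumes w: "continuous_on {0..} w"
    and zero: "\<And>a b D. 0 \<le> a \<Longrightarrow> a < b \<Longrightarrow> (\<And>t. (cutoff a b has_real_derivative D t) (at t)) \<Longrightarrow>
      continuous_on UNIV D \<Longrightarrow> integral {0..b} (\<lambda>t. D t * w t) = 0"
    and "t \<ge> 0"
  shows "w t = 0"
proof -
  \<comment> \<open>Stated for an arbitrary function so that it applies both to \<open>w\<close> and
    to its negative.\<close>
  have pos: False if w: "continuous_on {0..} w" "w t > 0" "t \<ge> 0"
    and zero: "\<And>a b D. 0 \<le> a \<Longrightarrow> a < b \<Longrightarrow> (\<And>t. (cutoff a b has_real_derivative D t) (at t)) \<Longrightarrow>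
      continuous_on UNIV D \<Longrightarrow> integral {0..b} (\<lambda>t. D t * w t) = 0" for w and t :: real
  proof -
    obtain d where d: "d > 0" "\<And>s. s \<ge> 0 \<Longrightarrow> dist s t < d \<Longrightarrow> dist (w s) (w t) < w t / 2"
      using w unfolding continuous_on_iff by (metis atLeast_iff half_gt_zero)
    define b where "b = t + d / 2"
    have b: "t < b" using d by (simp add: b_def)
    have w': "w s \<ge> w t / 2" if "s \<in> {t..b}" for s
      using d(2)[of s] that w(3) d(1) by (auto simp: b_def dist_real_def abs_if split: if_splits)
    obtain D where D: "\<And>s. (cutoff t b has_real_derivative D s) (at s)" "continuous_on UNIV D"
      using cutoff_derivative[of t b] by blast
    have D0: "D s \<le> 0" for s
    proof -
      have "((\<lambda>s. - cutoff t b s) has_real_derivative - D s) (at s)"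
        by (intro derivative_intros D)
      then have "- D s \<ge> 0"
        by (rule mono_on_imp_deriv_nonneg[of UNIV, rotated]) (auto intro!: mono_onI cutoff_antimono b)
      then show ?thesis by simp
    qed
    have Dl: "D s = 0" if "s < t" for s
    proof -
      have "((\<lambda>_. 1) has_real_derivative 0) (at s)" by simp
      then have "(cutoff t b has_real_derivative 0) (at s)"
        by (rule has_field_derivative_transform_within_open[of _ _ _ "{..<t}"])
          (use that cutoff_eq_1[OF b] in auto)
      then show ?thesis using D(1) DERIV_unique by blast
    qed
    have c: "continuous_on {0..b} D" "continuous_on {0..b} w"
      using D(2) w(1) by (auto intro: continuous_on_subset)
    have "(D has_integral (cutoff t b b - cutoff t b 0)) {0..b}"
      by (rule fundamental_theorem_of_calculus)
        (use b w(3) D(1) in \<open>auto simp flip: has_real_derivative_iff_has_vector_derivative intro: has_field_derivative_at_within\<close>)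
    then have "integral {0..b} D = - 1"
      using cutoff_eq_1[OF b] cutoff_eq_0[OF b] w(3) by (simp add: integral_unique)
    moreover have "integral {0..b} (\<lambda>s. D s * w s) \<le> integral {0..b} (\<lambda>s. (w t / 2) * D s)"
    proof (rule integral_le)
      fix s assume s: "s \<in> {0..b}"
      show "D s * w s \<le> (w t / 2) * D s"
      proof (cases "s < t")
        case False
        then show ?thesis using mult_right_mono_neg[OF w' D0, of s s] s by (simp add: mult.commute)
      qed (simp add: Dl)
    qed (auto intro!: integrable_continuous_real continuous_intros c)
    ultimately show False using zero[OF w(3) b D] w(2) by simp
  qed
  show ?thesis
  proof (rule ccontr)
    assume "w t \<noteq> 0"
    then consider "w t > 0" | "- w t > 0" by linarith
    then show False
    proof cases
      case 1
      then show False using pos[OF w] assms by blast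
    next
      case 2
      show False
        by (rule pos[of "\<lambda>t. - w t"]) (use 2 w zero \<open>t \<ge> 0\<close> in \<open>auto intro!: continuous_intros\<close>)
    qed
  qed
qed

lemma continuous_on_atLeast_iff:
  fixes f :: "real \<Rightarrow> 'b::topological_space"
  shows "continuous_on {a..} f \<longleftrightarrow> (\<forall>b. continuous_on {a..b} f)"
proof
  assume "\<forall>b. continuous_on {a..b} f"
  show "continuous_on {a..} f"
    unfolding continuous_on_eq_continuous_within
  proof
    fix s :: real assume s: "s \<in> {a..}"
    have "continuous (at s within {a..s + 1}) f"
      using \<open>\<forall>b. continuous_on {a..b} f\<close> s by (auto simp: continuous_on_eq_continuous_within)
    moreover have "at s within {a..s + 1} = at s within {a..}"
      by (rule at_within_nhd[where S = "ball s 1"]) (use s in \<open>auto simp: dist_real_def\<close>)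
    ultimately show "continuous (at s within {a..}) f" by simp
  qed
qed (auto intro: continuous_on_subset)

lemma smooth_in_test_functions:
  assumes "f \<in> smooth" "bounded {z \<in> {0..} \<times> UNIV. f z \<noteq> 0}"
  shows "f \<in> test_functions"
  using assms by (auto simp: test_functions_def smooth_on_def smooth_imp_C_k_on compact_closure)

lemma norm_fst_snd_le: "norm (fst z) \<le> norm z" "norm (snd z) \<le> norm z"
  by (metis norm_fst_le norm_snd_le prod.collapse)+

section \<open>The pair force and the drift\<close>

locale mean_field =
  fixes V :: "'a::euclidean_space \<Rightarrow> real" and \<psi> :: "real \<Rightarrow> real" and \<psi>_low :: real
  assumes V_derivative: "(V has_derivative (\<lambda>h. grad V x \<bullet> h)) (at x)"
    and V_bdd_below: "bdd_below (range V)"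
    and grad_minus: "grad V (- x) = - grad V x"
    and grad_lipschitz: "locally_lipschitz_on UNIV (grad V)"
    and grad_bounded: "bounded (range (grad V))"
    and repulsive: "x \<noteq> 0 \<Longrightarrow> grad V x \<bullet> x < 0"
    and \<psi>_bounded: "bounded (\<psi> ` {0..})"
    and \<psi>_lipschitz: "locally_lipschitz_on {0..} \<psi>"
    and \<psi>_low: "\<psi>_low > 0" "s \<ge> 0 \<Longrightarrow> \<psi> s \<ge> \<psi>_low"
begin

definition kernel :: "'a \<times> 'a \<Rightarrow> 'a \<times> 'a \<Rightarrow> 'a" where
  "kernel z z' = \<psi> (norm (fst z - fst z')) *\<^sub>R (snd z - snd z') - grad V (fst z' - fst z)"

text \<open>The velocity field of the characteristics in phase space: the interaction on the
  right-hand side of the weak equation acts as an acceleration with a minus sign. No mean velocity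
  is subtracted, since it is zero for the initial data considered.\<close>

definition drift :: "('a \<times> 'a) measure \<Rightarrow> 'a \<times> 'a \<Rightarrow> 'a \<times> 'a" where
  "drift \<mu> z = (snd z, - (\<integral>z'. kernel z z' \<partial>\<mu>))"

lemma interaction_eq: "interaction V \<psi> \<mu> r v = (\<integral>z'. kernel (r, v) z' \<partial>\<mu>)"
  unfolding interaction_def kernel_def case_prod_beta by simp

lemma grad_0: "grad V 0 = 0"
  using grad_minus[of 0] by (simp add: eq_neg_iff_add_eq_0 flip: scaleR_2)

lemma kernel_self: "kernel z z = 0"
  by (simp add: kernel_def grad_0)

text \<open>The argument of \<open>\<psi>\<close> is unchanged and \<open>grad V\<close> is
  antisymmetric, so the force is odd under reflection of both states. This is why configurations
  symmetric about the origin are preserved.\<close>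

lemma kernel_minus: "kernel (- z) (- z') = - kernel z z'"
proof -
  have "norm (fst z' - fst z) = norm (fst z - fst z')" by (rule norm_minus_commute)
  moreover have "grad V (fst z - fst z') = - grad V (fst z' - fst z)"
    using grad_minus[of "fst z' - fst z"] by simp
  ultimately show ?thesis by (simp add: kernel_def algebra_simps)
qed

lemma continuous_on_grad: "continuous_on S (grad V)"
  using locally_lipschitz_on_imp_continuous_on[OF grad_lipschitz] continuous_on_subset by blast

lemma continuous_on_\<psi>: "continuous_on {0..} \<psi>"
  by (rule locally_lipschitz_on_imp_continuous_on[OF \<psi>_lipschitz])

lemma continuous_on_kernel [continuous_intros]:
  assumes "continuous_on S f" "continuous_on S g"
  shows "continuous_on S (\<lambda>x. kernel (f x) (g x))"
  unfolding kernel_def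
  by (intro continuous_intros assms continuous_on_compose2[OF continuous_on_\<psi>]
      continuous_on_compose2[OF continuous_on_grad[of UNIV]]) auto

text \<open>With \<open>\<psi>\<close> and \<open>grad V\<close> bounded, only the relative velocity
  can grow. The linear bound is what rules out blow-up of trajectories.\<close>

lemma kernel_growth:
  obtains C where "C \<ge> 0" "\<And>z z'. norm (kernel z z') \<le> C * (1 + norm z + norm z')"
proof -
  obtain B G where B: "\<And>s. s \<ge> 0 \<Longrightarrow> norm (\<psi> s) \<le> B" and G: "\<And>x. norm (grad V x) \<le> G"
    using \<psi>_bounded grad_bounded unfolding bounded_iff by auto
  have BG: "B \<ge> 0" "G \<ge> 0" using order_trans[OF norm_ge_zero B[of 0]] order_trans[OF norm_ge_zero G] by auto
  show ?thesis
  proof (rule that[of "B + G"])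
    fix z z' :: "'a \<times> 'a"
    have "norm (snd z - snd z') \<le> norm z + norm z'"
      using norm_triangle_ineq4[of "snd z" "snd z'"] norm_fst_snd_le(2)[of z] norm_fst_snd_le(2)[of z']
      by linarith
    moreover have "norm (kernel z z') \<le> \<bar>\<psi> (norm (fst z - fst z'))\<bar> * norm (snd z - snd z') + norm (grad V (fst z' - fst z))"
      unfolding kernel_def by (rule order_trans[OF norm_triangle_ineq4]) simp
    ultimately have "norm (kernel z z') \<le> B * (norm z + norm z') + G"
      using B[of "norm (fst z - fst z')"] G[of "fst z' - fst z"] BG
      by (smt (verit) mult_mono norm_ge_zero real_norm_def)
    also have "\<dots> \<le> (B + G) * (1 + norm z + norm z')"
      using BG by (simp add: algebra_simps add_nonneg_nonneg)
    finally show "norm (kernel z z') \<le> (B + G) * (1 + norm z + norm z')" .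
  qed (use BG in simp)
qed

text \<open>The estimate is local because the increment of \<open>\<psi>\<close> is multiplied by a
  relative velocity, which is at most \<open>2 * R\<close> on the ball.\<close>

lemma kernel_lipschitz:
  obtains L where "L \<ge> 0"
    "\<And>z z' w w'. norm z \<le> R \<Longrightarrow> norm z' \<le> R \<Longrightarrow> norm w \<le> R \<Longrightarrow> norm w' \<le> R \<Longrightarrow>
      norm (kernel z z' - kernel w w') \<le> L * (norm (z - w) + norm (z' - w'))"
proof -
  obtain B where B: "\<And>s. s \<ge> 0 \<Longrightarrow> norm (\<psi> s) \<le> B"
    using \<psi>_bounded unfolding bounded_iff by auto
  have B0: "B \<ge> 0" using order_trans[OF norm_ge_zero B[of 0]] by auto
  obtain L1 where L1: "L1-lipschitz_on {0..2 * R} \<psi>"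
    by (rule locally_lipschitz_on_compact[OF \<psi>_lipschitz, of "{0..2 * R}"]) auto
  obtain L2 where L2: "L2-lipschitz_on (cball 0 (2 * R)) (grad V)"
    by (rule locally_lipschitz_on_compact[OF grad_lipschitz, of "cball 0 (2 * R)"]) auto
  have L0: "L1 \<ge> 0" "L2 \<ge> 0" using L1 L2 by (auto simp: lipschitz_on_def)
  \<comment> \<open>The summands account for the change of \<open>\<psi>\<close> times a relative
    velocity, for \<open>\<psi>\<close> times the change of that velocity, and for the change of
    \<open>grad V\<close>. The modulus of \<open>R\<close> keeps \<open>L\<close> nonnegative for
    every \<open>R\<close>.\<close>
  define L where "L = L1 * (2 * \<bar>R\<bar>) + B + L2"
  show ?thesis
  proof (rule that[of L])
    show "L \<ge> 0" using L0 B0 by (simp add: L_def)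
    fix z z' w w' :: "'a \<times> 'a"
    assume R: "norm z \<le> R" "norm z' \<le> R" "norm w \<le> R" "norm w' \<le> R"
    define D where "D = norm (z - w) + norm (z' - w')"
    have n: "norm (fst a - fst b) \<le> norm (a - b)" "norm (snd a - snd b) \<le> norm (a - b)" for a b :: "'a \<times> 'a"
      using norm_fst_snd_le[of "a - b"] by auto
    have D: "norm ((fst z' - fst z) - (fst w' - fst w)) \<le> D" "norm ((snd z - snd z') - (snd w - snd w')) \<le> D"
      using n[of z w] n[of z' w'] norm_triangle_ineq4[of "fst z' - fst w'" "fst z - fst w"]
        norm_triangle_ineq4[of "snd z - snd w" "snd z' - snd w'"]
      by (auto simp: D_def algebra_simps)
    have D': "\<bar>norm (fst z - fst z') - norm (fst w - fst w')\<bar> \<le> D"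
      using norm_triangle_ineq3[of "fst z' - fst z" "fst w' - fst w"] D(1) by (simp add: norm_minus_commute)
    have bd: "norm (fst a - fst b) \<le> 2 * R" "norm (snd a - snd b) \<le> 2 * R"
      if "norm a \<le> R" "norm b \<le> R" for a b :: "'a \<times> 'a"
      using n[of a b] norm_triangle_ineq4[of a b] that by auto
    have 1: "\<bar>\<psi> (norm (fst z - fst z')) - \<psi> (norm (fst w - fst w'))\<bar> \<le> L1 * D"
      using lipschitz_onD[OF L1, of "norm (fst z - fst z')" "norm (fst w - fst w')"] bd[OF R(1,2)] bd[OF R(3,4)]
        mult_left_mono[OF D' L0(1)] by (simp add: dist_real_def)
    have 2: "norm (grad V (fst z' - fst z) - grad V (fst w' - fst w)) \<le> L2 * D"
      using lipschitz_onD[OF L2, of "fst z' - fst z" "fst w' - fst w"] bd[OF R(2,1)] bd[OF R(4,3)]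
        mult_left_mono[OF D(1) L0(2)] by (simp add: dist_norm norm_minus_commute)
    have "kernel z z' - kernel w w' =
        (\<psi> (norm (fst z - fst z')) - \<psi> (norm (fst w - fst w'))) *\<^sub>R (snd z - snd z')
        + \<psi> (norm (fst w - fst w')) *\<^sub>R ((snd z - snd z') - (snd w - snd w'))
        - (grad V (fst z' - fst z) - grad V (fst w' - fst w))"
      by (simp add: kernel_def algebra_simps)
    also have "norm \<dots> \<le> \<bar>\<psi> (norm (fst z - fst z')) - \<psi> (norm (fst w - fst w'))\<bar> * norm (snd z - snd z')
        + \<bar>\<psi> (norm (fst w - fst w'))\<bar> * norm ((snd z - snd z') - (snd w - snd w'))
        + norm (grad V (fst z' - fst z) - grad V (fst w' - fst w))"
      by (rule order_trans[OF norm_triangle_ineq4 add_mono[OF order_trans[OF norm_triangle_ineq] order_refl]]) simp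
    also have "\<dots> \<le> L1 * D * (2 * \<bar>R\<bar>) + B * D + L2 * D"
      using 1 2 D(2) bd(2)[OF R(1,2)] B[of "norm (fst w - fst w')"] B0
      by (intro add_mono mult_mono) (auto intro: order_trans[OF abs_ge_zero])
    also have "\<dots> = L * (norm (z - w) + norm (z' - w'))" by (simp add: L_def D_def algebra_simps)
    finally show "norm (kernel z z' - kernel w w') \<le> L * (norm (z - w) + norm (z' - w'))" .
  qed
qed

lemma continuous_on_drift:
  assumes "continuous_curve_Pc g"
  shows "continuous_on ({0..} \<times> UNIV) (\<lambda>(s, z). drift (g s) z)"
proof -
  have "continuous_on ({0..} \<times> UNIV) (\<lambda>x. \<integral>z'. kernel (snd x) z' \<partial>g (fst x))"
    by (rule continuous_curve_integral[OF assms]) (auto simp: case_prod_beta intro!: continuous_intros)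
  then show ?thesis unfolding drift_def case_prod_beta by (intro continuous_intros)
qed

lemma continuous_on_drift_at:
  assumes "continuous_curve_Pc g" "s \<ge> 0"
  shows "continuous_on UNIV (drift (g s))"
proof -
  have "continuous_on UNIV (\<lambda>z. (\<lambda>(s, z). drift (g s) z) (s, z))"
    by (rule continuous_on_compose2[OF continuous_on_drift[OF assms(1)]])
      (use assms(2) in \<open>auto intro!: continuous_intros\<close>)
  then show ?thesis by simp
qed

lemma continuous_integral_drift:
  assumes g: "continuous_curve_Pc g" and G: "continuous_on UNIV G"
  shows "continuous_on {0..} (\<lambda>s. \<integral>z. G z \<bullet> drift (g s) z \<partial>g s)"
proof (rule continuous_curve_integral[OF g])
  have "continuous_on ({0..} \<times> UNIV) (\<lambda>x. G (snd x) \<bullet> (\<lambda>(s, z). drift (g s) z) x)"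
    by (intro continuous_intros continuous_on_drift[OF g] continuous_on_compose2[OF G]) auto
  then show "continuous_on ({0..} \<times> UNIV) (\<lambda>(s, z). G z \<bullet> drift (g s) z)"
    by (simp add: case_prod_beta)
qed (auto intro!: continuous_intros)

text \<open>The test function is \<open>cutoff a b t * \<phi> z\<close>. The left-hand side of the
  weak equation contributes the position part of the drift and the right-hand side its velocity
  part; together they form the derivative of \<open>\<phi>\<close> along the drift.\<close>

lemma weak_form_separable:
  assumes sol: "mean_field_solution V \<psi> f0 g" and mv: "mean_velocity f0 = 0"
    and \<phi>: "\<phi> \<in> smooth" "bounded {z. \<phi> z \<noteq> 0}"
    and G: "\<And>z. (\<phi> has_derivative (\<lambda>h. G z \<bullet> h)) (at z)" "continuous_on UNIV G"
    and ab: "0 \<le> a" "a < b"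
    and D: "\<And>t. (cutoff a b has_real_derivative D t) (at t)" "continuous_on UNIV D"
  shows "integral {0..b} (\<lambda>t. D t * (\<integral>z. \<phi> z \<partial>g t) + cutoff a b t * (\<integral>z. G z \<bullet> drift (g t) z \<partial>g t))
    + (\<integral>z. \<phi> z \<partial>f0) = 0"
proof -
  have g: "continuous_curve_Pc g" using sol by (simp add: mean_field_solution_def)
  then have gP: "g t \<in> Pc" if "t \<ge> 0" for t using that by (simp add: continuous_curve_Pc_def)
  have \<phi>c: "continuous_on S \<phi>" for S using smooth_continuous_on[OF \<phi>(1)] .
  have cc: "continuous_on S (cutoff a b)" for S
    using smooth_continuous_on[OF smooth_cutoff[OF smooth_ident]] .
  define h where "h x = cutoff a b (fst x) * \<phi> (snd x)" for x :: "real \<times> 'a \<times> 'a"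
  have "h \<in> smooth"
    unfolding h_def by (intro smooth.mult smooth_snd \<phi> smooth_fst[OF smooth_cutoff[OF smooth_ident]])
  moreover have "bounded {z \<in> {0..} \<times> UNIV. h z \<noteq> 0}"
  proof (rule bounded_subset)
    show "bounded ({0..b} \<times> {z. \<phi> z \<noteq> 0})" using \<phi>(2) by (intro bounded_Times) auto
    show "{z \<in> {0..} \<times> UNIV. h z \<noteq> 0} \<subseteq> {0..b} \<times> {z. \<phi> z \<noteq> 0}"
    proof (clarsimp simp: h_def)
      fix t assume "cutoff a b t \<noteq> 0"
      then show "t \<le> b" using cutoff_eq_0[OF ab(2), of t] by linarith
    qed
  qed
  ultimately have "h \<in> test_functions" by (rule smooth_in_test_functions)
  note weak = sol[unfolded mean_field_solution_def, THEN conjunct2, rule_format, OF this, unfolded mv]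
  have dt: "vector_derivative (\<lambda>s. h (s, r, v)) (at t within {0..}) = D t * \<phi> (r, v)" if "t \<ge> 0" for t r v
  proof (rule vector_derivative_within)
    show "((\<lambda>s. h (s, r, v)) has_vector_derivative D t * \<phi> (r, v)) (at t within {0..})"
      unfolding h_def has_real_derivative_iff_has_vector_derivative[symmetric]
      by (auto intro!: derivative_eq_intros has_field_derivative_at_within[OF D(1)])
    have "at_right t \<le> at t within {0..}" by (rule at_le) (use that in auto)
    then show "at t within {0..} \<noteq> bot"
      using trivial_limit_at_right_real[of t] by (auto simp: bot_unique)
  qed
  have gr: "grad (\<lambda>x. h (t, x, v)) r = cutoff a b t *\<^sub>R fst (G (r, v))" for t r v
  proof (rule grad_eqI)
    have "((\<lambda>x. \<phi> (x, v)) has_derivative (\<lambda>k. G (r, v) \<bullet> (k, 0))) (at r)"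
      by (rule has_derivative_compose[OF _ G(1), of "\<lambda>x. (x, v)"]) (auto intro!: derivative_eq_intros)
    then show "((\<lambda>x. h (t, x, v)) has_derivative (\<bullet>) (cutoff a b t *\<^sub>R fst (G (r, v)))) (at r)"
      unfolding h_def by (auto intro!: derivative_eq_intros simp: inner_prod_def)
  qed
  have gv: "grad (\<lambda>x. h (t, r, x)) v = cutoff a b t *\<^sub>R snd (G (r, v))" for t r v
  proof (rule grad_eqI)
    have "((\<lambda>x. \<phi> (r, x)) has_derivative (\<lambda>k. G (r, v) \<bullet> (0, k))) (at v)"
      by (rule has_derivative_compose[OF _ G(1), of "\<lambda>x. (r, x)"]) (auto intro!: derivative_eq_intros)
    then show "((\<lambda>x. h (t, r, x)) has_derivative (\<bullet>) (cutoff a b t *\<^sub>R snd (G (r, v)))) (at v)"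
      unfolding h_def by (auto intro!: derivative_eq_intros simp: inner_prod_def)
  qed
  define m where "m t = (\<integral>z. \<phi> z \<partial>g t)" for t
  define k1 where "k1 t = (\<integral>z. (fst (G z), 0) \<bullet> drift (g t) z \<partial>g t)" for t
  define k2 where "k2 t = (\<integral>z. (0, snd (G z)) \<bullet> drift (g t) z \<partial>g t)" for t
  have c: "continuous_on {0..} m" "continuous_on {0..} k1" "continuous_on {0..} k2"
    unfolding m_def k1_def k2_def
    by (intro continuous_integral_drift[OF g] continuous_curve_integral[OF g] continuous_intros G(2);
      auto simp: case_prod_beta intro!: continuous_intros continuous_on_compose2[OF \<phi>c[of UNIV]])+
  have Dc: "continuous_on S D" for S using D(2) continuous_on_subset by blast
  \<comment> \<open>Beyond \<open>b\<close> the cutoff is 0 on an open set, so its derivative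
    vanishes as well and the integral over the half-line reduces to \<open>{0..b}\<close>.\<close>
  have Db: "D t = 0" if "t > b" for t
  proof -
    have "((\<lambda>_. 0) has_real_derivative 0) (at t)" by simp
    then have "(cutoff a b has_real_derivative 0) (at t)"
      by (rule has_field_derivative_transform_within_open[of _ _ _ "{b<..}"])
        (use that cutoff_eq_0[OF ab(2)] in auto)
    then show ?thesis using D(1) DERIV_unique by blast
  qed
  have int: "integrable (g t) f" if "t \<ge> 0" "continuous_on UNIV f" for t and f :: "'a \<times> 'a \<Rightarrow> real"
    using Pc_integrable[OF gP] that by blast
  have dc: "continuous_on UNIV (drift (g t))" if "t \<ge> 0" for t
    using continuous_on_drift_at[OF g that] .
  have "(LINT t:{0..}|lborel. (\<integral>(r, v). vector_derivative (\<lambda>s. h (s, r, v)) (at t within {0..})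
            + (v - 0) \<bullet> grad (\<lambda>x. h (t, x, v)) r \<partial>g t))
      = (LINT t:{0..}|lborel. D t * m t + cutoff a b t * k1 t)"
  proof (rule set_lebesgue_integral_cong)
    show "\<forall>t. t \<in> {0..} \<longrightarrow> (\<integral>(r, v). vector_derivative (\<lambda>s. h (s, r, v)) (at t within {0..})
            + (v - 0) \<bullet> grad (\<lambda>x. h (t, x, v)) r \<partial>g t) = D t * m t + cutoff a b t * k1 t"
    proof (intro allI impI)
      fix t :: real assume "t \<in> {0..}"
      then have t: "t \<ge> 0" by simp
      have "(\<integral>(r, v). vector_derivative (\<lambda>s. h (s, r, v)) (at t within {0..})
            + (v - 0) \<bullet> grad (\<lambda>x. h (t, x, v)) r \<partial>g t)
          = (\<integral>z. D t * \<phi> z + cutoff a b t * ((fst (G z), 0) \<bullet> drift (g t) z) \<partial>g t)"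
        by (intro Bochner_Integration.integral_cong) (auto simp: dt[OF t] gr drift_def inner_commute)
      also have "\<dots> = D t * m t + cutoff a b t * k1 t"
        unfolding m_def k1_def
        by (subst Bochner_Integration.integral_add)
          (auto intro!: int[OF t] continuous_intros \<phi>c G(2) dc[OF t])
      finally show "(\<integral>(r, v). vector_derivative (\<lambda>s. h (s, r, v)) (at t within {0..})
            + (v - 0) \<bullet> grad (\<lambda>x. h (t, x, v)) r \<partial>g t) = D t * m t + cutoff a b t * k1 t" .
    qed
  qed simp
  also have "\<dots> = integral {0..b} (\<lambda>t. D t * m t + cutoff a b t * k1 t)"
    by (rule set_lebesgue_integral_eq_integral_bounded)
      (use ab Db cutoff_eq_0[OF ab(2)] in \<open>auto intro!: continuous_intros c Dc cc\<close>)
  finally have L: "(LINT t:{0..}|lborel. (\<integral>(r, v). vector_derivative (\<lambda>s. h (s, r, v)) (at t within {0..})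
            + (v - 0) \<bullet> grad (\<lambda>x. h (t, x, v)) r \<partial>g t)) = integral {0..b} (\<lambda>t. D t * m t + cutoff a b t * k1 t)" .
  have "(LINT t:{0..}|lborel. (\<integral>(r, v). interaction V \<psi> (g t) r v \<bullet> grad (\<lambda>w. h (t, r, w)) v \<partial>g t))
      = (LINT t:{0..}|lborel. - (cutoff a b t * k2 t))"
  proof (rule set_lebesgue_integral_cong)
    show "\<forall>t. t \<in> {0..} \<longrightarrow> (\<integral>(r, v). interaction V \<psi> (g t) r v \<bullet> grad (\<lambda>w. h (t, r, w)) v \<partial>g t)
        = - (cutoff a b t * k2 t)"
    proof (intro allI impI)
      fix t :: real
      have "- (cutoff a b t * k2 t) = (\<integral>z. - (cutoff a b t * ((0, snd (G z)) \<bullet> drift (g t) z)) \<partial>g t)"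
        unfolding k2_def by simp
      also have "\<dots> = (\<integral>(r, v). interaction V \<psi> (g t) r v \<bullet> grad (\<lambda>w. h (t, r, w)) v \<partial>g t)"
        by (intro Bochner_Integration.integral_cong)
          (auto simp: gv interaction_eq drift_def inner_commute inner_minus_right simp del: Bochner_Integration.integral_minus)
      finally show "(\<integral>(r, v). interaction V \<psi> (g t) r v \<bullet> grad (\<lambda>w. h (t, r, w)) v \<partial>g t) = - (cutoff a b t * k2 t)"
        by simp
    qed
  qed simp
  also have "\<dots> = integral {0..b} (\<lambda>t. - (cutoff a b t * k2 t))"
    by (rule set_lebesgue_integral_eq_integral_bounded)
      (use ab cutoff_eq_0[OF ab(2)] in \<open>auto intro!: continuous_intros c cc\<close>)
  finally have R: "(LINT t:{0..}|lborel. (\<integral>(r, v). interaction V \<psi> (g t) r v \<bullet> grad (\<lambda>w. h (t, r, w)) v \<partial>g t))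
      = integral {0..b} (\<lambda>t. - (cutoff a b t * k2 t))" .
  have h0: "(\<integral>(r, v). h (0, r, v) \<partial>f0) = (\<integral>z. \<phi> z \<partial>f0)"
    using cutoff_eq_1[OF ab(2,1)] by (simp add: h_def case_prod_beta)
  have c': "continuous_on {0..b} m" "continuous_on {0..b} k1" "continuous_on {0..b} k2"
    using c by (auto intro: continuous_on_subset)
  have k: "(\<integral>z. G z \<bullet> drift (g t) z \<partial>g t) = k1 t + k2 t" if "t \<ge> 0" for t
    unfolding k1_def k2_def
    by (subst Bochner_Integration.integral_add[symmetric])
      (auto intro!: int[OF that] continuous_intros G(2) dc[OF that] simp: inner_prod_def)
  have "integral {0..b} (\<lambda>t. D t * (\<integral>z. \<phi> z \<partial>g t) + cutoff a b t * (\<integral>z. G z \<bullet> drift (g t) z \<partial>g t))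
      = integral {0..b} (\<lambda>t. (D t * m t + cutoff a b t * k1 t) - (- (cutoff a b t * k2 t)))"
    by (rule integral_cong) (simp add: k m_def algebra_simps)
  also have "\<dots> = integral {0..b} (\<lambda>t. D t * m t + cutoff a b t * k1 t) - integral {0..b} (\<lambda>t. - (cutoff a b t * k2 t))"
    by (rule integral_diff) (intro integrable_continuous_real continuous_intros c' Dc cc)+
  finally show ?thesis using weak unfolding L R h0 by simp
qed

text \<open>The weak equation says that \<open>k\<close> is the distributional derivative of
  \<open>m\<close>. The antiderivative \<open>K\<close>, with initial value taken from
  \<open>f0\<close>, satisfies the same identities against cutoffs, so \<open>m - K\<close> is
  annihilated by all their derivatives. The initial value comes from the equation itself, through
  its term at time 0.\<close>

theorem evolution:
  assumes sol: "mean_field_solution V \<psi> f0 g" and mv: "mean_velocity f0 = 0"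
    and \<phi>: "\<phi> \<in> smooth" "bounded {z. \<phi> z \<noteq> 0}"
    and G: "\<And>z. (\<phi> has_derivative (\<lambda>h. G z \<bullet> h)) (at z)" "continuous_on UNIV G"
    and t: "t \<ge> 0"
  shows "(\<integral>z. \<phi> z \<partial>g t) = (\<integral>z. \<phi> z \<partial>f0) + integral {0..t} (\<lambda>s. \<integral>z. G z \<bullet> drift (g s) z \<partial>g s)"
proof -
  have g: "continuous_curve_Pc g" using sol by (simp add: mean_field_solution_def)
  define m where "m t = (\<integral>z. \<phi> z \<partial>g t)" for t
  define k where "k t = (\<integral>z. G z \<bullet> drift (g t) z \<partial>g t)" for t
  define K where "K t = (\<integral>z. \<phi> z \<partial>f0) + integral {0..t} k" for t
  have kc: "continuous_on {0..} k" unfolding k_def by (rule continuous_integral_drift[OF g G(2)])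
  have mc: "continuous_on {0..} m" unfolding m_def
    by (rule continuous_curve_integral[OF g])
      (auto simp: case_prod_beta intro!: continuous_intros continuous_on_compose2[OF smooth_continuous_on[OF \<phi>(1), of UNIV]])
  have Kd: "(K has_real_derivative k s) (at s within {0..b})" if "s \<in> {0..b}" for s b
  proof -
    have "continuous_on {0..b} k" using kc by (rule continuous_on_subset) auto
    then have "((\<lambda>u. integral {0..u} k) has_real_derivative k s) (at s within {0..b})"
      using that by (rule integral_has_real_derivative)
    then show ?thesis unfolding K_def by (auto intro!: derivative_eq_intros)
  qed
  have Kcb: "continuous_on {0..b} K" for b
    using Kd by (meson DERIV_continuous continuous_on_eq_continuous_within)
  have Kc: "continuous_on {0..} K"
    using Kcb by (simp add: continuous_on_atLeast_iff)
  have "m t - K t = 0"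
  proof (rule fundamental_lemma_cutoff[where w = "\<lambda>t. m t - K t"])
    show "continuous_on {0..} (\<lambda>t. m t - K t)" by (intro continuous_intros mc Kc)
    fix a b :: real and D assume ab: "0 \<le> a" "a < b"
      and D: "\<And>t. (cutoff a b has_real_derivative D t) (at t)" "continuous_on UNIV D"
    have cc: "continuous_on {0..b} (cutoff a b)"
      using smooth_continuous_on[OF smooth_cutoff[OF smooth_ident]] .
    have c: "continuous_on {0..b} m" "continuous_on {0..b} k" "continuous_on {0..b} D"
      using mc kc D(2) by (auto intro: continuous_on_subset)
    \<comment> \<open>The integrand is the derivative of \<open>cutoff a b t * K t\<close>; the
      boundary term at \<open>b\<close> vanishes, and at 0 the product is the integral of
      \<open>\<phi>\<close> against \<open>f0\<close>.\<close>
    have "((\<lambda>t. D t * K t + cutoff a b t * k t) has_integral (cutoff a b b * K b - cutoff a b 0 * K 0)) {0..b}"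
    proof (rule fundamental_theorem_of_calculus)
      fix s assume "s \<in> {0..b}"
      then show "((\<lambda>t. cutoff a b t * K t) has_vector_derivative D s * K s + cutoff a b s * k s) (at s within {0..b})"
        unfolding has_real_derivative_iff_has_vector_derivative[symmetric]
        by (auto intro!: derivative_eq_intros Kd has_field_derivative_at_within[OF D(1)])
    qed (use ab in simp)
    then have "integral {0..b} (\<lambda>t. D t * K t + cutoff a b t * k t) + (\<integral>z. \<phi> z \<partial>f0) = 0"
      using cutoff_eq_0[OF ab(2), of b] cutoff_eq_1[OF ab(2,1)] by (simp add: integral_unique K_def)
    moreover have "integral {0..b} (\<lambda>t. D t * m t + cutoff a b t * k t) + (\<integral>z. \<phi> z \<partial>f0) = 0"
      using weak_form_separable[OF sol mv \<phi> G ab D] by (simp add: m_def k_def)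
    moreover have "integral {0..b} (\<lambda>t. D t * (m t - K t)) =
        integral {0..b} (\<lambda>t. (D t * m t + cutoff a b t * k t) - (D t * K t + cutoff a b t * k t))"
      by (simp add: algebra_simps)
    moreover have "\<dots> = integral {0..b} (\<lambda>t. D t * m t + cutoff a b t * k t) - integral {0..b} (\<lambda>t. D t * K t + cutoff a b t * k t)"
      by (rule integral_diff) (intro integrable_continuous_real continuous_intros c Kcb cc)+
    ultimately show "integral {0..b} (\<lambda>t. D t * (m t - K t)) = 0" by simp
  qed (rule t)
  then show ?thesis by (simp add: m_def K_def k_def[abs_def])
qed

end

section \<open>The two-particle dynamics\<close>

text \<open>Picard iteration on the whole half-line. Linear growth bounds all iterates by one
  exponential, so on \<open>{0..T}\<close> they stay in a ball with a single Lipschitz constant, and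
  consecutive iterates differ by at most a constant times
  \<open>(L * t) ^ n / fact n\<close>.\<close>

lemma ode_solution_exists:
  fixes F :: "'b::euclidean_space \<Rightarrow> 'b"
  assumes lip: "\<And>R. \<exists>L. L-lipschitz_on (cball 0 R) F"
    and growth: "\<And>z. norm (F z) \<le> A * (1 + norm z)" and A: "A > 0"
  obtains z where "z 0 = z0" "\<And>t. t \<ge> 0 \<Longrightarrow> (z has_vector_derivative F (z t)) (at t within {0..})"
proof -
  have Fc: "continuous_on UNIV F"
  proof (rule continuous_at_imp_continuous_on, rule ballI)
    fix x :: 'b
    obtain L where "L-lipschitz_on (cball 0 (norm x + 1)) F" using lip by blast
    then have "continuous_on (ball 0 (norm x + 1)) F"
      using lipschitz_on_continuous_on continuous_on_subset ball_subset_cball by blast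
    then show "isCont F x" by (simp add: continuous_on_eq_continuous_at)
  qed
  define X where "X = rec_nat (\<lambda>_. z0) (\<lambda>n x (t::real). z0 + integral {0..t} (\<lambda>s. F (x s)))"
  have X0: "X 0 = (\<lambda>_. z0)" and XS: "X (Suc n) = (\<lambda>t. z0 + integral {0..t} (\<lambda>s. F (X n s)))" for n
    by (simp_all add: X_def)
  have Xc: "continuous_on {0..T} (X n)" for n T
  proof (induction n)
    case 0
    then show ?case by (simp add: X0)
  next
    case (Suc n)
    have "continuous_on {0..T} (\<lambda>s. F (X n s))"
      by (rule continuous_on_compose2[OF Fc Suc]) auto
    then have "continuous_on {0..T} (\<lambda>t. integral {0..t} (\<lambda>s. F (X n s)))"
      by (rule indefinite_integral_continuous_1[OF integrable_continuous_real])
    then show ?case unfolding XS by (intro continuous_intros)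
  qed
  have FXc: "continuous_on {0..T} (\<lambda>s. F (X n s))" for n T
    by (rule continuous_on_compose2[OF Fc Xc]) auto
  \<comment> \<open>\<open>Q\<close> solves \<open>Q' = A * Q\<close> with
    \<open>Q 0 = 1 + norm z0\<close>, so the bound \<open>1 + norm (X n t) \<le> Q t\<close> is
    reproduced by the integral equation.\<close>
  define Q where "Q t = (1 + norm z0) * exp (A * t)" for t
  have Qi: "((\<lambda>s. A * Q s) has_integral (Q t - Q 0)) {0..t}" if "t \<ge> 0" for t
    using that unfolding Q_def
    by (intro fundamental_theorem_of_calculus)
      (auto intro!: derivative_eq_intros simp flip: has_real_derivative_iff_has_vector_derivative)
  have Q: "1 + norm (X n t) \<le> Q t" if "t \<ge> 0" for n t
    using that
  proof (induction n arbitrary: t)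
    case 0
    then show ?case using A mult_left_mono[of 1 "exp (A * t)" "1 + norm z0"]
      by (simp add: X0 Q_def)
  next
    case (Suc n)
    have "norm (integral {0..t} (\<lambda>s. F (X n s))) \<le> integral {0..t} (\<lambda>s. A * Q s)"
    proof (rule integral_norm_bound_integral)
      show "norm (F (X n s)) \<le> A * Q s" if "s \<in> {0..t}" for s
        by (rule order_trans[OF growth mult_left_mono[OF Suc.IH]]) (use that A in auto)
    qed (use Qi[OF Suc.prems] in \<open>auto intro: integrable_continuous_real FXc\<close>)
    also have "\<dots> = Q t - Q 0" using Qi[OF Suc.prems] by (rule integral_unique)
    finally show ?case
      using norm_triangle_ineq[of z0 "integral {0..t} (\<lambda>s. F (X n s))"] by (simp add: XS Q_def)
  qed
  \<comment> \<open>Taken pointwise, the limit is one function for all \<open>T\<close>; uniform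
    convergence to it is then shown on each \<open>{0..T}\<close>.\<close>
  define Y where "Y t = lim (\<lambda>n. X n t)" for t
  have unif: "uniform_limit {0..T} X Y sequentially \<and>
      uniform_limit {0..T} (\<lambda>n t. F (X n t)) (\<lambda>t. F (Y t)) sequentially" if T: "T \<ge> 0" for T
  proof -
    obtain L where L: "L-lipschitz_on (cball 0 (Q T)) F" using lip by blast
    have L0: "L \<ge> 0" using L by (simp add: lipschitz_on_def)
    have QT: "norm (X n t) \<le> Q T" if "t \<in> {0..T}" for n t
    proof -
      have "norm (X n t) \<le> Q t" using Q[of t n] that by simp
      also have "\<dots> \<le> Q T" unfolding Q_def using that A by (intro mult_left_mono) auto
      finally show ?thesis .
    qed
    have d: "norm (X (Suc n) t - X n t) \<le> 2 * Q T * (L * t) ^ n / fact n" if "t \<in> {0..T}" for n t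
      using that
    proof (induction n arbitrary: t)
      case 0
      then show ?case
        using norm_triangle_ineq4[of "X (Suc 0) t" "X 0 t"] QT[of t "Suc 0"] QT[of t 0] by simp
    next
      case (Suc n)
      have c: "continuous_on {0..t} (\<lambda>s. F (X m s))" for m by (rule FXc)
      \<comment> \<open>The bound for \<open>Suc n\<close> is the antiderivative of \<open>L\<close>
        times the bound for \<open>n\<close>.\<close>
      have "((\<lambda>s. 2 * Q T / fact (Suc n) * (L * s) ^ Suc n) has_real_derivative
          L * (2 * Q T * (L * s) ^ n / fact n)) (at s within {0..t})" for s
      proof -
        have "((\<lambda>s. (L * s) ^ Suc n) has_real_derivative real (Suc n) * (L * s) ^ n * L) (at s within {0..t})"
          by (rule derivative_eq_intros refl | simp)+
        then have "((\<lambda>s. 2 * Q T / fact (Suc n) * (L * s) ^ Suc n) has_real_derivative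
            2 * Q T / fact (Suc n) * (real (Suc n) * (L * s) ^ n * L)) (at s within {0..t})"
          by (rule DERIV_cmult)
        moreover have "2 * Q T / fact (Suc n) * (real (Suc n) * (L * s) ^ n * L) = L * (2 * Q T * (L * s) ^ n / fact n)"
          unfolding fact_Suc of_nat_mult of_nat_fact by (simp add: field_simps del: of_nat_Suc)
        ultimately show ?thesis by (rule DERIV_cong)
      qed
      then have hi: "((\<lambda>s. L * (2 * Q T * (L * s) ^ n / fact n)) has_integral
          (2 * Q T / fact (Suc n) * (L * t) ^ Suc n - 2 * Q T / fact (Suc n) * (L * 0) ^ Suc n)) {0..t}"
        unfolding has_real_derivative_iff_has_vector_derivative
        by (rule fundamental_theorem_of_calculus[rotated]) (use Suc.prems in simp)
      have "X (Suc (Suc n)) t - X (Suc n) t = integral {0..t} (\<lambda>s. F (X (Suc n) s)) - integral {0..t} (\<lambda>s. F (X n s))"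
        unfolding XS by simp
      also have "\<dots> = integral {0..t} (\<lambda>s. F (X (Suc n) s) - F (X n s))"
        by (rule integral_diff[symmetric]) (intro integrable_continuous_real c)+
      also have "norm \<dots> \<le> integral {0..t} (\<lambda>s. L * (2 * Q T * (L * s) ^ n / fact n))"
      proof (rule integral_norm_bound_integral)
        fix s assume s: "s \<in> {0..t}"
        then have sT: "s \<in> {0..T}" using Suc.prems by simp
        have "norm (F (X (Suc n) s) - F (X n s)) \<le> L * norm (X (Suc n) s - X n s)"
          using lipschitz_onD[OF L, of "X (Suc n) s" "X n s"] QT[OF sT] by (simp add: dist_norm)
        also have "\<dots> \<le> L * (2 * Q T * (L * s) ^ n / fact n)"
          by (intro mult_left_mono Suc.IH sT L0)
        finally show "norm (F (X (Suc n) s) - F (X n s)) \<le> L * (2 * Q T * (L * s) ^ n / fact n)" .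
      qed (use hi in \<open>auto intro!: integrable_continuous_real continuous_intros c\<close>)
      also have "\<dots> = 2 * Q T * (L * t) ^ Suc n / fact (Suc n)"
        using integral_unique[OF hi] by simp
      finally show ?case .
    qed
    have "uniform_limit {0..T} (\<lambda>n t. \<Sum>i<n. X (Suc i) t - X i t) (\<lambda>t. \<Sum>i. X (Suc i) t - X i t) sequentially"
    proof (rule Weierstrass_m_test)
      show "norm (X (Suc n) t - X n t) \<le> 2 * Q T * (inverse (fact n) * (L * T) ^ n)" if "t \<in> {0..T}" for n t
      proof -
        have Q0: "Q T \<ge> 0" by (simp add: Q_def add_nonneg_nonneg)
        have "norm (X (Suc n) t - X n t) \<le> 2 * Q T * (L * t) ^ n / fact n" by (rule d[OF that])
        also have "\<dots> \<le> 2 * Q T * (L * T) ^ n / fact n"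
          using that L0 Q0 by (intro divide_right_mono mult_left_mono power_mono) auto
        finally show ?thesis by (simp add: field_simps)
      qed
      show "summable (\<lambda>n. 2 * Q T * (inverse (fact n) * (L * T) ^ n))"
        by (intro summable_mult summable_exp)
    qed
    then have "uniform_limit {0..T} (\<lambda>n t. z0 + (\<Sum>i<n. X (Suc i) t - X i t)) (\<lambda>t. z0 + (\<Sum>i. X (Suc i) t - X i t)) sequentially"
      by (intro uniform_limit_intros)
    moreover have "(\<Sum>i<n. X (Suc i) t - X i t) = X n t - z0" for n t
      by (subst sum_lessThan_telescope) (simp add: X0)
    ultimately have u: "uniform_limit {0..T} X (\<lambda>t. z0 + (\<Sum>i. X (Suc i) t - X i t)) sequentially"
      by simp
    have Y: "Y t = z0 + (\<Sum>i. X (Suc i) t - X i t)" if "t \<in> {0..T}" for t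
      unfolding Y_def using tendsto_uniform_limitI[OF u that] by (rule limI)
    have uY: "uniform_limit {0..T} X Y sequentially"
      by (rule uniform_limit_cong'[THEN iffD2, OF _ _ u]) (use Y in auto)
    have YQ: "norm (Y t) \<le> Q T" if "t \<in> {0..T}" for t
      by (rule Lim_norm_ubound[OF _ tendsto_uniform_limitI[OF uY that]]) (use QT[OF that] in auto)
    have "uniform_limit {0..T} (\<lambda>n t. F (X n t)) (\<lambda>t. F (Y t)) sequentially"
    proof (rule uniform_limitI)
      fix e :: real assume "e > 0"
      \<comment> \<open>The denominator is \<open>L + 1\<close> because \<open>L\<close> may be
        0.\<close>
      then have "e / (L + 1) > 0" using L0 by simp
      then have "\<forall>\<^sub>F n in sequentially. \<forall>t\<in>{0..T}. dist (X n t) (Y t) < e / (L + 1)"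
        by (rule uniform_limitD[OF uY])
      then show "\<forall>\<^sub>F n in sequentially. \<forall>t\<in>{0..T}. dist (F (X n t)) (F (Y t)) < e"
      proof eventually_elim
        case (elim n)
        show ?case
        proof
          fix t assume t: "t \<in> {0..T}"
          have "dist (F (X n t)) (F (Y t)) \<le> L * dist (X n t) (Y t)"
            using lipschitz_onD[OF L, of "X n t" "Y t"] QT[OF t] YQ[OF t] by simp
          also have "\<dots> \<le> (L + 1) * dist (X n t) (Y t)" by (intro mult_right_mono) auto
          also have "\<dots> < e" using elim t L0 by (simp add: field_simps)
          finally show "dist (F (X n t)) (F (Y t)) < e" .
        qed
      qed
    qed
    with uY show ?thesis by blast
  qed
  have Yc: "continuous_on {0..T} Y" for T
  proof (cases "T \<ge> 0")
    case True
    show ?thesis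
      by (rule uniform_limit_theorem[OF _ unif[OF True, THEN conjunct1]]) (simp_all add: Xc)
  qed simp
  have FYc: "continuous_on {0..T} (\<lambda>s. F (Y s))" for T
    by (rule continuous_on_compose2[OF Fc Yc]) auto
  have Yint: "Y t = z0 + integral {0..t} (\<lambda>s. F (Y s))" if t: "t \<ge> 0" for t
  proof -
    obtain I J where IJ: "\<And>n. ((\<lambda>s. F (X n s)) has_integral I n) {0..t}"
      "((\<lambda>s. F (Y s)) has_integral J) {0..t}" "I \<longlonglongrightarrow> J"
      using uniform_limit_integral[OF unif[OF t, THEN conjunct2] FXc trivial_limit_sequentially] by blast
    have "X (Suc n) t = z0 + I n" for n using IJ(1) by (simp add: XS integral_unique)
    moreover have "(\<lambda>n. z0 + I n) \<longlonglongrightarrow> z0 + J" by (intro tendsto_intros IJ)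
    ultimately have "(\<lambda>n. X (Suc n) t) \<longlonglongrightarrow> z0 + J" by simp
    moreover have "(\<lambda>n. X n t) \<longlonglongrightarrow> Y t"
      by (rule tendsto_uniform_limitI[OF unif[OF t, THEN conjunct1]]) (use t in simp)
    then have "(\<lambda>n. X (Suc n) t) \<longlonglongrightarrow> Y t" by (rule LIMSEQ_Suc)
    ultimately have "Y t = z0 + J" by (rule LIMSEQ_unique[symmetric])
    then show ?thesis using IJ(2) by (simp add: integral_unique)
  qed
  show ?thesis
  proof (rule that[of Y])
    show "Y 0 = z0" using Yint[of 0] by simp
    fix t :: real assume t: "t \<ge> 0"
    have "((\<lambda>u. integral {0..u} (\<lambda>s. F (Y s))) has_vector_derivative F (Y t)) (at t within {0..t + 1})"
      by (rule integral_has_vector_derivative[OF FYc]) (use t in auto)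
    then have "((\<lambda>u. z0 + integral {0..u} (\<lambda>s. F (Y s))) has_vector_derivative F (Y t)) (at t within {0..t + 1})"
      by (auto intro!: derivative_eq_intros)
    then have "(Y has_vector_derivative F (Y t)) (at t within {0..t + 1})"
      by (rule has_vector_derivative_transform[rotated 2]) (use t Yint in auto)
    moreover have "at t within {0..t + 1} = at t within {0..}"
      by (rule at_within_nhd[where S = "ball t 1"]) (use t in \<open>auto simp: dist_real_def\<close>)
    ultimately show "(Y has_vector_derivative F (Y t)) (at t within {0..})" by simp
  qed
qed

lemma mvt_half_line:
  fixes f :: "real \<Rightarrow> real"
  assumes "\<And>x. x \<ge> 0 \<Longrightarrow> (f has_real_derivative f' x) (at x within {0..})" "0 \<le> s" "s < t"
  obtains \<xi> where "s < \<xi>" "\<xi> < t" "f t - f s = f' \<xi> * (t - s)"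
proof -
  have "\<exists>\<xi>\<in>{s<..<t}. f t - f s = f' \<xi> * (t - s)"
  proof (rule mvt_simple)
    fix x assume "s \<le> x" "x \<le> t"
    then have "(f has_real_derivative f' x) (at x within {s..t})"
      using assms by (intro DERIV_subset[OF assms(1)]) auto
    then show "(f has_derivative (*) (f' x)) (at x within {s..t})"
      by (simp add: has_field_derivative_def)
  qed (rule assms)
  with that show ?thesis by auto
qed

text \<open>The derivative is bounded only from \<open>T\<close> on, so that a speed that is small
  at late times can be inserted.\<close>

lemma lipschitz_half_line:
  fixes f :: "real \<Rightarrow> 'b::real_normed_vector"
  assumes "\<And>x. x \<ge> 0 \<Longrightarrow> (f has_vector_derivative f' x) (at x within {0..})" "0 \<le> T"
    and "\<And>x. x \<ge> T \<Longrightarrow> norm (f' x) \<le> B" "s \<ge> T" "t \<ge> T"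
  shows "norm (f s - f t) \<le> B * \<bar>s - t\<bar>"
proof -
  have "norm (f s - f t) \<le> B * norm (s - t)"
  proof (rule differentiable_bound[of "{T..}"])
    fix x assume "x \<in> {T..}"
    then show "(f has_derivative (\<lambda>h. h *\<^sub>R f' x)) (at x within {T..})"
      using has_vector_derivative_within_subset[OF assms(1), of x "{T..}"] assms(2)
      by (auto simp: has_vector_derivative_def)
    show "onorm (\<lambda>h. h *\<^sub>R f' x) \<le> B"
      using assms(3)[of x] \<open>x \<in> {T..}\<close> onorm_scaleR_left[OF bounded_linear_ident, of "f' x"] onorm_id[where 'a = real]
      by (simp add: id_def)
  qed (use assms in auto)
  then show ?thesis by simp
qed

section \<open>Trajectories of the two-particle system\<close>

context mean_field begin

text \<open>This is \<open>drift (two_atoms z) z\<close>: an atom exerts no force on itself, and the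
  other atom carries mass one half.\<close>

definition field :: "'a \<times> 'a \<Rightarrow> 'a \<times> 'a" where
  "field z = (snd z, - ((1/2) *\<^sub>R kernel z (- z)))"

lemma field_eq: "field (r, v) = (v, - (\<psi> (norm (2 *\<^sub>R r)) *\<^sub>R v + (1/2) *\<^sub>R grad V (2 *\<^sub>R r)))"
proof -
  have "grad V (- r - r) = - grad V (2 *\<^sub>R r)" using grad_minus[of "2 *\<^sub>R r"] by (simp add: scaleR_2)
  moreover have "(1/2) *\<^sub>R (p *\<^sub>R (v - - v)) = p *\<^sub>R v" for p
    by (simp add: scaleR_add_right flip: scaleR_add_left)
  moreover have "r - - r = 2 *\<^sub>R r" by (simp add: scaleR_2)
  ultimately show ?thesis by (simp add: field_def kernel_def scaleR_diff_right scaleR_add_right[of "1/2"])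
qed

definition is_trajectory :: "(real \<Rightarrow> 'a \<times> 'a) \<Rightarrow> bool" where
  "is_trajectory z \<longleftrightarrow> (\<forall>t\<ge>0. (z has_vector_derivative field (z t)) (at t within {0..}))"

lemma trajectory_exists: obtains z where "z 0 = z0" "is_trajectory z"
proof -
  obtain C where C: "C \<ge> 0" "\<And>z z'. norm (kernel z z') \<le> C * (1 + norm z + norm z')"
    using kernel_growth by blast
  have "norm (field z) \<le> (1 + C) * (1 + norm z)" for z
  proof -
    have "norm (field z) \<le> norm (snd z) + norm ((1/2) *\<^sub>R kernel z (- z))"
      unfolding field_def by (rule order_trans[OF norm_Pair_le]) simp
    also have "\<dots> \<le> norm z + (1/2) * (C * (1 + norm z + norm z))"
      using C(2)[of z "- z"] norm_fst_snd_le(2)[of z] by (intro add_mono) auto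
    also have "\<dots> \<le> (1 + C) * (1 + norm z)" using C(1) by (simp add: algebra_simps)
    finally show ?thesis .
  qed
  moreover have "\<exists>L. L-lipschitz_on (cball 0 R) field" for R
  proof -
    obtain L where L: "L \<ge> 0"
      "\<And>z z' w w'. norm z \<le> R \<Longrightarrow> norm z' \<le> R \<Longrightarrow> norm w \<le> R \<Longrightarrow> norm w' \<le> R \<Longrightarrow>
        norm (kernel z z' - kernel w w') \<le> L * (norm (z - w) + norm (z' - w'))"
      using kernel_lipschitz by blast
    have "(1 + L)-lipschitz_on (cball 0 R) field"
    proof (rule lipschitz_onI)
      fix z w :: "'a \<times> 'a" assume R: "z \<in> cball 0 R" "w \<in> cball 0 R"
      have "field z - field w = (snd (z - w), - ((1/2) *\<^sub>R (kernel z (- z) - kernel w (- w))))"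
        by (simp add: field_def scaleR_diff_right)
      also have "norm \<dots> \<le> norm (snd (z - w)) + (1/2) * norm (kernel z (- z) - kernel w (- w))"
        by (rule order_trans[OF norm_Pair_le]) simp
      also have "\<dots> \<le> norm (z - w) + (1/2) * (L * (norm (z - w) + norm (- z - - w)))"
        using R by (intro add_mono norm_fst_snd_le mult_left_mono L(2)) auto
      also have "\<dots> = (1 + L) * norm (z - w)"
        by (simp add: algebra_simps norm_minus_commute)
      finally show "dist (field z) (field w) \<le> (1 + L) * dist z w" by (simp add: dist_norm)
    qed (use L in simp)
    then show ?thesis by blast
  qed
  ultimately show ?thesis
    using ode_solution_exists[of field "1 + C" z0] C(1) that unfolding is_trajectory_def by (metis add_pos_nonneg zero_less_one)
qed


section \<open>Energy dissipation and escape to infinity\<close>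

lemma V_0_greatest: "x \<noteq> 0 \<Longrightarrow> V x < V 0"
proof -
  assume x: "x \<noteq> 0"
  \<comment> \<open>Along the ray through \<open>x\<close> this derivative is negative for
    \<open>s > 0\<close>, by repulsion at the point \<open>s *\<^sub>R x\<close>; the mean value
    theorem makes it a strict inequality between the endpoints.\<close>
  have d: "((\<lambda>s. V (s *\<^sub>R x)) has_real_derivative grad V (s *\<^sub>R x) \<bullet> x) (at s)" for s :: real
  proof -
    have "((\<lambda>s. V (s *\<^sub>R x)) has_derivative (\<lambda>h. grad V (s *\<^sub>R x) \<bullet> (h *\<^sub>R x))) (at s)"
      by (rule has_derivative_compose[OF _ V_derivative]) (auto intro!: derivative_eq_intros)
    moreover have "(\<lambda>h. grad V (s *\<^sub>R x) \<bullet> (h *\<^sub>R x)) = (*) (grad V (s *\<^sub>R x) \<bullet> x)"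
      by (simp add: fun_eq_iff)
    ultimately show ?thesis by (simp add: has_field_derivative_def)
  qed
  obtain s where s: "0 < s" "s < 1" "V (1 *\<^sub>R x) - V (0 *\<^sub>R x) = (1 - 0) * (grad V (s *\<^sub>R x) \<bullet> x)"
    using MVT2[of 0 1 "\<lambda>s. V (s *\<^sub>R x)" "\<lambda>s. grad V (s *\<^sub>R x) \<bullet> x"] d by auto
  have "grad V (s *\<^sub>R x) \<bullet> (s *\<^sub>R x) < 0" using repulsive[of "s *\<^sub>R x"] x s by simp
  then have "grad V (s *\<^sub>R x) \<bullet> x < 0" using s by (simp add: mult_less_0_iff)
  then show ?thesis using s(3) by simp
qed

text \<open>The first component is the position of one of two particles at \<open>r\<close> and \<open>- r\<close>, so that
  the forces depend on the relative position \<open>2 r\<close>.\<close>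

definition energy :: "'a \<times> 'a \<Rightarrow> real" where
  "energy z = (1/2) * (snd z \<bullet> snd z) + (1/4) * V (2 *\<^sub>R fst z)"

lemma trajectory_components:
  assumes "is_trajectory z" "t \<ge> 0"
  shows "((\<lambda>t. fst (z t)) has_vector_derivative snd (z t)) (at t within {0..})"
    "((\<lambda>t. snd (z t)) has_vector_derivative
      - (\<psi> (norm (2 *\<^sub>R fst (z t))) *\<^sub>R snd (z t) + (1/2) *\<^sub>R grad V (2 *\<^sub>R fst (z t)))) (at t within {0..})"
proof -
  have z: "(z has_vector_derivative field (z t)) (at t within {0..})"
    using assms by (simp add: is_trajectory_def)
  have "((\<lambda>t. fst (z t)) has_vector_derivative fst (field (z t))) (at t within {0..})"
    "((\<lambda>t. snd (z t)) has_vector_derivative snd (field (z t))) (at t within {0..})"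
    using bounded_linear.has_vector_derivative[OF bounded_linear_fst z]
      bounded_linear.has_vector_derivative[OF bounded_linear_snd z] by simp_all
  then show "((\<lambda>t. fst (z t)) has_vector_derivative snd (z t)) (at t within {0..})"
    "((\<lambda>t. snd (z t)) has_vector_derivative
      - (\<psi> (norm (2 *\<^sub>R fst (z t))) *\<^sub>R snd (z t) + (1/2) *\<^sub>R grad V (2 *\<^sub>R fst (z t)))) (at t within {0..})"
    using field_eq[of "fst (z t)" "snd (z t)"] by simp_all
qed

text \<open>The force contributes \<open>- (1/2) *\<^sub>R grad V\<close> to the acceleration, and
  the factor 1/4 of the potential times the inner factor 2 is again 1/2. The two contributions
  cancel, and only the friction remains.\<close>

lemma energy_derivative:
  assumes "is_trajectory z" "t \<ge> 0"
  shows "((\<lambda>t. energy (z t)) has_real_derivative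
    - (\<psi> (norm (2 *\<^sub>R fst (z t))) * (snd (z t) \<bullet> snd (z t)))) (at t within {0..})"
proof -
  note d = trajectory_components[OF assms, unfolded has_vector_derivative_def]
  have "((\<lambda>t. V (2 *\<^sub>R fst (z t))) has_derivative (\<lambda>h. grad V (2 *\<^sub>R fst (z t)) \<bullet> (2 *\<^sub>R (h *\<^sub>R snd (z t))))) (at t within {0..})"
    by (rule has_derivative_compose[OF _ V_derivative]) (intro derivative_intros d)
  then have "((\<lambda>t. energy (z t)) has_derivative (\<lambda>h. (1/2) *
      (snd (z t) \<bullet> (h *\<^sub>R - (\<psi> (norm (2 *\<^sub>R fst (z t))) *\<^sub>R snd (z t) + (1/2) *\<^sub>R grad V (2 *\<^sub>R fst (z t))))
       + (h *\<^sub>R - (\<psi> (norm (2 *\<^sub>R fst (z t))) *\<^sub>R snd (z t) + (1/2) *\<^sub>R grad V (2 *\<^sub>R fst (z t)))) \<bullet> snd (z t))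
     + (1/4) * (grad V (2 *\<^sub>R fst (z t)) \<bullet> (2 *\<^sub>R (h *\<^sub>R snd (z t)))))) (at t within {0..})"
    unfolding energy_def by (intro derivative_intros d)
  then show ?thesis
    unfolding has_field_derivative_def
    by (rule has_derivative_eq_rhs) (auto simp: fun_eq_iff inner_commute inner_add_right inner_diff_right algebra_simps)
qed

lemma energy_antimono:
  assumes z: "is_trajectory z" and st: "0 \<le> s" "s \<le> t"
  shows "energy (z t) \<le> energy (z s)"
proof (cases "s = t")
  case False
  then have "s < t" using st by simp
  then obtain \<xi> where \<xi>: "s < \<xi>" "energy (z t) - energy (z s)
      = - (\<psi> (norm (2 *\<^sub>R fst (z \<xi>))) * (snd (z \<xi>) \<bullet> snd (z \<xi>))) * (t - s)"
    using mvt_half_line[OF energy_derivative[OF z] st(1)] by blast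
  moreover have "\<psi> (norm (2 *\<^sub>R fst (z \<xi>))) \<ge> 0" using \<psi>_low(2)[of "norm (2 *\<^sub>R fst (z \<xi>))"] \<psi>_low(1) by simp
  ultimately have "energy (z t) - energy (z s) \<le> 0" using \<open>s < t\<close>
    by (simp only:) (intro mult_nonpos_nonneg; simp)
  then show ?thesis by simp
qed simp

lemma trajectory_V_le:
  assumes z: "is_trajectory z" "z 0 = (a, 0)" "t \<ge> 0"
  shows "V (2 *\<^sub>R fst (z t)) \<le> V (2 *\<^sub>R a)"
proof -
  have "(1/4) * V (2 *\<^sub>R fst (z t)) \<le> energy (z t)" by (simp add: energy_def)
  also have "\<dots> \<le> energy (z 0)" using energy_antimono[OF z(1) _ z(3)] by simp
  also have "\<dots> = (1/4) * V (2 *\<^sub>R a)" using z(2) by (simp add: energy_def)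
  finally show ?thesis by simp
qed

text \<open>At the origin the strict maximum of \<open>V\<close> would have to be at most
  \<open>V (2 *\<^sub>R a)\<close>. This keeps the two atoms distinct at all times, which the
  uniqueness argument relies on.\<close>

lemma trajectory_nonzero:
  assumes z: "is_trajectory z" "z 0 = (a, 0)" "t \<ge> 0" and a: "a \<noteq> 0"
  shows "z t \<noteq> 0"
proof
  assume "z t = 0"
  then show False using trajectory_V_le[OF z] V_0_greatest[of "2 *\<^sub>R a"] a by simp
qed

lemma speed_bounded:
  assumes "is_trajectory z"
  obtains S where "\<And>t. t \<ge> 0 \<Longrightarrow> norm (snd (z t)) \<le> S"
proof -
  obtain m where m: "\<And>x. m \<le> V x" using V_bdd_below by (auto simp: bdd_below_def)
  have "norm (snd (z t)) \<le> sqrt (2 * energy (z 0) - m / 2)" if "t \<ge> 0" for t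
  proof (rule real_le_rsqrt)
    have "(norm (snd (z t)))\<^sup>2 = 2 * energy (z t) - (1/2) * V (2 *\<^sub>R fst (z t))"
      by (simp add: energy_def power2_norm_eq_inner)
    then show "(norm (snd (z t)))\<^sup>2 \<le> 2 * energy (z 0) - m / 2"
      using energy_antimono[OF assms _ that] m[of "2 *\<^sub>R fst (z t)"] by simp
  qed
  then show ?thesis by (rule that)
qed

lemma acceleration_bounded:
  assumes "is_trajectory z"
  obtains C where "C \<ge> 0" "\<And>t. t \<ge> 0 \<Longrightarrow>
    norm (- (\<psi> (norm (2 *\<^sub>R fst (z t))) *\<^sub>R snd (z t) + (1/2) *\<^sub>R grad V (2 *\<^sub>R fst (z t)))) \<le> C"
proof -
  obtain S where S: "\<And>t. t \<ge> 0 \<Longrightarrow> norm (snd (z t)) \<le> S" using speed_bounded[OF assms] by blast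
  obtain B G where B: "\<And>s. s \<ge> 0 \<Longrightarrow> norm (\<psi> s) \<le> B" and G: "\<And>x. norm (grad V x) \<le> G"
    using \<psi>_bounded grad_bounded unfolding bounded_iff by auto
  have BG: "B \<ge> 0" "G \<ge> 0" using order_trans[OF norm_ge_zero B[of 0]] order_trans[OF norm_ge_zero G] by auto
  have "S \<ge> 0" using order_trans[OF norm_ge_zero S[of 0]] by simp
  show ?thesis
  proof (rule that[of "B * S + (1/2) * G"])
    fix t :: real assume t: "t \<ge> 0"
    have "norm (- (\<psi> (norm (2 *\<^sub>R fst (z t))) *\<^sub>R snd (z t) + (1/2) *\<^sub>R grad V (2 *\<^sub>R fst (z t))))
        \<le> \<bar>\<psi> (norm (2 *\<^sub>R fst (z t)))\<bar> * norm (snd (z t)) + (1/2) * norm (grad V (2 *\<^sub>R fst (z t)))"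
      unfolding norm_minus_cancel by (rule order_trans[OF norm_triangle_ineq]) simp
    also have "\<dots> \<le> B * S + (1/2) * G"
      using B[of "norm (2 *\<^sub>R fst (z t))"] BG by (intro add_mono mult_mono S[OF t] G) auto
    finally show "norm (- (\<psi> (norm (2 *\<^sub>R fst (z t))) *\<^sub>R snd (z t) + (1/2) *\<^sub>R grad V (2 *\<^sub>R fst (z t)))) \<le> B * S + (1/2) * G" .
  qed (use BG \<open>S \<ge> 0\<close> in simp)
qed

text \<open>A speed of at least \<open>e\<close> at a late time persists at level
  \<open>e / 2\<close> for a fixed time \<open>\<tau>\<close>, since the acceleration is bounded.
  Friction would then take at least \<open>\<delta>\<close> from the energy, although after
  \<open>T\<close> the energy lies within \<open>\<delta>\<close> of its infimum.\<close>

lemma speed_tendsto_0: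
  assumes z: "is_trajectory z" and e: "e > 0"
  obtains T where "T \<ge> 0" "\<And>t. t \<ge> T \<Longrightarrow> norm (snd (z t)) < e"
proof -
  obtain C where C: "C \<ge> 0" "\<And>t. t \<ge> 0 \<Longrightarrow>
    norm (- (\<psi> (norm (2 *\<^sub>R fst (z t))) *\<^sub>R snd (z t) + (1/2) *\<^sub>R grad V (2 *\<^sub>R fst (z t)))) \<le> C"
    using acceleration_bounded[OF z] by blast
  \<comment> \<open>During \<open>\<tau>\<close> the velocity changes by at most
    \<open>C * \<tau> \<le> e / 2\<close>; adding 1 to \<open>C\<close> avoids a division by
    0.\<close>
  define \<tau> where "\<tau> = e / (2 * (C + 1))"
  have \<tau>: "\<tau> > 0" "C * \<tau> \<le> e / 2" using e C(1) by (auto simp: \<tau>_def field_simps)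
  define \<delta> where "\<delta> = \<psi>_low * (e / 2)\<^sup>2 * \<tau>"
  have \<delta>: "\<delta> > 0" using \<psi>_low(1) e \<tau> by (simp add: \<delta>_def)
  obtain m where m: "\<And>x. m \<le> V x" using V_bdd_below by (auto simp: bdd_below_def)
  have "m / 4 \<le> energy (z t)" for t
    using m[of "2 *\<^sub>R fst (z t)"] by (simp add: energy_def add_increasing)
  then have bdd: "bdd_below ((\<lambda>t. energy (z t)) ` {0..})" by (intro bdd_belowI2)
  define E where "E = Inf ((\<lambda>t. energy (z t)) ` {0..})"
  obtain T where T: "T \<ge> 0" "energy (z T) < E + \<delta>"
    using cInf_lessD[of "(\<lambda>t. energy (z t)) ` {0..}" "E + \<delta>"] \<delta> by (auto simp: E_def)
  have "norm (snd (z t)) < e" if t: "t \<ge> T" for t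
  proof (rule ccontr)
    assume "\<not> norm (snd (z t)) < e"
    then have v: "norm (snd (z t)) \<ge> e" by simp
    have t0: "0 \<le> t" using t T by simp
    obtain \<xi> where \<xi>: "t < \<xi>" "\<xi> < t + \<tau>" "energy (z (t + \<tau>)) - energy (z t)
        = - (\<psi> (norm (2 *\<^sub>R fst (z \<xi>))) * (snd (z \<xi>) \<bullet> snd (z \<xi>))) * (t + \<tau> - t)"
      using mvt_half_line[OF energy_derivative[OF z] t0, of "t + \<tau>"] \<tau>(1) by auto
    have "norm (snd (z t) - snd (z \<xi>)) \<le> C * \<bar>t - \<xi>\<bar>"
      by (rule lipschitz_half_line[OF trajectory_components(2)[OF z] order_refl C(2)]) (use t0 \<xi> in auto)
    also have "\<dots> \<le> C * \<tau>" using \<xi> C(1) by (intro mult_left_mono) auto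
    finally have "norm (snd (z \<xi>)) \<ge> e / 2"
      using \<tau>(2) v norm_triangle_ineq2[of "snd (z t)" "snd (z \<xi>)"] by simp
    then have "(e / 2)\<^sup>2 \<le> snd (z \<xi>) \<bullet> snd (z \<xi>)"
      using e by (subst power2_norm_eq_inner[symmetric]) (intro power_mono; simp)
    then have "\<psi>_low * (e / 2)\<^sup>2 \<le> \<psi> (norm (2 *\<^sub>R fst (z \<xi>))) * (snd (z \<xi>) \<bullet> snd (z \<xi>))"
      using \<psi>_low(2)[of "norm (2 *\<^sub>R fst (z \<xi>))"] \<psi>_low(1) by (intro mult_mono) auto
    then have "\<delta> \<le> \<psi> (norm (2 *\<^sub>R fst (z \<xi>))) * (snd (z \<xi>) \<bullet> snd (z \<xi>)) * \<tau>"
      unfolding \<delta>_def using \<tau>(1) by (intro mult_right_mono) auto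
    then have "energy (z (t + \<tau>)) \<le> energy (z t) - \<delta>" using \<xi>(3) by simp
    also have "\<dots> \<le> energy (z T) - \<delta>" using energy_antimono[OF z T(1) t] by simp
    also have "\<dots> < E" using T(2) by simp
    also have "E \<le> energy (z (t + \<tau>))"
      unfolding E_def using t0 \<tau>(1) by (intro cInf_lower bdd) auto
    finally show False by simp
  qed
  with T(1) show ?thesis by (rule that)
qed

text \<open>Since the speed tends to zero, near a finite limit point of the position the particle would
  feel an almost constant nonzero force for a unit of time.\<close>

lemma trajectory_unbounded:
  assumes z: "is_trajectory z" "z 0 = (a, 0)" and a: "a \<noteq> 0"
    and t: "\<And>n::nat. t n \<ge> 0" "filterlim t at_top sequentially"
    and bdd: "\<And>n. norm (z (t n)) \<le> R"
  shows False
proof -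
  have "fst (z (t n)) \<in> cball 0 R" for n
    using bdd[of n] norm_fst_snd_le(1)[of "z (t n)"] by simp
  then obtain r \<sigma> where "strict_mono (\<sigma> :: nat \<Rightarrow> nat)" "((\<lambda>n. fst (z (t n))) \<circ> \<sigma>) \<longlonglongrightarrow> r"
    using compact_cball[of "0::'a" R, unfolded compact_eq_seq_compact_metric seq_compact_def, rule_format,
        of "\<lambda>n. fst (z (t n))"] by blast
  then have \<sigma>: "strict_mono \<sigma>" "(\<lambda>n. fst (z (t (\<sigma> n)))) \<longlonglongrightarrow> r" by (simp_all add: o_def)
  define u where "u n = t (\<sigma> n)" for n
  have u: "u n \<ge> 0" "filterlim u at_top sequentially" "(\<lambda>n. fst (z (u n))) \<longlonglongrightarrow> r" for n
    using t \<sigma> filterlim_compose[OF t(2) filterlim_subseq[OF \<sigma>(1)]] by (auto simp: u_def[abs_def])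
  define G where "G = grad V (2 *\<^sub>R r)"
  have Vc: "continuous_on UNIV V"
    by (rule continuous_at_imp_continuous_on) (use has_derivative_continuous[OF V_derivative] in blast)
  have "(\<lambda>n. V (2 *\<^sub>R fst (z (u n)))) \<longlonglongrightarrow> V (2 *\<^sub>R r)"
    by (rule continuous_on_tendsto_compose[OF Vc]) (auto intro!: tendsto_intros u)
  \<comment> \<open>The energy bound passes to the limit and excludes \<open>r = 0\<close>, the
    point where the force vanishes.\<close>
  then have "V (2 *\<^sub>R r) \<le> V (2 *\<^sub>R a)"
    using trajectory_V_le[OF z u(1)] by (intro LIMSEQ_le_const2) auto
  then have "r \<noteq> 0" using V_0_greatest[of "2 *\<^sub>R a"] a by auto
  then have G: "G \<noteq> 0" using repulsive[of "2 *\<^sub>R r"] by (auto simp: G_def)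
  define acc where "acc s = - (\<psi> (norm (2 *\<^sub>R fst (z s))) *\<^sub>R snd (z s) + (1/2) *\<^sub>R grad V (2 *\<^sub>R fst (z s)))" for s
  \<comment> \<open>The mean value theorem is applied to the real component of the velocity along
    \<open>G\<close>: at some time within the unit interval after \<open>u n\<close> the
    acceleration along \<open>G\<close> equals the increment over that interval.\<close>
  have "\<exists>\<xi>. u n < \<xi> \<and> \<xi> < u n + 1 \<and> snd (z (u n + 1)) \<bullet> G - snd (z (u n)) \<bullet> G = acc \<xi> \<bullet> G" for n
  proof -
    have "((\<lambda>s. snd (z s) \<bullet> G) has_real_derivative acc x \<bullet> G) (at x within {0..})" if "x \<ge> 0" for x
      using bounded_linear.has_vector_derivative[OF bounded_linear_inner_left trajectory_components(2)[OF z(1) that], of G]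
      unfolding has_real_derivative_iff_has_vector_derivative acc_def by simp
    from mvt_half_line[OF this u(1), of n "u n + 1"] show ?thesis by (metis add_diff_cancel_left' less_add_one mult.right_neutral)
  qed
  then obtain \<xi> where \<xi>: "\<And>n. u n < \<xi> n" "\<And>n. \<xi> n < u n + 1"
    "\<And>n. snd (z (u n + 1)) \<bullet> G - snd (z (u n)) \<bullet> G = acc (\<xi> n) \<bullet> G" by metis
  have ev: "\<forall>\<^sub>F n in sequentially. \<forall>s\<ge>u n. norm (snd (z s)) < e" if e: "e > 0" for e
  proof -
    obtain T where "\<And>s. s \<ge> T \<Longrightarrow> norm (snd (z s)) < e" using speed_tendsto_0[OF z(1) e] by blast
    then show ?thesis
      using filterlim_at_top_dense[THEN iffD1, OF u(2), rule_format, of T] by (auto elim!: eventually_mono)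
  qed
  have v0: "(\<lambda>n. snd (z (w n))) \<longlonglongrightarrow> 0" if "\<And>n. w n \<ge> u n" for w
    unfolding tendsto_iff dist_norm diff_0_right
  proof (intro allI impI)
    fix e :: real assume "e > 0"
    then show "\<forall>\<^sub>F n in sequentially. norm (snd (z (w n))) < e"
      using that by (intro eventually_mono[OF ev]) auto
  qed
  \<comment> \<open>During at most one unit of time at vanishing speed the position does not move in
    the limit, so the force at \<open>\<xi> n\<close> also tends to \<open>G\<close>.\<close>
  have "(\<lambda>n. fst (z (\<xi> n)) - fst (z (u n))) \<longlonglongrightarrow> 0"
    unfolding tendsto_iff
  proof (intro allI impI)
    fix e :: real assume "e > 0"
    then have "\<forall>\<^sub>F n in sequentially. \<forall>s\<ge>u n. norm (snd (z s)) < e / 2" by (intro ev) simp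
    then show "\<forall>\<^sub>F n in sequentially. dist (fst (z (\<xi> n)) - fst (z (u n))) 0 < e"
    proof eventually_elim
      case (elim n)
      have "norm (fst (z (\<xi> n)) - fst (z (u n))) \<le> e / 2 * \<bar>\<xi> n - u n\<bar>"
        by (rule lipschitz_half_line[OF trajectory_components(1)[OF z(1)] u(1)[of n]])
          (use elim \<xi>(1)[of n] in \<open>auto intro: less_imp_le\<close>)
      also have "\<dots> \<le> e / 2 * 1" using \<xi>(1,2)[of n] \<open>e > 0\<close> by (intro mult_left_mono) auto
      also have "\<dots> < e" using \<open>e > 0\<close> by simp
      finally show ?case by simp
    qed
  qed
  then have r: "(\<lambda>n. fst (z (\<xi> n))) \<longlonglongrightarrow> r"
    using tendsto_add[OF u(3)] by fastforce
  obtain B where B: "\<And>s. s \<ge> 0 \<Longrightarrow> norm (\<psi> s) \<le> B"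
    using \<psi>_bounded unfolding bounded_iff by auto
  have "(\<lambda>n. \<psi> (norm (2 *\<^sub>R fst (z (\<xi> n)))) *\<^sub>R snd (z (\<xi> n))) \<longlonglongrightarrow> 0"
  proof (rule Lim_null_comparison)
    show "\<forall>\<^sub>F n in sequentially. norm (\<psi> (norm (2 *\<^sub>R fst (z (\<xi> n)))) *\<^sub>R snd (z (\<xi> n))) \<le> B * norm (snd (z (\<xi> n)))"
      using B by (intro always_eventually allI) (simp add: mult_right_mono)
    show "(\<lambda>n. B * norm (snd (z (\<xi> n)))) \<longlonglongrightarrow> 0"
      using tendsto_mult[OF tendsto_const[of B] tendsto_norm[OF v0[of \<xi>]]] \<xi>(1) by (auto intro: less_imp_le)
  qed
  moreover have "(\<lambda>n. grad V (2 *\<^sub>R fst (z (\<xi> n)))) \<longlonglongrightarrow> G"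
    unfolding G_def by (rule continuous_on_tendsto_compose[OF continuous_on_grad[of UNIV]]) (auto intro!: tendsto_intros r)
  ultimately have "(\<lambda>n. acc (\<xi> n)) \<longlonglongrightarrow> - (0 + (1/2) *\<^sub>R G)"
    unfolding acc_def by (intro tendsto_intros)
  \<comment> \<open>The acceleration along \<open>G\<close> has two limits: minus half of
    \<open>G \<bullet> G\<close>, from the force, and 0, from the vanishing velocities at both ends
    of the interval.\<close>
  then have "(\<lambda>n. acc (\<xi> n) \<bullet> G) \<longlonglongrightarrow> - (0 + (1/2) *\<^sub>R G) \<bullet> G" by (intro tendsto_intros)
  moreover have "(\<lambda>n. acc (\<xi> n) \<bullet> G) \<longlonglongrightarrow> 0 \<bullet> G - 0 \<bullet> G"
    unfolding \<xi>(3)[symmetric] by (intro tendsto_intros v0) auto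
  ultimately have "- (0 + (1/2) *\<^sub>R G) \<bullet> G = 0 \<bullet> G - 0 \<bullet> G" by (rule LIMSEQ_unique)
  then show False using G by simp
qed

end

section \<open>The two-particle solution\<close>

lemma product_in_couplings:
  fixes \<mu> \<nu> :: "'a::second_countable_topology measure"
  assumes "\<mu> \<in> borel_prob" "\<nu> \<in> borel_prob"
  shows "\<mu> \<Otimes>\<^sub>M \<nu> \<in> couplings \<mu> \<nu>"
proof -
  interpret \<mu>: prob_space \<mu> using assms(1) by (rule borel_probD)
  interpret \<nu>: prob_space \<nu> using assms(2) by (rule borel_probD)
  have s: "sets \<mu> = sets borel" "sets \<nu> = sets borel" using assms by (simp_all add: borel_probD)
  have m: "fst \<in> measurable (\<mu> \<Otimes>\<^sub>M \<nu>) borel" "snd \<in> measurable (\<mu> \<Otimes>\<^sub>M \<nu>) borel"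
    using measurable_fst[of \<mu> \<nu>] measurable_snd[of \<mu> \<nu>]
    unfolding measurable_cong_sets[OF refl s(1)] measurable_cong_sets[OF refl s(2)] by simp_all
  have "sets (\<mu> \<Otimes>\<^sub>M \<nu>) = sets borel"
    using sets_pair_measure_cong[OF s] unfolding borel_prod .
  moreover have "distr (\<mu> \<Otimes>\<^sub>M \<nu>) borel fst = \<mu>"
  proof (rule measure_eqI)
    fix A assume "A \<in> sets (distr (\<mu> \<Otimes>\<^sub>M \<nu>) borel fst)"
    then have A: "A \<in> sets borel" by simp
    have "fst -` A \<inter> space (\<mu> \<Otimes>\<^sub>M \<nu>) = A \<times> space \<nu>"
      by (auto simp: space_pair_measure borel_probD(3)[OF assms(1)])
    moreover have "emeasure (\<mu> \<Otimes>\<^sub>M \<nu>) (A \<times> space \<nu>) = emeasure \<mu> A * emeasure \<nu> (space \<nu>)"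
      by (rule \<nu>.emeasure_pair_measure_Times) (use A s in auto)
    ultimately show "emeasure (distr (\<mu> \<Otimes>\<^sub>M \<nu>) borel fst) A = emeasure \<mu> A"
      by (simp only: emeasure_distr[OF m(1) A] \<nu>.emeasure_space_1 mult_1_right)
  qed (simp add: s)
  moreover have "distr (\<mu> \<Otimes>\<^sub>M \<nu>) borel snd = \<nu>"
  proof (rule measure_eqI)
    fix A assume "A \<in> sets (distr (\<mu> \<Otimes>\<^sub>M \<nu>) borel snd)"
    then have A: "A \<in> sets borel" by simp
    have "snd -` A \<inter> space (\<mu> \<Otimes>\<^sub>M \<nu>) = space \<mu> \<times> A"
      by (auto simp: space_pair_measure borel_probD(3)[OF assms(2)])
    moreover have "emeasure (\<mu> \<Otimes>\<^sub>M \<nu>) (space \<mu> \<times> A) = emeasure \<mu> (space \<mu>) * emeasure \<nu> A"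
      by (rule \<nu>.emeasure_pair_measure_Times) (use A s in auto)
    ultimately show "emeasure (distr (\<mu> \<Otimes>\<^sub>M \<nu>) borel snd) A = emeasure \<nu> A"
      by (simp only: emeasure_distr[OF m(2) A] \<mu>.emeasure_space_1 mult_1_left)
  qed (simp add: s)
  ultimately show ?thesis
    using prob_space_pair[OF \<mu>.prob_space_axioms \<nu>.prob_space_axioms]
    by (simp add: couplings_def borel_prob_def)
qed

lemma couplings_nn_integral:
  fixes h :: "'a::second_countable_topology \<Rightarrow> ennreal"
  assumes "\<pi> \<in> couplings \<mu> \<nu>" "h \<in> borel_measurable borel"
  shows "(\<integral>\<^sup>+ z. h (fst z) \<partial>\<pi>) = integral\<^sup>N \<mu> h" "(\<integral>\<^sup>+ z. h (snd z) \<partial>\<pi>) = integral\<^sup>N \<nu> h"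
proof -
  have s: "sets \<pi> = sets (borel \<Otimes>\<^sub>M borel)" and \<mu>: "\<mu> = distr \<pi> borel fst" and \<nu>: "\<nu> = distr \<pi> borel snd"
    using assms(1) unfolding couplings_def borel_prob_def borel_prod by blast+
  have m: "fst \<in> measurable \<pi> borel" "snd \<in> measurable \<pi> borel"
    unfolding measurable_cong_sets[OF s refl] by simp_all
  show "(\<integral>\<^sup>+ z. h (fst z) \<partial>\<pi>) = integral\<^sup>N \<mu> h" "(\<integral>\<^sup>+ z. h (snd z) \<partial>\<pi>) = integral\<^sup>N \<nu> h"
    unfolding \<mu> \<nu> using assms(2) m by (simp_all add: nn_integral_distr)
qed

text \<open>Since \<^const>\<open>W2\<close> involves \<^const>\<open>enn2real\<close>, finiteness of the infimum has to be shown
  before a small value of \<^const>\<open>W2\<close> carries information.\<close>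

lemma W2_less_1_second_moment:
  fixes \<mu> \<nu> :: "'a::euclidean_space measure"
  assumes \<mu>: "\<mu> \<in> P2" and \<nu>: "\<nu> \<in> P2" and W: "W2 \<mu> \<nu> < 1"
  shows "(\<integral>\<^sup>+ z. ennreal ((norm z)\<^sup>2) \<partial>\<mu>) \<le> 2 + 2 * (\<integral>\<^sup>+ z. ennreal ((norm z)\<^sup>2) \<partial>\<nu>)"
proof -
  let ?c = "\<lambda>\<pi>. \<integral>\<^sup>+ z. ennreal ((dist (fst z) (snd z))\<^sup>2) \<partial>\<pi>"
  let ?sq = "\<lambda>z :: 'a. ennreal ((norm z)\<^sup>2)"
  have [measurable]: "?sq \<in> borel_measurable borel" by measurable
  have meas: "(\<lambda>z. ?sq (fst z)) \<in> borel_measurable \<pi>" "(\<lambda>z. ?sq (snd z)) \<in> borel_measurable \<pi>"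
    "(\<lambda>z. ennreal ((dist (fst z) (snd z))\<^sup>2)) \<in> borel_measurable \<pi>"
    if "\<pi> \<in> couplings \<mu> \<nu>" for \<pi>
  proof -
    have s: "sets \<pi> = sets borel" using that unfolding couplings_def borel_prob_def by blast
    show "(\<lambda>z. ?sq (fst z)) \<in> borel_measurable \<pi>" "(\<lambda>z. ?sq (snd z)) \<in> borel_measurable \<pi>"
      "(\<lambda>z. ennreal ((dist (fst z) (snd z))\<^sup>2)) \<in> borel_measurable \<pi>"
      unfolding measurable_cong_sets[OF s refl]
      by (intro measurable_compose[OF _ measurable_ennreal] borel_measurable_continuous_onI continuous_intros)+
  qed
  have ineq: "(norm x)\<^sup>2 \<le> 2 * (norm (x - y))\<^sup>2 + 2 * (norm y)\<^sup>2" for x y :: 'a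
  proof -
    have "(norm x)\<^sup>2 \<le> (norm (x - y) + norm y)\<^sup>2"
      using norm_triangle_ineq[of "x - y" y] by (intro power_mono) auto
    also have "\<dots> \<le> 2 * (norm (x - y))\<^sup>2 + 2 * (norm y)\<^sup>2"
      using sum_squares_bound[of "norm (x - y)" "norm y"] by (simp add: power2_sum)
    finally show ?thesis .
  qed
  have enn: "ennreal c \<le> 2 * ennreal a + 2 * ennreal b" if "c \<le> 2 * a + 2 * b" "a \<ge> 0" "b \<ge> 0" for a b c
  proof -
    have "ennreal c \<le> ennreal (2 * a + 2 * b)" using that(1) by (rule ennreal_leI)
    also have "\<dots> = 2 * ennreal a + 2 * ennreal b" using that by (simp add: ennreal_plus ennreal_mult)
    finally show ?thesis .
  qed
  define I where "I = (INF \<pi>\<in>couplings \<mu> \<nu>. ?c \<pi>)"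
  have prod: "\<mu> \<Otimes>\<^sub>M \<nu> \<in> couplings \<mu> \<nu>" using \<mu> \<nu> by (intro product_in_couplings) (auto simp: P2_def)
  have "I \<le> ?c (\<mu> \<Otimes>\<^sub>M \<nu>)" unfolding I_def by (rule INF_lower[OF prod])
  also have "\<dots> \<le> (\<integral>\<^sup>+ z. 2 * ?sq (fst z) + 2 * ?sq (snd z) \<partial>(\<mu> \<Otimes>\<^sub>M \<nu>))"
  proof (rule nn_integral_mono)
    fix z :: "'a \<times> 'a"
    have "(dist (fst z) (snd z))\<^sup>2 \<le> 2 * (norm (fst z))\<^sup>2 + 2 * (norm (snd z))\<^sup>2"
      using ineq[of "fst z - snd z" "- snd z"] by (simp add: dist_norm)
    then show "ennreal ((dist (fst z) (snd z))\<^sup>2) \<le> 2 * ?sq (fst z) + 2 * ?sq (snd z)"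
      by (rule enn) auto
  qed
  also have "\<dots> = 2 * integral\<^sup>N \<mu> ?sq + 2 * integral\<^sup>N \<nu> ?sq"
    using meas[OF prod] couplings_nn_integral[OF prod, of ?sq]
    by (simp add: nn_integral_add nn_integral_cmult)
  also have "\<dots> < \<infinity>" using \<mu> \<nu> by (auto simp: P2_def ennreal_mult_less_top)
  finally have "I < \<infinity>" .
  moreover have "enn2real I < 1"
    using W unfolding W2_def I_def by simp
  ultimately have "I < 1" by (cases I) (auto simp: ennreal_less_one_iff)
  then obtain \<pi> where \<pi>: "\<pi> \<in> couplings \<mu> \<nu>" "?c \<pi> < 1" unfolding I_def INF_less_iff by blast
  have "integral\<^sup>N \<mu> ?sq = (\<integral>\<^sup>+ z. ?sq (fst z) \<partial>\<pi>)" using couplings_nn_integral(1)[OF \<pi>(1), of ?sq] by simp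
  also have "\<dots> \<le> (\<integral>\<^sup>+ z. 2 * ennreal ((dist (fst z) (snd z))\<^sup>2) + 2 * ?sq (snd z) \<partial>\<pi>)"
  proof (rule nn_integral_mono)
    fix z :: "'a \<times> 'a"
    show "?sq (fst z) \<le> 2 * ennreal ((dist (fst z) (snd z))\<^sup>2) + 2 * ?sq (snd z)"
      using ineq[of "fst z" "snd z"] by (intro enn) (auto simp: dist_norm)
  qed
  also have "\<dots> = 2 * ?c \<pi> + 2 * integral\<^sup>N \<nu> ?sq"
    using meas[OF \<pi>(1)] couplings_nn_integral[OF \<pi>(1), of ?sq]
    by (simp add: nn_integral_add nn_integral_cmult)
  also have "\<dots> \<le> 2 * 1 + 2 * integral\<^sup>N \<nu> ?sq"
    using \<pi>(2) by (intro add_right_mono mult_left_mono) auto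
  finally show ?thesis by simp
qed

lemma two_atoms_second_moment: "(\<integral>\<^sup>+ z. ennreal ((norm z)\<^sup>2) \<partial>two_atoms c) = ennreal ((norm c)\<^sup>2)"
proof -
  interpret prob_space "two_atoms c" using two_atoms_borel_prob by (rule borel_probD)
  have "(\<integral>\<^sup>+ z. ennreal ((norm z)\<^sup>2) \<partial>two_atoms c) = (\<integral>\<^sup>+ z. ennreal ((norm c)\<^sup>2) \<partial>two_atoms c)"
    by (rule nn_integral_cong_AE) (use AE_two_atoms[of c] in \<open>auto elim!: eventually_mono\<close>)
  then show ?thesis by (simp add: emeasure_space_1)
qed

text \<open>The second moment of \<open>two_atoms c\<close> is the squared norm of \<open>c\<close>,
  and from some index on the distance to the limit is below 1, where second moments are
  comparable.\<close>

lemma two_atoms_converges_in_P2_imp_bounded: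
  assumes "converges_in_P2 (\<lambda>n. two_atoms (c n))"
  obtains N R where "\<And>n. n \<ge> N \<Longrightarrow> norm (c n) \<le> R"
proof -
  obtain \<nu> where \<nu>: "\<nu> \<in> P2" "(\<lambda>n. W2 (two_atoms (c n)) \<nu>) \<longlonglongrightarrow> 0"
    using assms by (auto simp: converges_in_P2_def)
  define M where "M = enn2real (\<integral>\<^sup>+ z. ennreal ((norm z)\<^sup>2) \<partial>\<nu>)"
  have M: "(\<integral>\<^sup>+ z. ennreal ((norm z)\<^sup>2) \<partial>\<nu>) = ennreal M" "M \<ge> 0"
    using \<nu>(1) by (auto simp: M_def P2_def)
  obtain N where N: "\<And>n. n \<ge> N \<Longrightarrow> W2 (two_atoms (c n)) \<nu> < 1"
    using order_tendstoD(2)[OF \<nu>(2), of 1] by (auto simp: eventually_sequentially)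
  have "norm (c n) \<le> sqrt (2 + 2 * M)" if "n \<ge> N" for n
  proof (rule real_le_rsqrt)
    have "two_atoms (c n) \<in> P2" using two_atoms_borel_prob by (auto simp: P2_def two_atoms_second_moment)
    from W2_less_1_second_moment[OF this \<nu>(1) N[OF that]]
    have "ennreal ((norm (c n))\<^sup>2) \<le> ennreal (2 + 2 * M)"
      using M(2) by (simp add: two_atoms_second_moment M(1) ennreal_mult ennreal_plus)
    then show "(norm (c n))\<^sup>2 \<le> 2 + 2 * M" using M(2) by (subst (asm) ennreal_le_iff) auto
  qed
  then show ?thesis by (rule that)
qed

lemma continuous_curve_two_atoms:
  fixes z :: "real \<Rightarrow> 'a::euclidean_space"
  assumes "continuous_on {0..} z"
  shows "continuous_curve_Pc (\<lambda>t. two_atoms (z t))"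
  unfolding continuous_curve_Pc_def
proof (intro conjI allI impI two_atoms_Pc)
  fix t :: real assume "t \<ge> 0"
  then have "(z \<longlongrightarrow> z t) (at t within {0..})" using assms unfolding continuous_on_def by simp
  then have "((\<lambda>s. dist (z s) (z t)) \<longlongrightarrow> 0) (at t within {0..})" by (rule tendsto_dist_iff[THEN iffD1])
  then have "((\<lambda>s. ennreal (dist (z s) (z t))) \<longlongrightarrow> ennreal 0) (at t within {0..})" by (rule tendsto_ennrealI)
  then have lim: "((\<lambda>s. ennreal (dist (z s) (z t))) \<longlongrightarrow> 0) (at t within {0..})" by simp
  show "((\<lambda>s. W_inf (two_atoms (z s)) (two_atoms (z t))) \<longlongrightarrow> 0) (at t within {0..})"
    by (rule tendsto_sandwich[OF _ _ tendsto_const lim]) (simp_all add: W_inf_two_atoms)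
qed

section \<open>Test functions along the two-particle trajectory\<close>

lemma continuous_on_linear_apply:
  fixes D :: "'x::topological_space \<Rightarrow> 'b::euclidean_space \<Rightarrow> real" and p :: "'y::topological_space \<Rightarrow> 'x"
  assumes lin: "\<And>x. x \<in> S \<Longrightarrow> bounded_linear (D x)"
    and D: "\<And>b. b \<in> Basis \<Longrightarrow> continuous_on S (\<lambda>x. D x b)"
    and p: "continuous_on X p" "\<And>x. x \<in> X \<Longrightarrow> p x \<in> S" and y: "continuous_on X y"
  shows "continuous_on X (\<lambda>x. D (p x) (y x))"
proof (rule continuous_on_cong[OF refl, THEN iffD1])
  \<comment> \<open>Expansion in the basis reduces joint continuity to finitely many fixed
    directions.\<close>
  show "(\<Sum>b\<in>Basis. (y x \<bullet> b) * D (p x) b) = D (p x) (y x)" if "x \<in> X" for x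
  proof -
    interpret bounded_linear "D (p x)" by (rule lin[OF p(2)[OF that]])
    have "D (p x) (y x) = D (p x) (\<Sum>b\<in>Basis. (y x \<bullet> b) *\<^sub>R b)" by (simp add: euclidean_representation)
    then show ?thesis by (simp only: sum scaleR real_scaleR_def)
  qed
  show "continuous_on X (\<lambda>x. \<Sum>b\<in>Basis. (y x \<bullet> b) * D (p x) b)"
    using p(2) by (intro continuous_intros y continuous_on_compose2[OF D p(1)]) auto
qed

lemma test_function_derivative:
  fixes h :: "real \<times> 'b::euclidean_space \<Rightarrow> real"
  assumes "h \<in> test_functions"
  shows "\<exists>D b. b \<ge> 0 \<and> (\<forall>x\<in>{0..} \<times> UNIV. (h has_derivative D x) (at x within {0..} \<times> UNIV)) \<and>
    (\<forall>y. continuous_on ({0..} \<times> UNIV) (\<lambda>x. D x y)) \<and>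
    (\<forall>t z. t \<ge> b \<longrightarrow> h (t, z) = 0) \<and> (\<forall>t z y. t > b \<longrightarrow> D (t, z) y = 0)"
proof -
  define D where "D x = frechet_derivative h (at x within {0..} \<times> UNIV)" for x
  have "C_k_on (Suc 0) ({0..} \<times> UNIV) h" using assms by (auto simp: test_functions_def smooth_on_def)
  then have h: "h differentiable_on ({0..} \<times> UNIV)"
    and Db: "\<And>b. b \<in> Basis \<Longrightarrow> continuous_on ({0..} \<times> UNIV) (\<lambda>x. D x b)"
    by (auto simp: D_def)
  have D: "(h has_derivative D x) (at x within {0..} \<times> UNIV)" if "x \<in> {0..} \<times> UNIV" for x
    using h that unfolding differentiable_on_def D_def frechet_derivative_works by blast
  have Dy: "continuous_on ({0..} \<times> UNIV) (\<lambda>x. D x y)" for y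
    using continuous_on_linear_apply[OF has_derivative_bounded_linear[OF D] Db, of "{0..} \<times> UNIV" "\<lambda>x. x" "\<lambda>_. y"]
    by simp
  have "bounded {z \<in> {0..} \<times> UNIV. h z \<noteq> 0}"
    using assms compact_imp_bounded bounded_subset closure_subset by (fastforce simp: test_functions_def)
  then obtain B where B: "\<And>x. x \<in> {0..} \<times> UNIV \<Longrightarrow> h x \<noteq> 0 \<Longrightarrow> norm x < B"
    unfolding bounded_pos_less by blast
  define b where "b = max 0 B"
  have hb: "h (t, z) = 0" if "t \<ge> b" for t z
  proof (rule ccontr)
    assume "h (t, z) \<noteq> 0"
    then have "norm (t, z) < B" using that by (intro B) (auto simp: b_def)
    then show False using norm_fst_le[of t z] that by (simp add: b_def)
  qed
  \<comment> \<open>The bound on \<open>t\<close> is strict: the derivative is computed on an open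
    set of times on which \<open>h\<close> is 0.\<close>
  have "D (t, z) y = 0" if t: "t > b" for t z y
  proof -
    have "((\<lambda>_. 0) has_derivative (\<lambda>_. 0)) (at (t, z) within {0..} \<times> UNIV)" by simp
    then have "(h has_derivative (\<lambda>_. 0)) (at (t, z) within {0..} \<times> UNIV)"
    proof (rule has_derivative_transform_within_open)
      show "open ({b<..} \<times> (UNIV :: 'b set))" by (intro open_Times) auto
      show "0 = h x" if "x \<in> {b<..} \<times> UNIV" for x using that hb[of "fst x" "snd x"] by auto
    qed (use t in auto)
    then have "D (t, z) = (\<lambda>_. 0)"
      unfolding D_def using t by (intro frechet_derivative_half_space) (auto simp: b_def)
    then show ?thesis by simp
  qed
  with D Dy hb show ?thesis by (intro exI[of _ D] exI[of _ b]) (auto simp: b_def)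
qed

context mean_field begin

lemma field_minus: "field (- z) = - field z"
  using kernel_minus[of z "- z"] by (simp add: field_def)

lemma interaction_two_atoms:
  "interaction V \<psi> (two_atoms c) (fst c) (snd c) = - snd (field c)"
  "interaction V \<psi> (two_atoms c) (fst (- c)) (snd (- c)) = - snd (field (- c))"
proof -
  have "kernel x \<in> borel_measurable borel" for x
    by (intro borel_measurable_continuous_onI continuous_intros)
  then have "interaction V \<psi> (two_atoms c) (fst x) (snd x) = (1/2) *\<^sub>R (kernel x c + kernel x (- c))" for x
    by (simp add: interaction_eq integral_two_atoms)
  from this[of c] this[of "- c"] show
    "interaction V \<psi> (two_atoms c) (fst c) (snd c) = - snd (field c)"
    "interaction V \<psi> (two_atoms c) (fst (- c)) (snd (- c)) = - snd (field (- c))"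
    using kernel_minus[of c c] by (simp_all add: field_def kernel_self)
qed

lemma mean_velocity_two_atoms: "mean_velocity (two_atoms (c :: 'a \<times> 'a)) = 0"
proof -
  have "(snd :: 'a \<times> 'a \<Rightarrow> 'a) \<in> borel_measurable borel"
    by (intro borel_measurable_continuous_onI continuous_intros)
  then show ?thesis by (simp add: mean_velocity_def integral_two_atoms)
qed

text \<open>The average of \<open>h\<close> over the two moving atoms is differentiated in time. By
  oddness of \<open>field\<close> the atom \<open>- z\<close> obeys the same differential equation,
  and the weak equation becomes the fundamental theorem of calculus on \<open>{0..b}\<close>, with
  \<open>A\<close> and \<open>B\<close> as integrands of the two sides.\<close>

theorem two_atoms_solution:
  assumes z: "is_trajectory z"
  shows "mean_field_solution V \<psi> (two_atoms (z 0)) (\<lambda>t. two_atoms (z t))"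
  unfolding mean_field_solution_def
proof (intro conjI ballI)
  have zd: "(z has_vector_derivative field (z t)) (at t within {0..})" if "t \<ge> 0" for t
    using z that by (simp add: is_trajectory_def)
  have zc: "continuous_on {0..} z"
    unfolding continuous_on_eq_continuous_within
    by (intro ballI has_vector_derivative_continuous[OF zd]) simp
  show curve: "continuous_curve_Pc (\<lambda>t. two_atoms (z t))" by (rule continuous_curve_two_atoms[OF zc])
  fix h :: "real \<times> 'a \<times> 'a \<Rightarrow> real" assume "h \<in> test_functions"
  from test_function_derivative[OF this] obtain D b where
    Dex: "b \<ge> 0 \<and> (\<forall>x\<in>{0..} \<times> UNIV. (h has_derivative D x) (at x within {0..} \<times> UNIV)) \<and>
    (\<forall>y. continuous_on ({0..} \<times> UNIV) (\<lambda>x. D x y)) \<and>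
    (\<forall>t z. t \<ge> b \<longrightarrow> h (t, z) = 0) \<and> (\<forall>t z y. t > b \<longrightarrow> D (t, z) y = 0)"
    by (elim exE)
  then have b: "b \<ge> 0" by simp
  have D: "\<And>x. x \<in> {0..} \<times> UNIV \<Longrightarrow> (h has_derivative D x) (at x within {0..} \<times> UNIV)"
    and Dc: "\<And>y. continuous_on ({0..} \<times> UNIV) (\<lambda>x. D x y)"
    and hb: "\<And>t z. t \<ge> b \<Longrightarrow> h (t, z) = 0" and Db: "\<And>t z y. t > b \<Longrightarrow> D (t, z) y = 0"
    using Dex by blast+
  have lin: "bounded_linear (D (t, x))" if "t \<ge> 0" for t x
    using D[of "(t, x)"] that by (auto intro: has_derivative_bounded_linear)
  have lin_scaleR: "D (t, x) (k *\<^sub>R y) = k * D (t, x) y" if "t \<ge> 0" for t x k y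
    using linear_cmul[OF bounded_linear.linear[OF lin[OF that]]] by simp
  note Dcomp = continuous_on_linear_apply[OF has_derivative_bounded_linear[OF D] Dc]
  have dt: "vector_derivative (\<lambda>s. h (s, x)) (at t within {0..}) = D (t, x) (1, 0)" if t: "t \<ge> 0" for t x
  proof (rule vector_derivative_within)
    have "((\<lambda>s. h (s, x)) has_derivative (\<lambda>k. D (t, x) (k, 0))) (at t within {0..})"
      by (rule has_derivative_in_compose2[of "{0..} \<times> UNIV", OF D])
        (use t in \<open>auto intro!: derivative_eq_intros\<close>)
    moreover have "(\<lambda>k. D (t, x) (k, 0)) = (\<lambda>k. k *\<^sub>R D (t, x) (1, 0))"
    proof
      show "D (t, x) (k, 0) = k *\<^sub>R D (t, x) (1, 0)" for k
        using lin_scaleR[OF t, of x k "(1, 0)"] by simp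
    qed
    ultimately show "((\<lambda>s. h (s, x)) has_vector_derivative D (t, x) (1, 0)) (at t within {0..})"
      by (simp add: has_vector_derivative_def)
    have "at_right t \<le> at t within {0..}" by (rule at_le) (use t in auto)
    then show "at t within {0..} \<noteq> bot"
      using trivial_limit_at_right_real[of t] by (auto simp: bot_unique)
  qed
  have grad_inner: "grad f x \<bullet> y = f' y" if "(f has_derivative f') (at x)" for f :: "'a \<Rightarrow> real" and f' x y
    using has_derivative_unique[OF that has_derivative_grad[OF differentiableI[OF that]]] by simp
  \<comment> \<open>Slices at a fixed time are differentiable on the whole space, although
    \<open>D\<close> is a derivative within the half-space only.\<close>
  have gr: "y \<bullet> grad (\<lambda>r. h (t, r, v)) r = D (t, r, v) (0, y, 0)" if t: "t \<ge> 0" for t r v y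
    unfolding inner_commute[of y]
    by (rule grad_inner, rule has_derivative_in_compose2[of "{0..} \<times> UNIV", OF D])
      (use t in \<open>auto intro!: derivative_eq_intros\<close>)
  have gv: "y \<bullet> grad (\<lambda>v. h (t, r, v)) v = D (t, r, v) (0, 0, y)" if t: "t \<ge> 0" for t r v y
    unfolding inner_commute[of y]
    by (rule grad_inner, rule has_derivative_in_compose2[of "{0..} \<times> UNIV", OF D])
      (use t in \<open>auto intro!: derivative_eq_intros\<close>)
  define A where "A t = (1/2) * (D (t, z t) (1, snd (z t), 0) + D (t, - z t) (1, - snd (z t), 0))" for t
  define B where "B t = (1/2) * (D (t, z t) (0, 0, - snd (field (z t))) + D (t, - z t) (0, 0, snd (field (z t))))" for t
  have fc: "continuous_on {0..} (\<lambda>t. field (z t))"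
    unfolding field_def by (intro continuous_intros zc)
  have Ac: "continuous_on {0..} A" "continuous_on {0..} B"
    unfolding A_def B_def by (intro continuous_intros Dcomp zc fc; simp)+
  have LA: "(\<integral>(r, v). vector_derivative (\<lambda>s. h (s, r, v)) (at t within {0..})
      + (v - mean_velocity (two_atoms (z 0))) \<bullet> grad (\<lambda>x. h (t, x, v)) r \<partial>two_atoms (z t)) = A t"
    if t: "t \<ge> 0" for t
  proof -
    have "D (t, x) (1, 0) + D (t, x) (0, snd x, 0) = D (t, x) (1, snd x, 0)" for x
      using linear_add[OF bounded_linear.linear[OF lin[OF t, of x]], of "(1, 0)" "(0, snd x, 0)"]
      by (simp add: zero_prod_def)
    then have "(\<integral>(r, v). vector_derivative (\<lambda>s. h (s, r, v)) (at t within {0..})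
        + (v - mean_velocity (two_atoms (z 0))) \<bullet> grad (\<lambda>x. h (t, x, v)) r \<partial>two_atoms (z t))
        = (\<integral>x. D (t, x) (1, snd x, 0) \<partial>two_atoms (z t))"
      by (intro Bochner_Integration.integral_cong) (auto simp: dt[OF t] gr[OF t] mean_velocity_two_atoms)
    also have "\<dots> = A t"
      by (subst integral_two_atoms)
        (use t in \<open>auto simp: A_def intro!: borel_measurable_continuous_onI Dcomp continuous_intros\<close>)
    finally show ?thesis .
  qed
  have LB: "(\<integral>(r, v). interaction V \<psi> (two_atoms (z t)) r v \<bullet> grad (\<lambda>w. h (t, r, w)) v \<partial>two_atoms (z t)) = B t"
    if t: "t \<ge> 0" for t
  proof -
    have "(\<integral>(r, v). interaction V \<psi> (two_atoms (z t)) r v \<bullet> grad (\<lambda>w. h (t, r, w)) v \<partial>two_atoms (z t))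
        = (\<integral>x. D (t, x) (0, 0, interaction V \<psi> (two_atoms (z t)) (fst x) (snd x)) \<partial>two_atoms (z t))"
      by (intro Bochner_Integration.integral_cong) (auto simp: gv[OF t])
    also have "\<dots> = B t"
    proof (subst integral_two_atoms)
      have "continuous_on UNIV (\<lambda>x. - snd (drift (two_atoms (z t)) x))"
        by (intro continuous_intros continuous_on_drift_at[OF curve t])
      then have "continuous_on UNIV (\<lambda>x. interaction V \<psi> (two_atoms (z t)) (fst x) (snd x))"
        by (simp add: drift_def interaction_eq)
      then show "(\<lambda>x. D (t, x) (0, 0, interaction V \<psi> (two_atoms (z t)) (fst x) (snd x))) \<in> borel_measurable borel"
        using t by (intro borel_measurable_continuous_onI Dcomp continuous_intros) auto
    qed (simp only: interaction_two_atoms B_def field_minus, simp)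
    finally show ?thesis .
  qed
  have *: "(LINT t:{0..}|lborel. (\<integral>(r, v). vector_derivative (\<lambda>s. h (s, r, v)) (at t within {0..})
      + (v - mean_velocity (two_atoms (z 0))) \<bullet> grad (\<lambda>x. h (t, x, v)) r \<partial>two_atoms (z t))) = integral {0..b} A"
    "(LINT t:{0..}|lborel. (\<integral>(r, v). interaction V \<psi> (two_atoms (z t)) r v \<bullet> grad (\<lambda>w. h (t, r, w)) v \<partial>two_atoms (z t)))
      = integral {0..b} B"
    by (subst set_lebesgue_integral_cong[of _ lborel _ A] set_lebesgue_integral_cong[of _ lborel _ B];
        simp add: LA LB set_lebesgue_integral_eq_integral_bounded[OF Ac(1) _ b]
          set_lebesgue_integral_eq_integral_bounded[OF Ac(2) _ b] A_def B_def Db)+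
  have h0: "(\<integral>(r, v). h (0, r, v) \<partial>two_atoms (z 0)) = (1/2) * (h (0, z 0) + h (0, - z 0))"
  proof -
    have "continuous_on ({0..} \<times> UNIV) h"
      unfolding continuous_on_eq_continuous_within using D has_derivative_continuous by blast
    then have "continuous_on UNIV (\<lambda>x. h (0, x))"
      by (rule continuous_on_compose2) (auto intro!: continuous_intros)
    then show ?thesis
      by (simp add: case_prod_beta integral_two_atoms borel_measurable_continuous_onI uminus_prod_def)
  qed
  have "((\<lambda>t. A t - B t) has_integral
      ((1/2) * (h (b, z b) + h (b, - z b)) - (1/2) * (h (0, z 0) + h (0, - z 0)))) {0..b}"
  proof (rule fundamental_theorem_of_calculus[OF b])
    fix t assume t: "t \<in> {0..b}"
    have *: "((\<lambda>t. h (t, w t)) has_vector_derivative D (t, w t) (1, w')) (at t within {0..})"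
      if "(w has_vector_derivative w') (at t within {0..})" for w w'
    proof -
      have "((\<lambda>t. h (t, w t)) has_derivative (\<lambda>k. D (t, w t) (k, k *\<^sub>R w'))) (at t within {0..})"
        by (rule has_derivative_in_compose2[of "{0..} \<times> UNIV", OF D])
          (use t that in \<open>auto intro!: derivative_eq_intros simp: has_vector_derivative_def\<close>)
      moreover have "(\<lambda>k. D (t, w t) (k, k *\<^sub>R w')) = (\<lambda>k. k *\<^sub>R D (t, w t) (1, w'))"
      proof
        show "D (t, w t) (k, k *\<^sub>R w') = k *\<^sub>R D (t, w t) (1, w')" for k
          using lin_scaleR[of t "w t" k "(1, w')"] t by simp
      qed
      ultimately show ?thesis by (simp add: has_vector_derivative_def)
    qed
    have "((\<lambda>t. (1/2) *\<^sub>R (h (t, z t) + h (t, - z t))) has_vector_derivative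
        (1/2) *\<^sub>R (D (t, z t) (1, field (z t)) + D (t, - z t) (1, - field (z t)))) (at t within {0..})"
      using zd[of t] t
      by (intro bounded_linear.has_vector_derivative[OF bounded_linear_scaleR_right] has_vector_derivative_add *
          has_vector_derivative_minus) auto
    moreover have "A t - B t = (1/2) *\<^sub>R (D (t, z t) (1, field (z t)) + D (t, - z t) (1, - field (z t)))"
    proof -
      have split: "D (t, x) (1, p, 0) - D (t, x) (0, 0, - q) = D (t, x) (1, p, q)" for x p q
        using linear_diff[OF bounded_linear.linear[OF lin[of t x]], of "(1, p, 0)" "(0, 0, - q)"] t by simp
      have avg: "(1/2) * (a + b) - (1/2) * (c + d) = (1/2) *\<^sub>R (p + q)"
        if "a - c = p" "b - d = q" for a b c d p q :: real
        using that by (simp add: field_simps)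
      have f: "(1, field (z t)) = (1, snd (z t), snd (field (z t)))"
        "(1, - field (z t)) = (1, - snd (z t), - snd (field (z t)))"
        by (simp_all add: field_def)
      show ?thesis
        unfolding A_def B_def f
        using avg[OF split split[of "- z t" "- snd (z t)" "- snd (field (z t))"]] by simp
    qed
    ultimately have "((\<lambda>t. (1/2) * (h (t, z t) + h (t, - z t))) has_vector_derivative A t - B t) (at t within {0..})"
      by (simp only: real_scaleR_def)
    then show "((\<lambda>t. (1/2) * (h (t, z t) + h (t, - z t))) has_vector_derivative A t - B t) (at t within {0..b})"
      by (rule has_vector_derivative_within_subset) auto
  qed
  then have "integral {0..b} (\<lambda>t. A t - B t) = - (1/2) * (h (0, z 0) + h (0, - z 0))"
    using hb[of b] by (simp add: integral_unique)
  moreover have "integral {0..b} (\<lambda>t. A t - B t) = integral {0..b} A - integral {0..b} B"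
    by (rule integral_diff; rule integrable_continuous_real; rule continuous_on_subset[OF Ac(1)] continuous_on_subset[OF Ac(2)]; auto)
  ultimately show "(LINT t:{0..}|lborel. (\<integral>(r, v). vector_derivative (\<lambda>s. h (s, r, v)) (at t within {0..})
      + (v - mean_velocity (two_atoms (z 0))) \<bullet> grad (\<lambda>x. h (t, x, v)) r \<partial>two_atoms (z t)))
      + (\<integral>(r, v). h (0, r, v) \<partial>two_atoms (z 0))
    = (LINT t:{0..}|lborel. (\<integral>(r, v). interaction V \<psi> (two_atoms (z t)) r v \<bullet> grad (\<lambda>w. h (t, r, w)) v \<partial>two_atoms (z t)))"
    unfolding * h0 by simp
qed

end

section \<open>Uniqueness\<close>

text \<open>The cutoff acts on the squared norm, which is a polynomial, because the norm itself is
  not smooth at 0.\<close>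

lemma ball_cutoff:
  obtains \<kappa> :: "'b::euclidean_space \<Rightarrow> real"
  where "\<kappa> \<in> smooth" "\<And>x. norm x \<le> R \<Longrightarrow> \<kappa> x = 1" "bounded {x. \<kappa> x \<noteq> 0}"
proof
  let ?\<kappa> = "\<lambda>x :: 'b. cutoff (R\<^sup>2) (R\<^sup>2 + 1) ((norm (x - 0))\<^sup>2)"
  show "?\<kappa> \<in> smooth" by (intro smooth_cutoff smooth_norm_sq)
  show "?\<kappa> x = 1" if "norm x \<le> R" for x :: 'b
    using that by (intro cutoff_eq_1) (auto intro: power_mono)
  have "norm x \<le> sqrt (R\<^sup>2 + 1)" if "?\<kappa> x \<noteq> 0" for x :: 'b
  proof (rule real_le_rsqrt)
    show "(norm x)\<^sup>2 \<le> R\<^sup>2 + 1"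
      using that cutoff_eq_0[of "R\<^sup>2" "R\<^sup>2 + 1" "(norm x)\<^sup>2"] by fastforce
  qed
  then show "bounded {x :: 'b. ?\<kappa> x \<noteq> 0}" by (auto simp: bounded_iff)
qed

lemma bounded_support_mult: "bounded {x. f x \<noteq> (0::real)} \<Longrightarrow> bounded {x. f x * g x \<noteq> 0}"
  by (rule bounded_subset) auto

text \<open>The zeros of the polynomial \<open>q\<close> are exactly the two atoms, so its vanishing
  integral concentrates \<open>\<mu>\<close> on them; testing with \<open>x \<bullet> c\<close> then
  balances the masses. The cutoff \<open>\<kappa>\<close> is 1 on a ball carrying both measures and
  makes these polynomials admissible.\<close>

lemma two_atoms_eqI:
  fixes \<mu> :: "'b::euclidean_space measure"
  assumes \<mu>: "\<mu> \<in> Pc" and c: "c \<noteq> 0"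
    and eq: "\<And>\<phi>. \<phi> \<in> smooth \<Longrightarrow> bounded {x. \<phi> x \<noteq> 0} \<Longrightarrow> (\<integral>x. \<phi> x \<partial>\<mu>) = (\<integral>x. \<phi> x \<partial>two_atoms c)"
  shows "\<mu> = two_atoms c"
proof -
  obtain R0 where R0: "AE x in \<mu>. norm x < R0" using Pc_AE_bounded[OF \<mu>] by blast
  define R where "R = max R0 (norm c)"
  obtain \<kappa> :: "'b \<Rightarrow> real" where \<kappa>: "\<kappa> \<in> smooth" "\<And>x. norm x \<le> R \<Longrightarrow> \<kappa> x = 1" "bounded {x. \<kappa> x \<noteq> 0}"
    using ball_cutoff by blast
  have AE: "AE x in \<mu>. \<kappa> x = 1" using R0 by eventually_elim (auto simp: \<kappa>(2) R_def)
  have \<kappa>c: "\<kappa> c = 1" "\<kappa> (- c) = 1" by (auto simp: \<kappa>(2) R_def)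
  have \<mu>b: "\<mu> \<in> borel_prob" using \<mu> by (simp add: Pc_def)
  have meas: "f \<in> borel_measurable \<mu>" if "continuous_on UNIV f" for f :: "'b \<Rightarrow> real"
    unfolding measurable_cong_sets[OF borel_probD(2)[OF \<mu>b] refl] by (rule borel_measurable_continuous_onI[OF that])
  define q where "q x = (norm (x - c))\<^sup>2 * (norm (x - (- c)))\<^sup>2" for x
  have q: "q \<in> smooth" unfolding q_def by (intro smooth.mult smooth_norm_sq)
  have qc: "continuous_on UNIV q" "continuous_on UNIV \<kappa>" using q \<kappa>(1) by (auto intro: smooth_continuous_on)
  have "(\<integral>x. q x \<partial>\<mu>) = (\<integral>x. \<kappa> x * q x \<partial>\<mu>)"
    by (rule integral_cong_AE) (use AE in \<open>auto intro!: meas continuous_intros qc\<close>)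
  also have "\<dots> = (\<integral>x. \<kappa> x * q x \<partial>two_atoms c)"
    by (intro eq smooth.mult \<kappa> q bounded_support_mult)
  also have "\<dots> = 0"
    by (subst integral_two_atoms) (auto intro!: borel_measurable_continuous_onI continuous_intros qc simp: q_def)
  finally have "(\<integral>x. q x \<partial>\<mu>) = 0" .
  then have "AE x in \<mu>. q x = 0"
    by (subst (asm) integral_nonneg_eq_0_iff_AE) (auto simp: q_def intro!: Pc_integrable[OF \<mu>] continuous_intros)
  then have "AE x in \<mu>. x \<in> {c, - c}" by eventually_elim (auto simp: q_def eq_neg_iff_add_eq_0)
  moreover have "(\<integral>x. x \<bullet> c \<partial>\<mu>) = 0"
  proof -
    have "(\<integral>x. x \<bullet> c \<partial>\<mu>) = (\<integral>x. \<kappa> x * (x \<bullet> c) \<partial>\<mu>)"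
      by (rule integral_cong_AE) (use AE in \<open>auto intro!: meas continuous_intros qc\<close>)
    also have "\<dots> = (\<integral>x. \<kappa> x * (x \<bullet> c) \<partial>two_atoms c)"
      by (intro eq smooth.mult \<kappa> smooth.inner bounded_support_mult)
    also have "\<dots> = 0"
      by (subst integral_two_atoms) (auto intro!: borel_measurable_continuous_onI continuous_intros qc simp: \<kappa>c)
    finally show ?thesis .
  qed
  ultimately show ?thesis using c by (intro two_atoms_unique[OF \<mu>b])
qed

lemma gronwall_zero:
  fixes D :: "real \<Rightarrow> real"
  assumes D: "\<And>x. x \<in> {T..S} \<Longrightarrow> (D has_real_derivative D' x) (at x within {T..S})"
    and le: "\<And>x. x \<in> {T..S} \<Longrightarrow> D' x \<le> C * D x" and D0: "D T \<le> 0" and s: "s \<in> {T..S}"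
  shows "D s \<le> 0"
proof (cases "s = T")
  case False
  then have "T < s" using s by simp
  define u where "u x = D x * exp (- C * (x - T))" for x
  have "\<exists>\<xi>\<in>{T<..<s}. u s - u T = ((D' \<xi> - C * D \<xi>) * exp (- C * (\<xi> - T))) * (s - T)"
  proof (rule mvt_simple[OF \<open>T < s\<close>])
    fix x assume x: "T \<le> x" "x \<le> s"
    have "(D has_real_derivative D' x) (at x within {T..s})"
      by (rule DERIV_subset[OF D]) (use x s in auto)
    then have "(u has_real_derivative (D' x - C * D x) * exp (- C * (x - T))) (at x within {T..s})"
      unfolding u_def by (auto intro!: derivative_eq_intros simp: algebra_simps)
    then show "(u has_derivative (*) ((D' x - C * D x) * exp (- C * (x - T)))) (at x within {T..s})"
      by (simp add: has_field_derivative_def)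
  qed
  then obtain \<xi> where \<xi>: "T < \<xi>" "\<xi> < s" "u s - u T = ((D' \<xi> - C * D \<xi>) * exp (- C * (\<xi> - T))) * (s - T)"
    by auto
  have "D' \<xi> - C * D \<xi> \<le> 0" using le[of \<xi>] \<xi> s by simp
  then have "u s - u T \<le> 0" unfolding \<xi>(3) using \<open>T < s\<close> by (intro mult_nonpos_nonneg) auto
  then have "u s \<le> 0" using D0 by (simp add: u_def)
  then show ?thesis by (simp add: u_def mult_le_0_iff)
qed (use D0 in simp)

context mean_field begin

text \<open>The gradient of \<open>\<phi>\<close> matters only where the measures are concentrated.
  Replacing it by a formula \<open>H\<close> valid on \<open>B\<close> removes the cutoffs from the
  later computations.\<close>

lemma evolution_derivative:
  assumes sol: "mean_field_solution V \<psi> f0 g" and mv: "mean_velocity f0 = 0"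
    and \<phi>: "\<phi> \<in> smooth" "bounded {x. \<phi> x \<noteq> 0}"
    and B: "\<And>x. x \<in> B \<Longrightarrow> (\<phi> has_derivative (\<lambda>h. H x \<bullet> h)) (at x)" "continuous_on UNIV H"
    and AE: "\<And>s. s \<in> {T..S} \<Longrightarrow> AE x in g s. x \<in> B" and T: "0 \<le> T" and s: "s \<in> {T..S}"
  shows "((\<lambda>t. \<integral>x. \<phi> x \<partial>g t) has_real_derivative (\<integral>x. H x \<bullet> drift (g s) x \<partial>g s)) (at s within {T..S})"
proof -
  have g: "continuous_curve_Pc g" using sol by (simp add: mean_field_solution_def)
  have s0: "s \<ge> 0" using s T by simp
  obtain G where G: "\<And>x. (\<phi> has_derivative (\<lambda>h. G x \<bullet> h)) (at x)" "continuous_on UNIV G"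
    using smooth_gradient[OF \<phi>(1)] by blast
  have GH: "G x = H x" if "x \<in> B" for x
    using grad_eqI[OF G(1)[of x]] grad_eqI[OF B(1)[OF that]] by simp
  define k where "k t = (\<integral>x. G x \<bullet> drift (g t) x \<partial>g t)" for t
  have "continuous_on {0..S} k" unfolding k_def
    using continuous_integral_drift[OF g G(2)] by (rule continuous_on_subset) auto
  then have "((\<lambda>u. integral {0..u} k) has_real_derivative k s) (at s within {0..S})"
    using s s0 by (intro integral_has_real_derivative) auto
  then have "((\<lambda>u. (\<integral>x. \<phi> x \<partial>f0) + integral {0..u} k) has_real_derivative k s) (at s within {0..S})"
    by (auto intro!: derivative_eq_intros)
  then have "((\<lambda>t. \<integral>x. \<phi> x \<partial>g t) has_real_derivative k s) (at s within {0..S})"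
    by (rule has_field_derivative_transform_within[OF _ zero_less_one])
      (use s s0 evolution[OF sol mv \<phi> G] in \<open>auto simp: k_def[abs_def]\<close>)
  then have "((\<lambda>t. \<integral>x. \<phi> x \<partial>g t) has_real_derivative k s) (at s within {T..S})"
    by (rule DERIV_subset) (use T in auto)
  moreover have "k s = (\<integral>x. H x \<bullet> drift (g s) x \<partial>g s)"
    unfolding k_def
  proof (rule integral_cong_AE)
    have *: "sets (g s) = sets borel" using g s0 by (auto simp: continuous_curve_Pc_def Pc_def borel_prob_def)
    show "(\<lambda>x. G x \<bullet> drift (g s) x) \<in> borel_measurable (g s)" "(\<lambda>x. H x \<bullet> drift (g s) x) \<in> borel_measurable (g s)"
      unfolding measurable_cong_sets[OF * refl]
      by (intro borel_measurable_continuous_onI continuous_intros G B continuous_on_drift_at[OF g s0])+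
    show "AE x in g s. G x \<bullet> drift (g s) x = H x \<bullet> drift (g s) x"
      using AE[OF s] by eventually_elim (simp add: GH)
  qed
  ultimately show ?thesis by simp
qed

text \<open>In the evolution equation a single time is negligible in the integral, so the value at
  \<open>T\<close> is determined by earlier times and the datum. For \<open>T = 0\<close> this is
  agreement with the initial datum.\<close>

lemma solutions_agree_at_limit:
  assumes f: "mean_field_solution V \<psi> f0 f" and g: "mean_field_solution V \<psi> f0 g" and mv: "mean_velocity f0 = 0"
    and T: "T \<ge> 0" and agree: "\<And>s. 0 \<le> s \<Longrightarrow> s < T \<Longrightarrow> g s = f s"
    and \<phi>: "\<phi> \<in> smooth" "bounded {x. \<phi> x \<noteq> 0}"
  shows "(\<integral>x. \<phi> x \<partial>g T) = (\<integral>x. \<phi> x \<partial>f T)"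
proof -
  obtain G where G: "\<And>x. (\<phi> has_derivative (\<lambda>h. G x \<bullet> h)) (at x)" "continuous_on UNIV G"
    using smooth_gradient[OF \<phi>(1)] by blast
  have "integral {0..T} (\<lambda>s. \<integral>z. G z \<bullet> drift (g s) z \<partial>g s) = integral {0..T} (\<lambda>s. \<integral>z. G z \<bullet> drift (f s) z \<partial>f s)"
    by (rule integral_spike[of "{T}"]) (use agree in auto)
  then show ?thesis
    unfolding evolution[OF f mv \<phi> G T] evolution[OF g mv \<phi> G T] by simp
qed


lemma kernel_sign:
  assumes "\<sigma> = 1 \<or> \<sigma> = (-1::real)"
  shows "\<sigma> *\<^sub>R kernel x x' = kernel (\<sigma> *\<^sub>R x) (\<sigma> *\<^sub>R x')"
  using assms kernel_minus[of x x'] by auto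

text \<open>The reflection \<open>x \<mapsto> \<sigma> x *\<^sub>R x\<close> merges the clusters around \<open>w\<close> and \<open>- w\<close> into one. The
  kernel is odd and the two clusters have equal mass, so the reflected drift is compared with \<^const>\<open>field\<close>.\<close>

lemma reflected_drift_bound:
  fixes \<sigma> :: "'a \<times> 'a \<Rightarrow> real"
  assumes \<mu>: "\<mu> \<in> Pc" and dc: "continuous_on UNIV (drift \<mu>)" and \<sigma>: "continuous_on UNIV \<sigma>"
    and AE: "AE x in \<mu>. (\<sigma> x = 1 \<or> \<sigma> x = -1) \<and> norm x \<le> R" and w: "norm w \<le> R"
    and bal: "(\<integral>x. \<sigma> x \<partial>\<mu>) = 0"
    and L: "L \<ge> 0"
      "\<And>z z' w w'. norm z \<le> R \<Longrightarrow> norm z' \<le> R \<Longrightarrow> norm w \<le> R \<Longrightarrow> norm w' \<le> R \<Longrightarrow>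
        norm (kernel z z' - kernel w w') \<le> L * (norm (z - w) + norm (z' - w'))"
  shows "(\<integral>x. 2 * ((\<sigma> x *\<^sub>R x - w) \<bullet> (\<sigma> x *\<^sub>R drift \<mu> x - field w)) \<partial>\<mu>)
    \<le> (2 + 4 * L) * (\<integral>x. (norm (\<sigma> x *\<^sub>R x - w))\<^sup>2 \<partial>\<mu>)"
proof -
  interpret prob_space \<mu> using \<mu> by (auto simp: Pc_def borel_probD)
  have int: "integrable \<mu> f" if "continuous_on UNIV f" for f :: "'a \<times> 'a \<Rightarrow> 'c::{banach,second_countable_topology}"
    using Pc_integrable[OF \<mu> that] .
  define a where "a = (\<integral>x. norm (\<sigma> x *\<^sub>R x - w) \<partial>\<mu>)"
  define D where "D = (\<integral>x. (norm (\<sigma> x *\<^sub>R x - w))\<^sup>2 \<partial>\<mu>)"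
  \<comment> \<open>The difference of the two sides is the variance of the distance.\<close>
  have aD: "a\<^sup>2 \<le> D"
  proof -
    have "0 \<le> (\<integral>x. (norm (\<sigma> x *\<^sub>R x - w) - a)\<^sup>2 \<partial>\<mu>)" by simp
    also have "\<dots> = (\<integral>x. (norm (\<sigma> x *\<^sub>R x - w))\<^sup>2 - 2 * a * norm (\<sigma> x *\<^sub>R x - w) + a\<^sup>2 \<partial>\<mu>)"
      by (simp add: power2_diff algebra_simps)
    also have "\<dots> = D - 2 * a * a + a\<^sup>2"
      unfolding D_def a_def
      by (subst Bochner_Integration.integral_add, (intro int continuous_intros \<sigma>)+,
          subst Bochner_Integration.integral_diff, (intro int continuous_intros \<sigma>)+) (simp add: prob_space)
    finally show ?thesis by (simp add: power2_eq_square)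
  qed
  have force: "norm (\<sigma> x *\<^sub>R drift \<mu> x - field w) \<le> (1 + L) * norm (\<sigma> x *\<^sub>R x - w) + L * a"
    if x: "\<sigma> x = 1 \<or> \<sigma> x = -1" "norm x \<le> R" for x
  proof -
    have nx: "norm (\<sigma> x *\<^sub>R x) \<le> R" using x by auto
    have "(\<integral>x'. \<sigma> x *\<^sub>R kernel x x' - kernel w ((\<sigma> x * \<sigma> x') *\<^sub>R w) \<partial>\<mu>)
        = \<sigma> x *\<^sub>R (\<integral>x'. kernel x x' \<partial>\<mu>) - (\<integral>x'. kernel w ((\<sigma> x * \<sigma> x') *\<^sub>R w) \<partial>\<mu>)"
      by (subst Bochner_Integration.integral_diff) (auto intro!: int continuous_intros \<sigma>)
    \<comment> \<open>Pairs in the same cluster contribute \<open>kernel w w = 0\<close>, pairs in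
      opposite clusters \<open>kernel w (- w)\<close>. The product of the signs selects the case,
      and the balance \<open>bal\<close> makes the average weight one half.\<close>
    also have "(\<integral>x'. kernel w ((\<sigma> x * \<sigma> x') *\<^sub>R w) \<partial>\<mu>)
        = (\<integral>x'. (1/2 - \<sigma> x' * (\<sigma> x / 2)) *\<^sub>R kernel w (- w) \<partial>\<mu>)"
    proof (rule integral_cong_AE)
      show "AE x' in \<mu>. kernel w ((\<sigma> x * \<sigma> x') *\<^sub>R w) = (1/2 - \<sigma> x' * (\<sigma> x / 2)) *\<^sub>R kernel w (- w)"
        using AE by eventually_elim (use x(1) in \<open>auto simp: kernel_self\<close>)
    qed (auto intro!: borel_measurable_integrable int continuous_intros \<sigma>)
    also have "\<dots> = (\<integral>x'. 1/2 - \<sigma> x' * (\<sigma> x / 2) \<partial>\<mu>) *\<^sub>R kernel w (- w)"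
      by (rule Bochner_Integration.integral_scaleR_left) (intro int continuous_intros \<sigma>)
    also have "(\<integral>x'. 1/2 - \<sigma> x' * (\<sigma> x / 2) \<partial>\<mu>) = 1/2"
      by (subst Bochner_Integration.integral_diff) (auto intro!: int continuous_intros \<sigma> simp: bal prob_space)
    finally have eq: "\<sigma> x *\<^sub>R (\<integral>x'. kernel x x' \<partial>\<mu>) - (1/2) *\<^sub>R kernel w (- w)
        = (\<integral>x'. \<sigma> x *\<^sub>R kernel x x' - kernel w ((\<sigma> x * \<sigma> x') *\<^sub>R w) \<partial>\<mu>)" by simp
    have "norm (\<integral>x'. \<sigma> x *\<^sub>R kernel x x' - kernel w ((\<sigma> x * \<sigma> x') *\<^sub>R w) \<partial>\<mu>)
        \<le> (\<integral>x'. norm (\<sigma> x *\<^sub>R kernel x x' - kernel w ((\<sigma> x * \<sigma> x') *\<^sub>R w)) \<partial>\<mu>)"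
      by (rule integral_norm_bound)
    also have "\<dots> \<le> (\<integral>x'. L * norm (\<sigma> x *\<^sub>R x - w) + L * norm (\<sigma> x' *\<^sub>R x' - w) \<partial>\<mu>)"
    proof (rule integral_mono_AE)
      show "AE x' in \<mu>. norm (\<sigma> x *\<^sub>R kernel x x' - kernel w ((\<sigma> x * \<sigma> x') *\<^sub>R w))
          \<le> L * norm (\<sigma> x *\<^sub>R x - w) + L * norm (\<sigma> x' *\<^sub>R x' - w)"
        using AE
      proof eventually_elim
        case (elim x')
        have s: "\<sigma> x' * \<sigma> x' = 1" "\<bar>\<sigma> x * \<sigma> x'\<bar> = 1" using elim x(1) by auto
        \<comment> \<open>Reflecting \<open>x'\<close> by \<open>\<sigma> x\<close> instead of
          \<open>\<sigma> x'\<close> changes the comparison point to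
          \<open>(\<sigma> x * \<sigma> x') *\<^sub>R w\<close> but not the distance to it.\<close>
        have "\<sigma> x *\<^sub>R x' - (\<sigma> x * \<sigma> x') *\<^sub>R w = (\<sigma> x * \<sigma> x') *\<^sub>R (\<sigma> x' *\<^sub>R x' - w)"
          using s(1) by (simp add: scaleR_diff_right mult.assoc)
        then have n: "norm (\<sigma> x *\<^sub>R x' - (\<sigma> x * \<sigma> x') *\<^sub>R w) = norm (\<sigma> x' *\<^sub>R x' - w)"
          using s(2) by simp
        have "norm (kernel (\<sigma> x *\<^sub>R x) (\<sigma> x *\<^sub>R x') - kernel w ((\<sigma> x * \<sigma> x') *\<^sub>R w))
            \<le> L * (norm (\<sigma> x *\<^sub>R x - w) + norm (\<sigma> x *\<^sub>R x' - (\<sigma> x * \<sigma> x') *\<^sub>R w))"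
          by (rule L(2)) (use nx w elim x(1) s(2) in auto)
        then show ?case unfolding kernel_sign[OF x(1)] n by (simp add: distrib_left)
      qed
    qed (auto intro!: int continuous_intros \<sigma>)
    also have "\<dots> = L * norm (\<sigma> x *\<^sub>R x - w) + L * a"
      unfolding a_def by (subst Bochner_Integration.integral_add) (auto intro!: int continuous_intros \<sigma> simp: prob_space)
    finally have K: "norm (\<sigma> x *\<^sub>R (\<integral>x'. kernel x x' \<partial>\<mu>) - (1/2) *\<^sub>R kernel w (- w)) \<le> L * norm (\<sigma> x *\<^sub>R x - w) + L * a"
      unfolding eq .
    have "\<sigma> x *\<^sub>R drift \<mu> x - field w = (snd (\<sigma> x *\<^sub>R x - w), - (\<sigma> x *\<^sub>R (\<integral>x'. kernel x x' \<partial>\<mu>) - (1/2) *\<^sub>R kernel w (- w)))"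
      by (simp add: drift_def field_def)
    also have "norm \<dots> \<le> norm (snd (\<sigma> x *\<^sub>R x - w)) + norm (\<sigma> x *\<^sub>R (\<integral>x'. kernel x x' \<partial>\<mu>) - (1/2) *\<^sub>R kernel w (- w))"
      using norm_Pair_le[of "snd (\<sigma> x *\<^sub>R x - w)" "- (\<sigma> x *\<^sub>R (\<integral>x'. kernel x x' \<partial>\<mu>) - (1/2) *\<^sub>R kernel w (- w))"]
      unfolding norm_minus_cancel .
    also have "\<dots> \<le> norm (\<sigma> x *\<^sub>R x - w) + (L * norm (\<sigma> x *\<^sub>R x - w) + L * a)"
      by (intro add_mono norm_fst_snd_le K)
    finally show ?thesis by (simp add: algebra_simps)
  qed
  \<comment> \<open>Twice \<open>n * ((1 + L) * n + L * a)\<close>, with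
    \<open>2 * n * a \<le> n\<^sup>2 + a\<^sup>2\<close>, gives the factor \<open>2 + 3 * L\<close>;
    the remaining \<open>L * a\<^sup>2\<close> is absorbed through \<open>aD\<close> and raises it
    to \<open>2 + 4 * L\<close>.\<close>
  have "(\<integral>x. 2 * ((\<sigma> x *\<^sub>R x - w) \<bullet> (\<sigma> x *\<^sub>R drift \<mu> x - field w)) \<partial>\<mu>)
      \<le> (\<integral>x. (2 + 3 * L) * (norm (\<sigma> x *\<^sub>R x - w))\<^sup>2 + L * a\<^sup>2 \<partial>\<mu>)"
  proof (rule integral_mono_AE)
    show "AE x in \<mu>. 2 * ((\<sigma> x *\<^sub>R x - w) \<bullet> (\<sigma> x *\<^sub>R drift \<mu> x - field w))
        \<le> (2 + 3 * L) * (norm (\<sigma> x *\<^sub>R x - w))\<^sup>2 + L * a\<^sup>2"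
      using AE
    proof eventually_elim
      case (elim x)
      define n where "n = norm (\<sigma> x *\<^sub>R x - w)"
      have "(\<sigma> x *\<^sub>R x - w) \<bullet> (\<sigma> x *\<^sub>R drift \<mu> x - field w) \<le> n * ((1 + L) * n + L * a)"
        using force[of x] elim
        by (intro order_trans[OF norm_cauchy_schwarz] mult_mono) (auto simp: n_def)
      moreover have "L * (2 * n * a) \<le> L * (n\<^sup>2 + a\<^sup>2)"
        using sum_squares_bound[of n a] L(1) by (intro mult_left_mono) auto
      ultimately show ?case by (simp add: n_def[symmetric] power2_eq_square algebra_simps)
    qed
  qed (auto intro!: int continuous_intros \<sigma> dc)
  also have "\<dots> = (2 + 3 * L) * D + L * a\<^sup>2"
    unfolding D_def by (subst Bochner_Integration.integral_add) (auto intro!: int continuous_intros \<sigma> simp: prob_space)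
  also have "\<dots> \<le> (2 + 4 * L) * D"
    using mult_left_mono[OF aD L(1)] by (simp add: algebra_simps)
  finally show ?thesis by (simp add: D_def)
qed


lemma trajectory_continuous:
  assumes "is_trajectory z"
  shows "continuous_on {0..} z"
  unfolding continuous_on_eq_continuous_within
  using assms by (auto simp: is_trajectory_def intro: has_vector_derivative_continuous)

text \<open>Up to \<open>S\<close> the mass of \<open>g s\<close> stays in two disjoint balls around
  \<open>c\<close> and \<open>- c\<close>. There the conserved difference of their masses gives
  \<open>bal\<close>, and the mean squared distance \<open>D\<close> obeys a linear differential
  inequality with initial value 0.\<close>

lemma local_uniqueness:
  assumes z: "is_trajectory z" and sol: "mean_field_solution V \<psi> (two_atoms (z 0)) g"
    and T: "T \<ge> 0" and gT: "g T = two_atoms (z T)" and nz: "z T \<noteq> 0"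
  obtains S where "S > T" "\<And>s. s \<in> {T..S} \<Longrightarrow> g s = two_atoms (z s)"
proof -
  have g: "continuous_curve_Pc g" using sol by (simp add: mean_field_solution_def)
  define c where "c = z T"
  \<comment> \<open>Half the distance from \<open>c\<close> to the origin: the balls are disjoint,
    and on them \<open>x \<bullet> c\<close> has modulus at least half of
    \<open>(norm c)\<^sup>2\<close>.\<close>
  define \<rho> where "\<rho> = norm c / 2"
  have c: "c \<noteq> 0" and \<rho>: "\<rho> > 0" using nz by (simp_all add: c_def \<rho>_def)
  have "((\<lambda>s. W_inf (g s) (g T)) \<longlongrightarrow> 0) (at T within {0..})"
    using g T by (auto simp: continuous_curve_Pc_def)
  then have "\<forall>\<^sub>F s in at T within {0..}. W_inf (g s) (g T) < ennreal \<rho>"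
    using \<rho> by (intro order_tendstoD(2)) auto
  then obtain \<eta>1 where \<eta>1: "\<eta>1 > 0"
    "\<And>s. s \<ge> 0 \<Longrightarrow> s \<noteq> T \<Longrightarrow> dist s T < \<eta>1 \<Longrightarrow> W_inf (g s) (g T) < ennreal \<rho>"
    unfolding eventually_at by auto
  obtain \<eta>2 where \<eta>2: "\<eta>2 > 0" "\<And>s. s \<ge> 0 \<Longrightarrow> dist s T < \<eta>2 \<Longrightarrow> dist (z s) (z T) < \<rho>"
    using trajectory_continuous[OF z] T \<rho> unfolding continuous_on_iff by (metis atLeast_iff)
  define S where "S = T + min \<eta>1 \<eta>2 / 2"
  have S: "S > T" using \<eta>1 \<eta>2 by (simp add: S_def)
  have s0: "s \<ge> 0" "dist s T < \<eta>1" "dist s T < \<eta>2" if "s \<in> {T..S}" for s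
    using that T \<eta>1 \<eta>2 by (auto simp: S_def dist_real_def)
  define B where "B = ball c \<rho> \<union> ball (- c) \<rho>"
  have AEB: "AE x in g s. x \<in> B" if s: "s \<in> {T..S}" for s
  proof (cases "s = T")
    case True
    show ?thesis unfolding True gT c_def[symmetric]
      using AE_two_atoms[of c] by eventually_elim (use \<rho> in \<open>auto simp: B_def\<close>)
  next
    case False
    then have "W_inf (g s) (g T) < ennreal \<rho>" using \<eta>1(2) s0[OF s] by simp
    then obtain \<pi> where \<pi>: "\<pi> \<in> couplings (g s) (g T)" "AE p in \<pi>. dist (fst p) (snd p) < \<rho>"
      by (rule W_inf_lessE)
    have "AE p in g T. p \<in> {c, - c}" unfolding gT c_def[symmetric] by (rule AE_two_atoms)
    then have "AE p in \<pi>. snd p \<in> {c, - c}" by (rule couplings_AE(2)[OF \<pi>(1)]) simp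
    with \<pi>(2) have "AE p in \<pi>. fst p \<in> B"
      by eventually_elim (auto simp: B_def dist_commute)
    then show ?thesis by (rule couplings_AE(3)[OF \<pi>(1)]) (simp add: B_def)
  qed
  \<comment> \<open>The transition of \<open>\<sigma>\<close> is placed in the strip where
    \<open>x \<bullet> c\<close> lies between \<open>- q\<close> and \<open>q\<close>, which the
    balls do not meet.\<close>
  define q where "q = (norm c)\<^sup>2 / 4"
  have q: "- q < q" using c by (simp add: q_def)
  define \<sigma> where "\<sigma> x = 1 - 2 * cutoff (- q) q (x \<bullet> c)" for x
  have \<sigma>s: "\<sigma> \<in> smooth" unfolding \<sigma>_def by (intro smooth_diff smooth.mult smooth.const smooth_cutoff smooth.inner)
  have inner_c: "\<bar>(x - y) \<bullet> c\<bar> \<le> (norm c)\<^sup>2 / 2" if "dist y x < \<rho>" for x y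
  proof -
    have "\<bar>(x - y) \<bullet> c\<bar> \<le> norm (x - y) * norm c" by (rule Cauchy_Schwarz_ineq2)
    also have "\<dots> \<le> \<rho> * norm c" using that by (intro mult_right_mono) (auto simp: dist_norm norm_minus_commute)
    finally show ?thesis by (simp add: \<rho>_def power2_eq_square)
  qed
  have cc: "c \<bullet> c = (norm c)\<^sup>2" "(norm c)\<^sup>2 > 0" using c by (simp_all add: power2_norm_eq_inner)
  have \<sigma>p: "\<sigma> x = 1" if "x \<in> ball c \<rho>" for x
  proof -
    have "\<bar>x \<bullet> c - (norm c)\<^sup>2\<bar> \<le> (norm c)\<^sup>2 / 2"
      using inner_c[of c x] that cc(1) by (simp add: inner_diff_left)
    then have "x \<bullet> c \<ge> q" using cc(2) unfolding q_def by linarith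
    then show ?thesis using cutoff_eq_0[OF q] by (simp add: \<sigma>_def)
  qed
  have \<sigma>m: "\<sigma> x = -1" if "x \<in> ball (- c) \<rho>" for x
  proof -
    have "\<bar>x \<bullet> c + (norm c)\<^sup>2\<bar> \<le> (norm c)\<^sup>2 / 2"
      using inner_c[of "- c" x] that cc(1) by (simp add: inner_add_left)
    then have "x \<bullet> c \<le> - q" using cc(2) unfolding q_def by linarith
    then show ?thesis using cutoff_eq_1[OF q] by (simp add: \<sigma>_def)
  qed
  have \<sigma>B: "\<sigma> x = 1 \<or> \<sigma> x = -1" if "x \<in> B" for x using that \<sigma>p[of x] \<sigma>m[of x] unfolding B_def by blast
  define R where "R = 2 * norm c"
  have BR: "norm x \<le> R" if "x \<in> B" for x
  proof -
    have "norm x \<le> norm c + \<rho>"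
      using that norm_triangle_ineq2[of x c] norm_triangle_ineq2[of x "- c"]
      by (auto simp: B_def dist_norm norm_minus_commute)
    then show ?thesis using norm_ge_zero[of c] unfolding R_def \<rho>_def by linarith
  qed
  have zR: "norm (z s) \<le> R" if "s \<in> {T..S}" for s
  proof (rule BR)
    show "z s \<in> B" using \<eta>2(2)[OF s0(1)[OF that] s0(3)[OF that]] unfolding B_def c_def
      by (simp add: dist_commute[of "z T"])
  qed
  obtain \<kappa> :: "'a \<times> 'a \<Rightarrow> real" where \<kappa>: "\<kappa> \<in> smooth" "\<And>x. norm x \<le> R \<Longrightarrow> \<kappa> x = 1" "bounded {x. \<kappa> x \<noteq> 0}"
    using ball_cutoff by blast
  have \<sigma>c: "continuous_on X \<sigma>" for X using smooth_continuous_on[OF \<sigma>s] .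
  \<comment> \<open>Cut off versions of the sign, the squared norm and the reflected coordinates:
    the fixed functions whose integrals determine the mass balance and \<open>D\<close>.\<close>
  define \<phi>0 where "\<phi>0 x = \<kappa> x * \<sigma> x" for x
  define \<phi>1 where "\<phi>1 x = \<kappa> x * (norm (x - 0))\<^sup>2" for x
  define \<phi> where "\<phi> b x = \<kappa> x * (\<sigma> x * (x \<bullet> b))" for b x
  have \<phi>s: "\<phi>0 \<in> smooth" "\<phi>1 \<in> smooth" "\<phi> b \<in> smooth" for b
    unfolding \<phi>0_def \<phi>1_def \<phi>_def by (intro smooth.mult \<kappa>(1) \<sigma>s smooth_norm_sq smooth.inner)+
  have \<phi>bd: "bounded {x. \<phi>0 x \<noteq> 0}" "bounded {x. \<phi>1 x \<noteq> 0}" "bounded {x. \<phi> b x \<noteq> 0}" for b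
    unfolding \<phi>0_def \<phi>1_def \<phi>_def by (rule bounded_support_mult[OF \<kappa>(3)])+
  have \<phi>c: "continuous_on X \<phi>0" "continuous_on X \<phi>1" "continuous_on X (\<phi> b)" for b X
    by (rule smooth_continuous_on[OF \<phi>s(1)] smooth_continuous_on[OF \<phi>s(2)] smooth_continuous_on[OF \<phi>s(3)])+
  \<comment> \<open>On each ball \<open>\<sigma>\<close> is constant, so near \<open>x\<close> the
    test function is the explicit function \<open>p0\<close> with that value of the sign
    inserted.\<close>
  have local: "(p has_derivative p') (at x)"
    if x: "x \<in> B" and d: "(p0 has_derivative p') (at x)" and eq: "\<And>y. y \<in> B \<Longrightarrow> \<sigma> y = \<sigma> x \<Longrightarrow> p0 y = p y"
    for x p0 p p'
  proof (cases "x \<in> ball c \<rho>")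
    case True
    show ?thesis
    proof (rule has_derivative_transform_within_open[OF d _ True])
      show "p0 y = p y" if "y \<in> ball c \<rho>" for y
        by (rule eq) (simp add: B_def that[unfolded mem_ball], simp only: \<sigma>p[OF that] \<sigma>p[OF True])
    qed simp
  next
    case False
    then have x': "x \<in> ball (- c) \<rho>" using x by (simp add: B_def)
    show ?thesis
    proof (rule has_derivative_transform_within_open[OF d _ x'])
      show "p0 y = p y" if "y \<in> ball (- c) \<rho>" for y
        by (rule eq) (simp add: B_def that[unfolded mem_ball], simp only: \<sigma>m[OF that] \<sigma>m[OF x'])
    qed simp
  qed
  have d0: "(\<phi>0 has_derivative (\<lambda>h. 0 \<bullet> h)) (at x)" if "x \<in> B" for x
    by (rule local[OF that, of "\<lambda>_. \<sigma> x"]) (auto simp: \<phi>0_def \<kappa>(2) BR)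
  have d1: "(\<phi>1 has_derivative (\<lambda>h. (2 *\<^sub>R x) \<bullet> h)) (at x)" if "x \<in> B" for x
    by (rule local[OF that, of "\<lambda>x. x \<bullet> x"])
      (auto simp: \<phi>1_def \<kappa>(2) BR power2_norm_eq_inner inner_commute intro!: derivative_eq_intros)
  have d2: "(\<phi> b has_derivative (\<lambda>h. (\<sigma> x *\<^sub>R b) \<bullet> h)) (at x)" if "x \<in> B" for x b
    by (rule local[OF that, of "\<lambda>y. \<sigma> x * (y \<bullet> b)"])
      (auto simp: \<phi>_def \<kappa>(2) BR inner_commute intro!: derivative_eq_intros)
  note ev = evolution_derivative[OF sol mean_velocity_two_atoms _ _ _ _ AEB T]
  have gP: "g s \<in> Pc" if "s \<in> {T..S}" for s using g s0[OF that] by (simp add: continuous_curve_Pc_def)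
  have int: "integrable (g s) p" if "s \<in> {T..S}" "continuous_on UNIV p" for s and p :: "'a \<times> 'a \<Rightarrow> real"
    using Pc_integrable[OF gP] that by blast
  \<comment> \<open>The integral of the sign has derivative 0, since the gradient of
    \<open>\<phi>0\<close> vanishes on \<open>B\<close>; at time \<open>T\<close> the two atoms
    balance.\<close>
  have bal: "(\<integral>x. \<sigma> x \<partial>g s) = 0" if s: "s \<in> {T..S}" for s
  proof -
    have "((\<lambda>t. \<integral>x. \<phi>0 x \<partial>g t) has_real_derivative 0) (at t within {T..S})" if "t \<in> {T..S}" for t
      using ev[OF \<phi>s(1) \<phi>bd(1) d0 continuous_on_const _ that] by simp
    then obtain k where k: "\<And>t. t \<in> {T..S} \<Longrightarrow> (\<integral>x. \<phi>0 x \<partial>g t) = k"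
      using has_field_derivative_zero_constant[of "{T..S}" "\<lambda>t. \<integral>x. \<phi>0 x \<partial>g t"] by auto
    have "(\<integral>x. \<sigma> x \<partial>g s) = (\<integral>x. \<phi>0 x \<partial>g s)"
    proof (rule integral_cong_AE)
      show "AE x in g s. \<sigma> x = \<phi>0 x" using AEB[OF s] by eventually_elim (simp add: \<phi>0_def \<kappa>(2) BR)
    qed (auto intro!: borel_measurable_integrable int[OF s] \<sigma>c \<phi>c)
    also have "\<dots> = (\<integral>x. \<phi>0 x \<partial>g T)" using k[OF s] k[of T] S by simp
    also have "\<dots> = (1/2) * (\<phi>0 c + \<phi>0 (- c))"
      unfolding gT c_def[symmetric] by (subst integral_two_atoms) (auto intro!: borel_measurable_continuous_onI \<phi>c)
    also have "\<dots> = 0" using \<rho> \<sigma>p[of c] \<sigma>m[of "- c"] by (simp add: \<phi>0_def \<kappa>(2) R_def)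
    finally show ?thesis .
  qed
  define D where "D s = (\<integral>x. (norm (\<sigma> x *\<^sub>R x - z s))\<^sup>2 \<partial>g s)" for s
  define D' where "D' s = (\<integral>x. 2 * ((\<sigma> x *\<^sub>R x - z s) \<bullet> (\<sigma> x *\<^sub>R drift (g s) x - field (z s))) \<partial>g s)" for s
  have dc: "continuous_on UNIV (drift (g s))" if "s \<in> {T..S}" for s
    using continuous_on_drift_at[OF g] s0[OF that] by blast
  \<comment> \<open>As the square of the sign is 1, it drops out of the quadratic term, and the
    mixed term separates into coordinates of \<open>z s\<close> times integrals of fixed test
    functions.\<close>
  have D_eq: "D s = (\<integral>x. \<phi>1 x \<partial>g s) + (\<Sum>b\<in>Basis. (z s \<bullet> b)\<^sup>2 - 2 * ((z s \<bullet> b) * (\<integral>x. \<phi> b x \<partial>g s)))"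
    if s: "s \<in> {T..S}" for s
  proof -
    interpret prob_space "g s" using gP[OF s] by (auto simp: Pc_def borel_probD)
    have each: "(\<integral>x. (z s \<bullet> b)\<^sup>2 - 2 * ((z s \<bullet> b) * \<phi> b x) \<partial>g s) = (z s \<bullet> b)\<^sup>2 - 2 * ((z s \<bullet> b) * (\<integral>x. \<phi> b x \<partial>g s))" for b
      by (subst Bochner_Integration.integral_diff) (auto intro!: int[OF s] continuous_intros \<phi>c simp: prob_space)
    have "D s = (\<integral>x. \<phi>1 x + (\<Sum>b\<in>Basis. (z s \<bullet> b)\<^sup>2 - 2 * ((z s \<bullet> b) * \<phi> b x)) \<partial>g s)"
      unfolding D_def
    proof (rule integral_cong_AE)
      show "AE x in g s. (norm (\<sigma> x *\<^sub>R x - z s))\<^sup>2 = \<phi>1 x + (\<Sum>b\<in>Basis. (z s \<bullet> b)\<^sup>2 - 2 * ((z s \<bullet> b) * \<phi> b x))"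
        using AEB[OF s]
      proof eventually_elim
        case (elim x)
        have \<sigma>2: "\<sigma> x * (\<sigma> x * y) = y" for y using \<sigma>B[OF elim] by auto
        have "(norm (\<sigma> x *\<^sub>R x - z s))\<^sup>2 = x \<bullet> x + (z s \<bullet> z s - 2 * (\<sigma> x * (z s \<bullet> x)))"
          by (simp add: power2_norm_eq_inner inner_diff_left inner_diff_right right_diff_distrib \<sigma>2 inner_commute[of x "z s"])
        also have "z s \<bullet> z s - 2 * (\<sigma> x * (z s \<bullet> x)) = (\<Sum>b\<in>Basis. (z s \<bullet> b)\<^sup>2 - 2 * ((z s \<bullet> b) * (\<sigma> x * (x \<bullet> b))))"
          unfolding euclidean_inner[of "z s" "z s"] euclidean_inner[of "z s" x]
          by (simp add: sum_subtractf sum_distrib_left power2_eq_square mult.left_commute)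
        finally show ?case using elim by (simp add: \<phi>1_def \<phi>_def \<kappa>(2) BR power2_norm_eq_inner)
      qed
    qed (auto intro!: borel_measurable_integrable int[OF s] continuous_intros \<sigma>c \<phi>c)
    also have "\<dots> = (\<integral>x. \<phi>1 x \<partial>g s) + (\<Sum>b\<in>Basis. \<integral>x. (z s \<bullet> b)\<^sup>2 - 2 * ((z s \<bullet> b) * \<phi> b x) \<partial>g s)"
      by (subst Bochner_Integration.integral_add, (intro int[OF s] continuous_intros \<phi>c)+,
          subst Bochner_Integration.integral_sum, (intro int[OF s] continuous_intros \<phi>c)+, simp)
    finally show ?thesis unfolding each .
  qed
  have D_der: "(D has_real_derivative D' s) (at s within {T..S})" if s: "s \<in> {T..S}" for s
  proof -
    interpret prob_space "g s" using gP[OF s] by (auto simp: Pc_def borel_probD)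
    let ?k1 = "\<integral>x. (2 *\<^sub>R x) \<bullet> drift (g s) x \<partial>g s"
    let ?k = "\<lambda>b. \<integral>x. (\<sigma> x *\<^sub>R b) \<bullet> drift (g s) x \<partial>g s"
    have zb: "((\<lambda>t. z t \<bullet> b) has_real_derivative field (z s) \<bullet> b) (at s within {T..S})" for b
    proof -
      have "(z has_vector_derivative field (z s)) (at s within {0..})"
        using z s0[OF s] by (simp add: is_trajectory_def)
      then have "(z has_vector_derivative field (z s)) (at s within {T..S})"
        by (rule has_vector_derivative_within_subset) (use T in auto)
      from bounded_linear.has_vector_derivative[OF bounded_linear_inner_left this, of b]
      show ?thesis by (simp add: has_real_derivative_iff_has_vector_derivative)
    qed
    have "((\<lambda>s. (\<integral>x. \<phi>1 x \<partial>g s) + (\<Sum>b\<in>Basis. (z s \<bullet> b)\<^sup>2 - 2 * ((z s \<bullet> b) * (\<integral>x. \<phi> b x \<partial>g s)))) has_real_derivative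
        ?k1 + (\<Sum>b\<in>Basis. 2 * (z s \<bullet> b) * (field (z s) \<bullet> b)
          - 2 * ((z s \<bullet> b) * ?k b + (field (z s) \<bullet> b) * (\<integral>x. \<phi> b x \<partial>g s)))) (at s within {T..S})"
    proof (intro DERIV_add DERIV_sum DERIV_diff DERIV_cmult)
      show "((\<lambda>s. \<integral>x. \<phi>1 x \<partial>g s) has_real_derivative ?k1) (at s within {T..S})"
        by (rule ev[OF \<phi>s(2) \<phi>bd(2) d1 _ _ s]) (auto intro!: continuous_intros)
      fix b :: "'a \<times> 'a"
      have "((\<lambda>s. \<integral>x. \<phi> b x \<partial>g s) has_real_derivative ?k b) (at s within {T..S})"
        by (rule ev[OF \<phi>s(3) \<phi>bd(3) d2 _ _ s]) (auto intro!: continuous_intros \<sigma>c)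
      then show "((\<lambda>s. (z s \<bullet> b) * (\<integral>x. \<phi> b x \<partial>g s)) has_real_derivative
          (z s \<bullet> b) * ?k b + (field (z s) \<bullet> b) * (\<integral>x. \<phi> b x \<partial>g s)) (at s within {T..S})"
        by (auto intro!: derivative_eq_intros zb)
      show "((\<lambda>s. (z s \<bullet> b)\<^sup>2) has_real_derivative 2 * (z s \<bullet> b) * (field (z s) \<bullet> b)) (at s within {T..S})"
        by (auto intro!: derivative_eq_intros zb)
    qed
    then have "(D has_real_derivative
        ?k1 + (\<Sum>b\<in>Basis. 2 * (z s \<bullet> b) * (field (z s) \<bullet> b)
          - 2 * ((z s \<bullet> b) * ?k b + (field (z s) \<bullet> b) * (\<integral>x. \<phi> b x \<partial>g s)))) (at s within {T..S})"
      by (rule has_field_derivative_transform_within[OF _ zero_less_one s]) (simp add: D_eq)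
    moreover have "D' s = ?k1 + (\<Sum>b\<in>Basis. 2 * (z s \<bullet> b) * (field (z s) \<bullet> b)
          - 2 * ((z s \<bullet> b) * ?k b + (field (z s) \<bullet> b) * (\<integral>x. \<phi> b x \<partial>g s)))"
    proof -
      let ?t = "\<lambda>b x. 2 * (z s \<bullet> b) * (field (z s) \<bullet> b)
          - 2 * ((z s \<bullet> b) * ((\<sigma> x *\<^sub>R b) \<bullet> drift (g s) x) + (field (z s) \<bullet> b) * \<phi> b x)"
      note ci = continuous_intros \<phi>c \<sigma>c dc[OF s]
      have each: "(\<integral>x. ?t b x \<partial>g s) = 2 * (z s \<bullet> b) * (field (z s) \<bullet> b)
          - 2 * ((z s \<bullet> b) * ?k b + (field (z s) \<bullet> b) * (\<integral>x. \<phi> b x \<partial>g s))" for b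
      proof -
        have add: "(\<integral>x. (z s \<bullet> b) * ((\<sigma> x *\<^sub>R b) \<bullet> drift (g s) x) + (field (z s) \<bullet> b) * \<phi> b x \<partial>g s)
            = (\<integral>x. (z s \<bullet> b) * ((\<sigma> x *\<^sub>R b) \<bullet> drift (g s) x) \<partial>g s) + (\<integral>x. (field (z s) \<bullet> b) * \<phi> b x \<partial>g s)"
          by (rule Bochner_Integration.integral_add) (intro int[OF s] ci)+
        have "(\<integral>x. ?t b x \<partial>g s) = (\<integral>x. 2 * (z s \<bullet> b) * (field (z s) \<bullet> b) \<partial>g s)
            - (\<integral>x. 2 * ((z s \<bullet> b) * ((\<sigma> x *\<^sub>R b) \<bullet> drift (g s) x) + (field (z s) \<bullet> b) * \<phi> b x) \<partial>g s)"
          by (rule Bochner_Integration.integral_diff) (intro int[OF s] ci)+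
        also have "(\<integral>x. 2 * ((z s \<bullet> b) * ((\<sigma> x *\<^sub>R b) \<bullet> drift (g s) x) + (field (z s) \<bullet> b) * \<phi> b x) \<partial>g s)
            = 2 * ((z s \<bullet> b) * ?k b + (field (z s) \<bullet> b) * (\<integral>x. \<phi> b x \<partial>g s))"
          by (simp only: Bochner_Integration.integral_mult_right_zero add)
        finally show ?thesis by (simp add: prob_space)
      qed
      have "D' s = (\<integral>x. (2 *\<^sub>R x) \<bullet> drift (g s) x + (\<Sum>b\<in>Basis. ?t b x) \<partial>g s)"
        unfolding D'_def
      proof (rule integral_cong_AE)
        show "AE x in g s. 2 * ((\<sigma> x *\<^sub>R x - z s) \<bullet> (\<sigma> x *\<^sub>R drift (g s) x - field (z s)))
            = (2 *\<^sub>R x) \<bullet> drift (g s) x + (\<Sum>b\<in>Basis. ?t b x)"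
          using AEB[OF s]
        proof eventually_elim
          case (elim x)
          have \<sigma>2: "\<sigma> x * (\<sigma> x * y) = y" for y using \<sigma>B[OF elim] by auto
          have "(\<Sum>b\<in>Basis. ?t b x) = 2 * (z s \<bullet> field (z s)) - 2 * (\<sigma> x * (z s \<bullet> drift (g s) x)) - 2 * (\<sigma> x * (field (z s) \<bullet> x))"
            unfolding euclidean_inner[of "z s" "field (z s)"] euclidean_inner[of "z s" "drift (g s) x"]
              euclidean_inner[of "field (z s)" x]
            using elim
            by (simp add: \<phi>_def \<kappa>(2) BR sum_subtractf sum.distrib sum_distrib_left inner_commute[of _ "drift (g s) x"]
                mult.assoc mult.left_commute distrib_left)
          then show ?case
            by (simp add: inner_diff_left inner_diff_right \<sigma>2 inner_commute[of x "field (z s)"] right_diff_distrib)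
        qed
      qed (auto intro!: borel_measurable_integrable int[OF s] ci)
      also have "\<dots> = ?k1 + (\<Sum>b\<in>Basis. \<integral>x. ?t b x \<partial>g s)"
        by (subst Bochner_Integration.integral_add, (intro int[OF s] ci)+,
            subst Bochner_Integration.integral_sum, (intro int[OF s] ci)+, simp)
      finally show ?thesis unfolding each .
    qed
    ultimately show ?thesis by simp
  qed
  obtain L where L: "L \<ge> 0"
    "\<And>z z' w w'. norm z \<le> R \<Longrightarrow> norm z' \<le> R \<Longrightarrow> norm w \<le> R \<Longrightarrow> norm w' \<le> R \<Longrightarrow>
      norm (kernel z z' - kernel w w') \<le> L * (norm (z - w) + norm (z' - w'))"
    using kernel_lipschitz by blast
  have D_le: "D' s \<le> (2 + 4 * L) * D s" if s: "s \<in> {T..S}" for s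
    unfolding D'_def D_def
    by (rule reflected_drift_bound[OF gP[OF s] dc[OF s] \<sigma>c _ zR[OF s] bal[OF s] L])
      (use AEB[OF s] \<sigma>B BR in \<open>auto elim!: eventually_mono\<close>)
  have "D T = (1/2) *\<^sub>R ((norm (\<sigma> c *\<^sub>R c - c))\<^sup>2 + (norm (\<sigma> (- c) *\<^sub>R - c - c))\<^sup>2)"
    unfolding D_def gT c_def[symmetric]
    by (rule integral_two_atoms) (auto intro!: borel_measurable_continuous_onI continuous_intros \<sigma>c)
  then have DT: "D T \<le> 0" using \<rho> \<sigma>p[of c] \<sigma>m[of "- c"] by simp
  have "g s = two_atoms (z s)" if s: "s \<in> {T..S}" for s
  proof -
    have "D s \<le> 0" by (rule gronwall_zero[OF D_der D_le DT s])
    then have "D s = 0" unfolding D_def by (intro antisym) auto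
    then have "AE x in g s. (norm (\<sigma> x *\<^sub>R x - z s))\<^sup>2 = 0"
      unfolding D_def by (subst (asm) integral_nonneg_eq_0_iff_AE) (auto intro!: int[OF s] continuous_intros \<sigma>c)
    then have AE: "AE x in g s. x = \<sigma> x *\<^sub>R z s \<and> (\<sigma> x = 1 \<or> \<sigma> x = -1)"
      using AEB[OF s]
    proof eventually_elim
      case (elim x)
      then have "z s = \<sigma> x *\<^sub>R x" by simp
      then show ?case using \<sigma>B[OF elim(2)] by auto
    qed
    \<comment> \<open>On the support \<open>x\<close> is \<open>\<sigma> x *\<^sub>R z s\<close>, so
      the first moment along \<open>z s\<close> is a multiple of the balance; this gives the two
      atoms equal mass.\<close>
    have "(\<integral>x. x \<bullet> z s \<partial>g s) = (\<integral>x. \<sigma> x * (z s \<bullet> z s) \<partial>g s)"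
    proof (rule integral_cong_AE)
      show "AE x in g s. x \<bullet> z s = \<sigma> x * (z s \<bullet> z s)"
        using AE by eventually_elim (metis inner_scaleR_left)
    qed (auto intro!: borel_measurable_integrable int[OF s] continuous_intros \<sigma>c)
    then have "(\<integral>x. x \<bullet> z s \<partial>g s) = 0" using bal[OF s] by simp
    moreover have "AE x in g s. x \<in> {z s, - z s}" using AE by eventually_elim auto
    moreover have "z s \<noteq> 0"
    proof
      assume "z s = 0"
      then show False using \<eta>2(2)[of s] s0[OF s] c by (simp add: \<rho>_def c_def dist_norm)
    qed
    ultimately show ?thesis using gP[OF s] by (intro two_atoms_unique) (auto simp: Pc_def)
  qed
  with S show ?thesis by (rule that)
qed

text \<open>\<open>T\<close> is the infimum of the times of disagreement. Agreement before
  \<open>T\<close> extends to \<open>T\<close> itself, and as the trajectory does not vanish there,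
  the local result carries it beyond \<open>T\<close>, contradicting the infimum.\<close>

theorem two_atoms_unique_solution:
  assumes z: "is_trajectory z" "z 0 = (a, 0)" "a \<noteq> 0"
    and g: "mean_field_solution V \<psi> (two_atoms (z 0)) g" and t: "t \<ge> 0"
  shows "g t = two_atoms (z t)"
proof (rule ccontr)
  assume ne: "g t \<noteq> two_atoms (z t)"
  define X where "X = {s. s \<ge> 0 \<and> g s \<noteq> two_atoms (z s)}"
  define T where "T = Inf X"
  have X: "X \<noteq> {}" "bdd_below X" using ne t by (auto simp: X_def bdd_below_def)
  have T: "T \<ge> 0" unfolding T_def using X(1) by (rule cInf_greatest) (simp add: X_def)
  have agree: "g s = two_atoms (z s)" if "0 \<le> s" "s < T" for s
    using cInf_lower[OF _ X(2), of s] that by (force simp: X_def T_def)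
  have nz: "z T \<noteq> 0" by (rule trajectory_nonzero[OF z(1,2) T z(3)])
  have gT: "g T = two_atoms (z T)"
  proof (rule two_atoms_eqI[OF _ nz])
    show "g T \<in> Pc" using g T by (simp add: mean_field_solution_def continuous_curve_Pc_def)
    show "(\<integral>x. \<phi> x \<partial>g T) = (\<integral>x. \<phi> x \<partial>two_atoms (z T))" if "\<phi> \<in> smooth" "bounded {x. \<phi> x \<noteq> 0}" for \<phi>
      by (rule solutions_agree_at_limit[OF two_atoms_solution[OF z(1)] g mean_velocity_two_atoms T agree that])
  qed
  obtain S where S: "S > T" "\<And>s. s \<in> {T..S} \<Longrightarrow> g s = two_atoms (z s)"
    using local_uniqueness[OF z(1) g T gT nz] by blast
  have "s \<ge> S" if "s \<in> X" for s
  proof (rule ccontr)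
    assume "\<not> s \<ge> S"
    then show False using that agree[of s] S(2)[of s] by (cases "s < T") (auto simp: X_def)
  qed
  then have "S \<le> T" unfolding T_def using X(1) by (intro cInf_greatest)
  then show False using S(1) by simp
qed

end

theorem mainTheorem2:
  fixes V :: "real ^ 'd \<Rightarrow> real" and \<psi> :: "real \<Rightarrow> real" and \<psi>_low :: real
  assumes "C_k_on 1 UNIV V"
    and "bdd_below (range V)"
    and "\<forall>x. grad V (- x) = - grad V x"
    and "uniformly_continuous_on UNIV (grad V)"
    and "locally_lipschitz_on UNIV (grad V)"
    and "bounded (range (grad V))"
    and "\<forall>x. x \<noteq> 0 \<longrightarrow> grad V x \<bullet> x < 0"
    and "continuous_on {0..} \<psi>"
    and "\<forall>x\<ge>0. \<psi> x \<ge> 0"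
    and "bounded (\<psi> ` {0..})"
    and "locally_lipschitz_on {0..} \<psi>"
    and "\<psi>_low > 0"
    and "\<forall>x\<ge>0. \<psi> x \<ge> \<psi>_low"
  shows "\<exists>f0\<in>Pc. \<exists>f. mean_field_solution V \<psi> f0 f
    \<and> (\<forall>g. mean_field_solution V \<psi> f0 g \<longrightarrow> (\<forall>t\<ge>0. g t = f t))
    \<and> (\<forall>t :: nat \<Rightarrow> real. (\<forall>n. t n \<ge> 0) \<and> filterlim t at_top sequentially
          \<longrightarrow> \<not> converges_in_P2 (\<lambda>n. f (t n)))"
proof -
  have "V differentiable at x" for x
    using assms(1) by (simp add: differentiable_on_def)
  then interpret mean_field V \<psi> \<psi>_low
    using assms by unfold_locales (auto intro: has_derivative_grad)
  \<comment> \<open>The index type is nonempty, so the dimension is at least 1 and a nonzero vector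
    exists.\<close>
  obtain a :: "real ^ 'd" where a: "a \<noteq> 0" using vector_choose_size[of 1] by force
  obtain z where z: "z 0 = (a, 0)" "is_trajectory z" by (rule trajectory_exists)
  have no_limit: "\<not> converges_in_P2 (\<lambda>n. two_atoms (z (t n)))"
    if t: "\<forall>n. t n \<ge> 0" "filterlim t at_top sequentially" for t :: "nat \<Rightarrow> real"
  proof
    assume "converges_in_P2 (\<lambda>n. two_atoms (z (t n)))"
    then obtain N R where NR: "\<And>n. n \<ge> N \<Longrightarrow> norm (z (t n)) \<le> R"
      using two_atoms_converges_in_P2_imp_bounded[of "\<lambda>n. z (t n)"] by blast
    show False
    \<comment> \<open>The bound holds from \<open>N\<close> on, so the sequence of times is shifted
      by \<open>N\<close>.\<close>
    proof (rule trajectory_unbounded[OF z(2,1) a])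
      show "t (n + N) \<ge> 0" for n using t by simp
      show "filterlim (\<lambda>n. t (n + N)) at_top sequentially"
        by (rule filterlim_compose[OF t(2) filterlim_add_const_nat_at_top])
      show "norm (z (t (n + N))) \<le> R" for n by (rule NR) simp
    qed
  qed
  show ?thesis
  proof (intro bexI[of _ "two_atoms (z 0)"] exI[of _ "\<lambda>t. two_atoms (z t)"] conjI allI impI)
    show "mean_field_solution V \<psi> (two_atoms (z 0)) (\<lambda>t. two_atoms (z t))"
      by (rule two_atoms_solution[OF z(2)])
    show "g t = two_atoms (z t)" if "mean_field_solution V \<psi> (two_atoms (z 0)) g" "t \<ge> 0" for g t
      by (rule two_atoms_unique_solution[OF z(2,1) a that])
    show "\<not> converges_in_P2 (\<lambda>n. two_atoms (z (t n)))"
      if "(\<forall>n. t n \<ge> 0) \<and> filterlim t at_top sequentially" for t :: "nat \<Rightarrow> real"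
      using that by (intro no_limit) auto
    show "two_atoms (z 0) \<in> Pc" by (rule two_atoms_Pc)
  qed
qed

end
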